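(* Let $(A,\Delta)$ be an algebraic quantum group with left integral $\varphi$ and right integral $\psi=\varphi\circ S$, with modular automorphisms $\sigma$ and $\sigma'$ respectively. Let $B=\widehat A$ be the dual of $A$, with modular element $\widehat\delta\in M(B)$. For all $a\in A$ we have $$\langle a,\widehat\delta\rangle=\varepsilon(\sigma^{-1}(a))=\varepsilon({\sigma'}^{-1}(a)),\qquad \langle a,\widehat\delta^{-1}\rangle=\varepsilon(\sigma(a))=\varepsilon(\sigma'(a)),$$ where the pairing is extended to $A\times M(B)$.
   Context: All algebras are associative algebras over $\mathbb C$, possibly non-unital, with non-degenerate product; $M(A)$ is the multiplier algebra of $A$; $\iota$ denotes identity maps. Regular multiplier Hopf algebra: an algebra $A$ with a homomorphism $\Delta:A\to M(A\otimes A)$ such that $\Delta(a)(1\otimes a')$, $(a\otimes 1)\Delta(a')$, $\Delta(a)(a'\otimes 1)$ and $(1\otimes a)\Delta(a')$ lie in $A\otimes A$ for all $a,a'$; $\Delta$ is coassociative, $(a\otimes1\otimes1)(\Delta\otimes\iota)(\Delta(c)(1\otimes a'))=((\iota\otimes\Delta)((a\otimes1)\Delta(c)))(1\otimes1\otimes a')$; and the maps $a\otimes a'\mapsto\Delta(a)(1\otimes a')$, $a\otimes a'\mapsto(a\otimes1)\Delta(a')$, and the same two maps for the flipped coproduct, are bijections of $A\otimes A$. It has a unique counit $\varepsilon:A\to\mathbb C$ (a homomorphism) and antipode $S:A\to A$ (a bijective anti-homomorphism). A left (right) integral is a non-zero linear functional $\varphi$ (resp. $\psi$) on $A$ with $(\iota\otimes\varphi)\Delta(a)=\varphi(a)1$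 (resp. $(\psi\otimes\iota)\Delta(a)=\psi(a)1$) in $M(A)$ for all $a$; integrals are faithful and unique up to a scalar. An algebraic quantum group is a regular multiplier Hopf algebra with integrals. Modular automorphisms: the unique automorphisms $\sigma,\sigma'$ of $A$ with $\varphi(aa')=\varphi(a'\sigma(a))$ and $\psi(aa')=\psi(a'\sigma'(a))$ for all $a,a'$. Dual: $B=\widehat A=\{\varphi(\,\cdot\,c):c\in A\}$, with $\langle a,b\rangle=b(a)$. Its product is $\langle a,bb'\rangle=\langle\Delta(a),b\otimes b'\rangle$; its coproduct $\Delta:B\to M(B\otimes B)$ is determined by $\langle a\otimes a',(b'\otimes1)\Delta(b)\rangle=\langle\Delta(a)(1\otimes a'),b'\otimes b\rangle$ and $\langle a\otimes a',\Delta(b)(1\otimes b')\rangle=\langle(a\otimes1)\Delta(a'),b\otimes b'\rangle$. $(B,\Delta)$ is again an algebraic quantum group. Its right integral $\widehat\psi$ is $\widehat\psi(\varphi(\,\cdot\,a))=\varepsilon(a)$ and its left integral $\widehat\varphi$ is $\widehat\varphi(\psi(S(\,\cdot\,)a))=\varepsilon(a)$; one has $\widehat\psi=\widehat\varphi\circ S$. Its modular element $\widehat\delta$ is the unique invertible element of $M(B)$ with $(\widehat\varphi\otimes\iota)\Delta(b)=\widehat\varphi(b)\widehat\delta$ for all $b\in B$; also $(\iota\otimes\widehat\psi)\Delta(b)=\widehat\psi(b)\widehat\delta^{-1}$. The extended pairing on $A\times M(B)$ is determined by $\langle a,bm\rangle=\langle a\triangleleft b,m\rangle$ and $\langle a,mb\rangle=\langle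 b\triangleright a,m\rangle$ for $a\in A$, $b\in B$, $m\in M(B)$, where $a\triangleleft b=(\langle\,\cdot\,,b\rangle\otimes\iota)\Delta(a)$ and $b\triangleright a=(\iota\otimes\langle\,\cdot\,,b\rangle)\Delta(a)$ are elements of $A$. *)

theory Defs
  imports
    Complex_Main
    "HOL-Library.Function_Algebras"
    "HOL-Library.Product_Plus"
    "HOL-Library.Poly_Mapping"
begin

class complex_vector = ab_group_add +
  fixes scaleC :: "complex \<Rightarrow> 'a \<Rightarrow> 'a" (infixr "*\<^sub>C" 75)
  assumes scaleC_add_right: "c *\<^sub>C (x + y) = c *\<^sub>C x + c *\<^sub>C y"
    and scaleC_add_left: "(c + d) *\<^sub>C x = c *\<^sub>C x + d *\<^sub>C x"
    and scaleC_scaleC: "c *\<^sub>C d *\<^sub>C x = (c * d) *\<^sub>C x"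
    and scaleC_one: "1 *\<^sub>C x = x"

global_interpretation complex_vector:
  vector_space "scaleC :: complex \<Rightarrow> 'a::complex_vector \<Rightarrow> 'a"
  by unfold_locales (rule scaleC_add_right scaleC_add_left scaleC_scaleC scaleC_one)+

instantiation complex :: complex_vector
begin
definition scaleC_complex_def: "c *\<^sub>C (z::complex) = c * z"
instance by standard (simp_all add: scaleC_complex_def algebra_simps)
end

instantiation "fun" :: (type, complex_vector) complex_vector
begin
definition scaleC_fun_def: "c *\<^sub>C f = (\<lambda>x. c *\<^sub>C f x)"
instance by standard
  (simp_all add: scaleC_fun_def plus_fun_def scaleC_add_right scaleC_add_left scaleC_scaleC scaleC_one)
end

instantiation prod :: (complex_vector, complex_vector) complex_vector
begin
definition scaleC_prod_def: "c *\<^sub>C p = (c *\<^sub>C fst p, c *\<^sub>C snd p)"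
instance by standard
  (simp_all add: scaleC_prod_def plus_prod_def scaleC_add_right scaleC_add_left scaleC_scaleC scaleC_one)
end

instantiation poly_mapping :: (type, complex_vector) complex_vector
begin
lift_definition scaleC_poly_mapping :: "complex \<Rightarrow> ('a \<Rightarrow>\<^sub>0 'b) \<Rightarrow> 'a \<Rightarrow>\<^sub>0 'b"
  is "\<lambda>c f x. c *\<^sub>C f x"
proof -
  fix c and f :: "'a \<Rightarrow> 'b"
  assume "finite {x. f x \<noteq> 0}"
  then show "finite {x. c *\<^sub>C f x \<noteq> 0}"
    by (rule rev_finite_subset) auto
qed
instance
  by standard
    (transfer, simp add: fun_eq_iff scaleC_add_right scaleC_add_left scaleC_scaleC scaleC_one)+
end

definition linear_on ::
  "'a::complex_vector set \<Rightarrow> 'b::complex_vector set \<Rightarrow> ('a \<Rightarrow> 'b) \<Rightarrow> bool" where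
  "linear_on V W f \<longleftrightarrow> f ` V \<subseteq> W \<and> (\<forall>x\<in>V. \<forall>y\<in>V. f (x + y) = f x + f y) \<and>
     (\<forall>c. \<forall>x\<in>V. f (c *\<^sub>C x) = c *\<^sub>C f x)"

definition bilinear_on ::
  "'a::complex_vector set \<Rightarrow> 'b::complex_vector set \<Rightarrow> 'c::complex_vector set
    \<Rightarrow> ('a \<Rightarrow> 'b \<Rightarrow> 'c) \<Rightarrow> bool" where
  "bilinear_on V W U f \<longleftrightarrow>
     (\<forall>y\<in>W. linear_on V U (\<lambda>x. f x y)) \<and> (\<forall>x\<in>V. linear_on W U (f x))"

text \<open>The type of tensors is the free vector space on pairs modulo the bilinearity relations.\<close>

definition tensor_relators ::
  "(('a::complex_vector \<times> 'b::complex_vector) \<Rightarrow>\<^sub>0 complex) set" where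
  "tensor_relators =
     {Poly_Mapping.single (x + x', y) 1 - Poly_Mapping.single (x, y) 1
        - Poly_Mapping.single (x', y) 1 | x x' y. True}
   \<union> {Poly_Mapping.single (x, y + y') 1 - Poly_Mapping.single (x, y) 1
        - Poly_Mapping.single (x, y') 1 | x y y'. True}
   \<union> {Poly_Mapping.single (c *\<^sub>C x, y) 1 - Poly_Mapping.single (x, y) c | c x y. True}
   \<union> {Poly_Mapping.single (x, c *\<^sub>C y) 1 - Poly_Mapping.single (x, y) c | c x y. True}"

definition tensor_rel ::
  "(('a::complex_vector \<times> 'b::complex_vector) \<Rightarrow>\<^sub>0 complex) \<Rightarrow> ('a \<times> 'b \<Rightarrow>\<^sub>0 complex) \<Rightarrow> bool" where
  "tensor_rel s t \<longleftrightarrow> s - t \<in> complex_vector.span tensor_relators"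

lemma equivp_tensor_rel: "equivp tensor_rel"
proof (rule equivpI)
  show "reflp tensor_rel"
    by (simp add: reflp_def tensor_rel_def complex_vector.span_zero)
  show "symp tensor_rel"
    unfolding symp_def tensor_rel_def
    using complex_vector.span_neg by fastforce
  show "transp tensor_rel"
    unfolding transp_def tensor_rel_def
    using complex_vector.span_add by fastforce
qed

quotient_type (overloaded) ('a, 'b) tensor =
  "('a::complex_vector \<times> 'b::complex_vector) \<Rightarrow>\<^sub>0 complex" / tensor_rel
  by (rule equivp_tensor_rel)

instantiation tensor :: (complex_vector, complex_vector) complex_vector
begin
lift_definition zero_tensor :: "('a, 'b) tensor" is 0 .
lift_definition plus_tensor :: "('a, 'b) tensor \<Rightarrow> ('a, 'b) tensor \<Rightarrow> ('a, 'b) tensor" is "(+)"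
  unfolding tensor_rel_def using complex_vector.span_add by (fastforce simp: add_diff_add)
lift_definition minus_tensor :: "('a, 'b) tensor \<Rightarrow> ('a, 'b) tensor \<Rightarrow> ('a, 'b) tensor" is "(-)"
proof -
  fix s s' t t' :: "'a \<times> 'b \<Rightarrow>\<^sub>0 complex"
  assume "tensor_rel s s'" "tensor_rel t t'"
  moreover have "(s - t) - (s' - t') = (s - s') - (t - t')" by simp
  ultimately show "tensor_rel (s - t) (s' - t')"
    unfolding tensor_rel_def by (simp only: complex_vector.span_diff)
qed
lift_definition uminus_tensor :: "('a, 'b) tensor \<Rightarrow> ('a, 'b) tensor" is uminus
proof -
  fix s s' :: "'a \<times> 'b \<Rightarrow>\<^sub>0 complex"
  assume "tensor_rel s s'"
  moreover have "(- s) - (- s') = - (s - s')" by simp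
  ultimately show "tensor_rel (- s) (- s')"
    unfolding tensor_rel_def by (simp only: complex_vector.span_neg)
qed
lift_definition scaleC_tensor :: "complex \<Rightarrow> ('a, 'b) tensor \<Rightarrow> ('a, 'b) tensor" is scaleC
proof -
  fix c and s s' :: "'a \<times> 'b \<Rightarrow>\<^sub>0 complex"
  assume "tensor_rel s s'"
  then show "tensor_rel (c *\<^sub>C s) (c *\<^sub>C s')"
    unfolding tensor_rel_def
    by (simp only: complex_vector.scale_right_diff_distrib[symmetric] complex_vector.span_scale)
qed
instance
proof
  fix x y z :: "('a, 'b) tensor" and c d :: complex
  have refl: "s = t \<Longrightarrow> tensor_rel s t" for s t :: "'a \<times> 'b \<Rightarrow>\<^sub>0 complex"
    by (simp add: tensor_rel_def complex_vector.span_zero)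
  show "x + y + z = x + (y + z)" by transfer (rule refl, rule add.assoc)
  show "x + y = y + x" by transfer (rule refl, rule add.commute)
  show "0 + x = x" by transfer (rule refl, rule add_0_left)
  show "- x + x = 0" by transfer (rule refl, rule left_minus)
  show "x - y = x + - y" by transfer (rule refl, rule diff_conv_add_uminus)
  show "c *\<^sub>C (x + y) = c *\<^sub>C x + c *\<^sub>C y" by transfer (rule refl, rule scaleC_add_right)
  show "(c + d) *\<^sub>C x = c *\<^sub>C x + d *\<^sub>C x" by transfer (rule refl, rule scaleC_add_left)
  show "c *\<^sub>C d *\<^sub>C x = (c * d) *\<^sub>C x" by transfer (rule refl, rule scaleC_scaleC)
  show "1 *\<^sub>C x = x" by transfer (rule refl, rule scaleC_one)
qed
end

lift_definition pure_tensor ::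
  "'a::complex_vector \<Rightarrow> 'b::complex_vector \<Rightarrow> ('a, 'b) tensor" (infixr "\<otimes>" 72)
  is "\<lambda>x y. Poly_Mapping.single (x, y) 1" .

text \<open>Over a field the tensor product of two subspaces embeds into the tensor product of the
  ambient spaces.\<close>

definition tensor_space ::
  "'a::complex_vector set \<Rightarrow> 'b::complex_vector set \<Rightarrow> ('a, 'b) tensor set" where
  "tensor_space V W = complex_vector.span {x \<otimes> y | x y. x \<in> V \<and> y \<in> W}"

text \<open>The linear map on \<open>V \<otimes> W\<close> induced by a bilinear map \<open>f\<close> on \<open>V \<times> W\<close>.\<close>

definition tlift ::
  "'a::complex_vector set \<Rightarrow> 'b::complex_vector set \<Rightarrow> ('a \<Rightarrow> 'b \<Rightarrow> 'c::complex_vector)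
    \<Rightarrow> ('a, 'b) tensor \<Rightarrow> 'c" where
  "tlift V W f t = (THE z. \<exists>ps. set ps \<subseteq> V \<times> W \<and>
     t = (\<Sum>(x, y)\<leftarrow>ps. x \<otimes> y) \<and> z = (\<Sum>(x, y)\<leftarrow>ps. f x y))"

definition tmap ::
  "'a::complex_vector set \<Rightarrow> 'b::complex_vector set \<Rightarrow> ('a \<Rightarrow> 'c::complex_vector)
    \<Rightarrow> ('b \<Rightarrow> 'd::complex_vector) \<Rightarrow> ('a, 'b) tensor \<Rightarrow> ('c, 'd) tensor" where
  "tmap V W f g = tlift V W (\<lambda>x y. f x \<otimes> g y)"

definition tflip ::
  "'a::complex_vector set \<Rightarrow> 'b::complex_vector set \<Rightarrow> ('a, 'b) tensor \<Rightarrow> ('b, 'a) tensor" where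
  "tflip V W = tlift V W (\<lambda>x y. y \<otimes> x)"

definition tassoc ::
  "'a::complex_vector set \<Rightarrow> 'b::complex_vector set \<Rightarrow> 'c::complex_vector set
    \<Rightarrow> (('a, 'b) tensor, 'c) tensor \<Rightarrow> ('a, ('b, 'c) tensor) tensor" where
  "tassoc U V W = tlift (tensor_space U V) W (\<lambda>s z. tlift U V (\<lambda>x y. x \<otimes> y \<otimes> z) s)"

text \<open>An algebra is a subspace of an ambient complex vector space together with a product, whose
  values outside the subspace are irrelevant.  There need not be a unit.\<close>

record 'a calg =
  carrier :: "'a set"
  mult :: "'a \<Rightarrow> 'a \<Rightarrow> 'a" (infixl "\<cdot>\<index>" 70)

definition nondegenerate_algebra :: "'a::complex_vector calg \<Rightarrow> bool" where
  "nondegenerate_algebra A \<longleftrightarrow>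
     complex_vector.subspace (carrier A) \<and>
     bilinear_on (carrier A) (carrier A) (carrier A) (mult A) \<and>
     (\<forall>x\<in>carrier A. \<forall>y\<in>carrier A. \<forall>z\<in>carrier A. (x \<cdot>\<^bsub>A\<^esub> y) \<cdot>\<^bsub>A\<^esub> z = x \<cdot>\<^bsub>A\<^esub> (y \<cdot>\<^bsub>A\<^esub> z)) \<and>
     (\<forall>x\<in>carrier A. (\<forall>y\<in>carrier A. x \<cdot>\<^bsub>A\<^esub> y = 0) \<longrightarrow> x = 0) \<and>
     (\<forall>x\<in>carrier A. (\<forall>y\<in>carrier A. y \<cdot>\<^bsub>A\<^esub> x = 0) \<longrightarrow> x = 0)"

definition alg_hom ::
  "'a::complex_vector calg \<Rightarrow> 'b::complex_vector calg \<Rightarrow> ('a \<Rightarrow> 'b) \<Rightarrow> bool" where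
  "alg_hom A B f \<longleftrightarrow> linear_on (carrier A) (carrier B) f \<and>
     (\<forall>x\<in>carrier A. \<forall>y\<in>carrier A. f (x \<cdot>\<^bsub>A\<^esub> y) = f x \<cdot>\<^bsub>B\<^esub> f y)"

definition complex_alg :: "complex calg" where
  "complex_alg = \<lparr>carrier = UNIV, mult = (*)\<rparr>"

definition tensor_alg ::
  "'a::complex_vector calg \<Rightarrow> 'b::complex_vector calg \<Rightarrow> ('a, 'b) tensor calg"
  (infixr "\<otimes>\<^sub>A" 72) where
  "A \<otimes>\<^sub>A B =
     \<lparr>carrier = tensor_space (carrier A) (carrier B),
      mult = (\<lambda>s t. tlift (carrier A) (carrier B) (\<lambda>x y.
               tlift (carrier A) (carrier B) (\<lambda>x' y'. (x \<cdot>\<^bsub>A\<^esub> x') \<otimes> (y \<cdot>\<^bsub>B\<^esub> y')) t) s)\<rparr>"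

text \<open>A multiplier \<open>m\<close> is the pair of maps \<open>x \<mapsto> m x\<close> and \<open>x \<mapsto> x m\<close>, extended by zero outside
  the algebra, so that equality of multipliers is equality in HOL and multipliers form a subspace
  of a function space.\<close>

type_synonym 'a multiplier = "('a \<Rightarrow> 'a) \<times> ('a \<Rightarrow> 'a)"

definition mult_alg :: "'a::complex_vector calg \<Rightarrow> 'a multiplier calg" where
  "mult_alg A =
     \<lparr>carrier = {(L, R). linear_on (carrier A) (carrier A) L \<and> linear_on (carrier A) (carrier A) R \<and>
        (\<forall>x. x \<notin> carrier A \<longrightarrow> L x = 0 \<and> R x = 0) \<and>
        (\<forall>x\<in>carrier A. \<forall>y\<in>carrier A. x \<cdot>\<^bsub>A\<^esub> L y = R x \<cdot>\<^bsub>A\<^esub> y)},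
      mult = (\<lambda>m n. (fst m \<circ> fst n, snd n \<circ> snd m))\<rparr>"

definition mult_one :: "'a::complex_vector calg \<Rightarrow> 'a multiplier" where
  "mult_one A = (\<lambda>x. if x \<in> carrier A then x else 0, \<lambda>x. if x \<in> carrier A then x else 0)"

definition embed :: "'a::complex_vector calg \<Rightarrow> 'a \<Rightarrow> 'a multiplier" where
  "embed A a = (\<lambda>x. if x \<in> carrier A then a \<cdot>\<^bsub>A\<^esub> x else 0, \<lambda>x. if x \<in> carrier A then x \<cdot>\<^bsub>A\<^esub> a else 0)"

definition in_alg :: "'a::complex_vector calg \<Rightarrow> 'a multiplier \<Rightarrow> bool" where
  "in_alg A m \<longleftrightarrow> m \<in> embed A ` carrier A"

definition unembed :: "'a::complex_vector calg \<Rightarrow> 'a multiplier \<Rightarrow> 'a" where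
  "unembed A = inv_into (carrier A) (embed A)"

definition mult_tensor ::
  "'a::complex_vector calg \<Rightarrow> 'b::complex_vector calg \<Rightarrow> 'a multiplier \<Rightarrow> 'b multiplier
    \<Rightarrow> ('a, 'b) tensor multiplier" where
  "mult_tensor A B m n =
     (\<lambda>t. if t \<in> carrier (A \<otimes>\<^sub>A B) then tmap (carrier A) (carrier B) (fst m) (fst n) t else 0,
      \<lambda>t. if t \<in> carrier (A \<otimes>\<^sub>A B) then tmap (carrier A) (carrier B) (snd m) (snd n) t else 0)"

text \<open>Transport of multipliers along an isomorphism \<open>f\<close> from \<open>A\<close> onto \<open>B\<close>.\<close>

definition mult_transport ::
  "'a::complex_vector calg \<Rightarrow> 'b::complex_vector calg \<Rightarrow> ('a \<Rightarrow> 'b) \<Rightarrow> 'a multiplier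
    \<Rightarrow> 'b multiplier" where
  "mult_transport A B f m =
     (\<lambda>y. if y \<in> carrier B then f (fst m (inv_into (carrier A) f y)) else 0,
      \<lambda>y. if y \<in> carrier B then f (snd m (inv_into (carrier A) f y)) else 0)"

type_synonym 'a coproduct = "'a \<Rightarrow> ('a, 'a) tensor multiplier"

text \<open>\<open>in_left A a\<close> and \<open>in_right A a\<close> are the multipliers \<open>a \<otimes> 1\<close> and \<open>1 \<otimes> a\<close> of \<open>A \<otimes> A\<close>.\<close>

definition in_left :: "'a::complex_vector calg \<Rightarrow> 'a \<Rightarrow> ('a, 'a) tensor multiplier" where
  "in_left A a = mult_tensor A A (embed A a) (mult_one A)"

definition in_right :: "'a::complex_vector calg \<Rightarrow> 'a \<Rightarrow> ('a, 'a) tensor multiplier" where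
  "in_right A a = mult_tensor A A (mult_one A) (embed A a)"

abbreviation M2 :: "'a::complex_vector calg \<Rightarrow> ('a, 'a) tensor multiplier calg" where
  "M2 A \<equiv> mult_alg (A \<otimes>\<^sub>A A)"

text \<open>\<open>\<Delta>(a)(1 \<otimes> a')\<close> and \<open>(a \<otimes> 1)\<Delta>(a')\<close> as elements of \<open>A \<otimes> A\<close>.\<close>

definition cov_right ::
  "'a::complex_vector calg \<Rightarrow> 'a coproduct \<Rightarrow> 'a \<Rightarrow> 'a \<Rightarrow> ('a, 'a) tensor" where
  "cov_right A \<Delta> a a' = unembed (A \<otimes>\<^sub>A A) (\<Delta> a \<cdot>\<^bsub>M2 A\<^esub> in_right A a')"

definition cov_left ::
  "'a::complex_vector calg \<Rightarrow> 'a coproduct \<Rightarrow> 'a \<Rightarrow> 'a \<Rightarrow> ('a, 'a) tensor" where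
  "cov_left A \<Delta> a a' = unembed (A \<otimes>\<^sub>A A) (in_left A a \<cdot>\<^bsub>M2 A\<^esub> \<Delta> a')"

definition flip_coproduct ::
  "'a::complex_vector calg \<Rightarrow> 'a coproduct \<Rightarrow> 'a coproduct" where
  "flip_coproduct A \<Delta> a =
     mult_transport (A \<otimes>\<^sub>A A) (A \<otimes>\<^sub>A A) (tflip (carrier A) (carrier A)) (\<Delta> a)"

definition coassociative :: "'a::complex_vector calg \<Rightarrow> 'a coproduct \<Rightarrow> bool" where
  "coassociative A \<Delta> \<longleftrightarrow> (\<forall>a\<in>carrier A. \<forall>a'\<in>carrier A. \<forall>c\<in>carrier A.
     mult_transport ((A \<otimes>\<^sub>A A) \<otimes>\<^sub>A A) (A \<otimes>\<^sub>A A \<otimes>\<^sub>A A) (tassoc (carrier A) (carrier A) (carrier A))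
       (mult_tensor (A \<otimes>\<^sub>A A) A (in_left A a) (mult_one A)
         \<cdot>\<^bsub>mult_alg ((A \<otimes>\<^sub>A A) \<otimes>\<^sub>A A)\<^esub>
         tlift (carrier A) (carrier A) (\<lambda>x y. mult_tensor (A \<otimes>\<^sub>A A) A (\<Delta> x) (embed A y))
           (cov_right A \<Delta> c a'))
     = tlift (carrier A) (carrier A) (\<lambda>x y. mult_tensor A (A \<otimes>\<^sub>A A) (embed A x) (\<Delta> y))
           (cov_left A \<Delta> a c)
         \<cdot>\<^bsub>mult_alg (A \<otimes>\<^sub>A A \<otimes>\<^sub>A A)\<^esub>
         mult_tensor A (A \<otimes>\<^sub>A A) (mult_one A) (in_right A a'))"

definition canonical_maps_bijective :: "'a::complex_vector calg \<Rightarrow> 'a coproduct \<Rightarrow> bool" where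
  "canonical_maps_bijective A \<Delta> \<longleftrightarrow>
     bij_betw (tlift (carrier A) (carrier A) (cov_right A \<Delta>))
       (carrier (A \<otimes>\<^sub>A A)) (carrier (A \<otimes>\<^sub>A A)) \<and>
     bij_betw (tlift (carrier A) (carrier A) (cov_left A \<Delta>))
       (carrier (A \<otimes>\<^sub>A A)) (carrier (A \<otimes>\<^sub>A A))"

definition regular_multiplier_hopf_algebra ::
  "'a::complex_vector calg \<Rightarrow> 'a coproduct \<Rightarrow> bool" where
  "regular_multiplier_hopf_algebra A \<Delta> \<longleftrightarrow>
     nondegenerate_algebra A \<and>
     alg_hom A (M2 A) \<Delta> \<and>
     (\<forall>a\<in>carrier A. \<forall>a'\<in>carrier A.
        in_alg (A \<otimes>\<^sub>A A) (\<Delta> a \<cdot>\<^bsub>M2 A\<^esub> in_right A a') \<and>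
        in_alg (A \<otimes>\<^sub>A A) (in_left A a \<cdot>\<^bsub>M2 A\<^esub> \<Delta> a') \<and>
        in_alg (A \<otimes>\<^sub>A A) (\<Delta> a \<cdot>\<^bsub>M2 A\<^esub> in_left A a') \<and>
        in_alg (A \<otimes>\<^sub>A A) (in_right A a \<cdot>\<^bsub>M2 A\<^esub> \<Delta> a')) \<and>
     coassociative A \<Delta> \<and>
     canonical_maps_bijective A \<Delta> \<and>
     canonical_maps_bijective A (flip_coproduct A \<Delta>)"

text \<open>\<open>\<omega> \<otimes> \<iota>\<close> and \<open>\<iota> \<otimes> \<omega>\<close>, first on \<open>A \<otimes> A\<close> and then on multipliers \<open>m\<close> of \<open>A \<otimes> A\<close>.  The value
  in the latter case is the multiplier of \<open>A\<close> given by
  \<open>((\<omega> \<otimes> \<iota>) m) x = (\<omega> \<otimes> \<iota>)(m (1 \<otimes> x))\<close> and \<open>x ((\<omega> \<otimes> \<iota>) m) = (\<omega> \<otimes> \<iota>)((1 \<otimes> x) m)\<close>.\<close>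

definition slice_left ::
  "'a::complex_vector calg \<Rightarrow> ('a \<Rightarrow> complex) \<Rightarrow> ('a, 'a) tensor \<Rightarrow> 'a" where
  "slice_left A \<omega> = tlift (carrier A) (carrier A) (\<lambda>x y. \<omega> x *\<^sub>C y)"

definition slice_right ::
  "'a::complex_vector calg \<Rightarrow> ('a \<Rightarrow> complex) \<Rightarrow> ('a, 'a) tensor \<Rightarrow> 'a" where
  "slice_right A \<omega> = tlift (carrier A) (carrier A) (\<lambda>x y. \<omega> y *\<^sub>C x)"

definition mslice_left ::
  "'a::complex_vector calg \<Rightarrow> ('a \<Rightarrow> complex) \<Rightarrow> ('a, 'a) tensor multiplier \<Rightarrow> 'a multiplier" where
  "mslice_left A \<omega> m =
     (\<lambda>x. if x \<in> carrier A
            then slice_left A \<omega> (unembed (A \<otimes>\<^sub>A A) (m \<cdot>\<^bsub>M2 A\<^esub> in_right A x)) else 0,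
      \<lambda>x. if x \<in> carrier A
            then slice_left A \<omega> (unembed (A \<otimes>\<^sub>A A) (in_right A x \<cdot>\<^bsub>M2 A\<^esub> m)) else 0)"

definition mslice_right ::
  "'a::complex_vector calg \<Rightarrow> ('a \<Rightarrow> complex) \<Rightarrow> ('a, 'a) tensor multiplier \<Rightarrow> 'a multiplier" where
  "mslice_right A \<omega> m =
     (\<lambda>x. if x \<in> carrier A
            then slice_right A \<omega> (unembed (A \<otimes>\<^sub>A A) (m \<cdot>\<^bsub>M2 A\<^esub> in_left A x)) else 0,
      \<lambda>x. if x \<in> carrier A
            then slice_right A \<omega> (unembed (A \<otimes>\<^sub>A A) (in_left A x \<cdot>\<^bsub>M2 A\<^esub> m)) else 0)"

definition is_counit ::
  "'a::complex_vector calg \<Rightarrow> 'a coproduct \<Rightarrow> ('a \<Rightarrow> complex) \<Rightarrow> bool" where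
  "is_counit A \<Delta> \<epsilon> \<longleftrightarrow> alg_hom A complex_alg \<epsilon> \<and>
     (\<forall>a\<in>carrier A. \<forall>a'\<in>carrier A.
        slice_left A \<epsilon> (cov_right A \<Delta> a a') = a \<cdot>\<^bsub>A\<^esub> a' \<and>
        slice_right A \<epsilon> (cov_left A \<Delta> a a') = a \<cdot>\<^bsub>A\<^esub> a')"

definition is_antipode ::
  "'a::complex_vector calg \<Rightarrow> 'a coproduct \<Rightarrow> ('a \<Rightarrow> complex) \<Rightarrow> ('a \<Rightarrow> 'a) \<Rightarrow> bool" where
  "is_antipode A \<Delta> \<epsilon> S \<longleftrightarrow>
     linear_on (carrier A) (carrier A) S \<and> bij_betw S (carrier A) (carrier A) \<and>
     (\<forall>a\<in>carrier A. \<forall>a'\<in>carrier A. S (a \<cdot>\<^bsub>A\<^esub> a') = S a' \<cdot>\<^bsub>A\<^esub> S a) \<and>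
     (\<forall>a\<in>carrier A. \<forall>a'\<in>carrier A.
        tlift (carrier A) (carrier A) (\<lambda>x y. S x \<cdot>\<^bsub>A\<^esub> y) (cov_right A \<Delta> a a') = \<epsilon> a *\<^sub>C a' \<and>
        tlift (carrier A) (carrier A) (\<lambda>x y. x \<cdot>\<^bsub>A\<^esub> S y) (cov_left A \<Delta> a a') = \<epsilon> a' *\<^sub>C a)"

definition left_integral ::
  "'a::complex_vector calg \<Rightarrow> 'a coproduct \<Rightarrow> ('a \<Rightarrow> complex) \<Rightarrow> bool" where
  "left_integral A \<Delta> \<phi> \<longleftrightarrow> linear_on (carrier A) UNIV \<phi> \<and> (\<exists>a\<in>carrier A. \<phi> a \<noteq> 0) \<and>
     (\<forall>a\<in>carrier A. mslice_right A \<phi> (\<Delta> a) = \<phi> a *\<^sub>C mult_one A)"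

definition right_integral ::
  "'a::complex_vector calg \<Rightarrow> 'a coproduct \<Rightarrow> ('a \<Rightarrow> complex) \<Rightarrow> bool" where
  "right_integral A \<Delta> \<psi> \<longleftrightarrow> linear_on (carrier A) UNIV \<psi> \<and> (\<exists>a\<in>carrier A. \<psi> a \<noteq> 0) \<and>
     (\<forall>a\<in>carrier A. mslice_left A \<psi> (\<Delta> a) = \<psi> a *\<^sub>C mult_one A)"

definition algebraic_quantum_group ::
  "'a::complex_vector calg \<Rightarrow> 'a coproduct \<Rightarrow> bool" where
  "algebraic_quantum_group A \<Delta> \<longleftrightarrow> regular_multiplier_hopf_algebra A \<Delta> \<and>
     (\<exists>\<phi>. left_integral A \<Delta> \<phi>) \<and> (\<exists>\<psi>. right_integral A \<Delta> \<psi>)"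

definition modular_automorphism ::
  "'a::complex_vector calg \<Rightarrow> ('a \<Rightarrow> complex) \<Rightarrow> ('a \<Rightarrow> 'a) \<Rightarrow> bool" where
  "modular_automorphism A \<omega> \<sigma> \<longleftrightarrow> alg_hom A A \<sigma> \<and> bij_betw \<sigma> (carrier A) (carrier A) \<and>
     (\<forall>a\<in>carrier A. \<forall>a'\<in>carrier A. \<omega> (a \<cdot>\<^bsub>A\<^esub> a') = \<omega> (a' \<cdot>\<^bsub>A\<^esub> \<sigma> a))"

definition mult_invertible :: "'a::complex_vector calg \<Rightarrow> 'a multiplier \<Rightarrow> bool" where
  "mult_invertible A m \<longleftrightarrow> m \<in> carrier (mult_alg A) \<and>
     (\<exists>n\<in>carrier (mult_alg A). m \<cdot>\<^bsub>mult_alg A\<^esub> n = mult_one A \<and> n \<cdot>\<^bsub>mult_alg A\<^esub> m = mult_one A)"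

definition mult_inverse :: "'a::complex_vector calg \<Rightarrow> 'a multiplier \<Rightarrow> 'a multiplier" where
  "mult_inverse A m = (THE n. n \<in> carrier (mult_alg A) \<and>
     m \<cdot>\<^bsub>mult_alg A\<^esub> n = mult_one A \<and> n \<cdot>\<^bsub>mult_alg A\<^esub> m = mult_one A)"

definition modular_element ::
  "'a::complex_vector calg \<Rightarrow> 'a coproduct \<Rightarrow> ('a \<Rightarrow> complex) \<Rightarrow> 'a multiplier \<Rightarrow> bool" where
  "modular_element A \<Delta> \<phi> \<delta> \<longleftrightarrow> mult_invertible A \<delta> \<and>
     (\<forall>a\<in>carrier A. mslice_left A \<phi> (\<Delta> a) = \<phi> a *\<^sub>C \<delta>)"

text \<open>\<open>dual_fun A \<phi> c\<close> is the functional \<open>\<phi>(\<cdot> c)\<close> on \<open>A\<close>, extended by zero.\<close>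

definition dual_fun ::
  "'a::complex_vector calg \<Rightarrow> ('a \<Rightarrow> complex) \<Rightarrow> 'a \<Rightarrow> 'a \<Rightarrow> complex" where
  "dual_fun A \<phi> c = (\<lambda>a. if a \<in> carrier A then \<phi> (a \<cdot>\<^bsub>A\<^esub> c) else 0)"

text \<open>For \<open>b = \<phi>(\<cdot> c)\<close> and \<open>b' = \<phi>(\<cdot> c')\<close> the functional \<open>b \<otimes> b'\<close> extends to a multiplier \<open>m\<close> of
  \<open>A \<otimes> A\<close> by \<open>\<langle>m, b \<otimes> b'\<rangle> = (\<phi> \<otimes> \<phi>)(m (c \<otimes> c'))\<close>.\<close>

definition pair_multiplier ::
  "'a::complex_vector calg \<Rightarrow> ('a \<Rightarrow> complex) \<Rightarrow> ('a, 'a) tensor multiplier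
    \<Rightarrow> ('a \<Rightarrow> complex) \<Rightarrow> ('a \<Rightarrow> complex) \<Rightarrow> complex" where
  "pair_multiplier A \<phi> m b b' =
     (let c = inv_into (carrier A) (dual_fun A \<phi>) b;
          c' = inv_into (carrier A) (dual_fun A \<phi>) b'
      in tlift (carrier A) (carrier A) (\<lambda>x y. \<phi> x * \<phi> y) (fst m (c \<otimes> c')))"

definition dual_alg ::
  "'a::complex_vector calg \<Rightarrow> 'a coproduct \<Rightarrow> ('a \<Rightarrow> complex) \<Rightarrow> ('a \<Rightarrow> complex) calg" where
  "dual_alg A \<Delta> \<phi> =
     \<lparr>carrier = dual_fun A \<phi> ` carrier A,
      mult = (\<lambda>b b' a. if a \<in> carrier A then pair_multiplier A \<phi> (\<Delta> a) b b' else 0)\<rparr>"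

definition tensor_pairing ::
  "'a::complex_vector calg \<Rightarrow> ('a \<Rightarrow> complex) calg
    \<Rightarrow> ('a, 'a) tensor \<Rightarrow> ('a \<Rightarrow> complex, 'a \<Rightarrow> complex) tensor \<Rightarrow> complex" where
  "tensor_pairing A B s t =
     tlift (carrier A) (carrier A) (\<lambda>a a'. tlift (carrier B) (carrier B) (\<lambda>b b'. b a * b' a') t) s"

definition dual_coproduct ::
  "'a::complex_vector calg \<Rightarrow> 'a coproduct \<Rightarrow> ('a \<Rightarrow> complex) \<Rightarrow> ('a \<Rightarrow> complex) coproduct \<Rightarrow> bool" where
  "dual_coproduct A \<Delta> \<phi> \<Delta>' \<longleftrightarrow> (let B = dual_alg A \<Delta> \<phi> in
     \<forall>b\<in>carrier B. \<Delta>' b \<in> carrier (M2 B) \<and>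
       (\<forall>b'\<in>carrier B.
          in_alg (B \<otimes>\<^sub>A B) (in_left B b' \<cdot>\<^bsub>M2 B\<^esub> \<Delta>' b) \<and>
          in_alg (B \<otimes>\<^sub>A B) (\<Delta>' b \<cdot>\<^bsub>M2 B\<^esub> in_right B b') \<and>
          (\<forall>a\<in>carrier A. \<forall>a'\<in>carrier A.
             tensor_pairing A B (a \<otimes> a') (cov_left B \<Delta>' b' b)
               = tensor_pairing A B (cov_right A \<Delta> a a') (b' \<otimes> b) \<and>
             tensor_pairing A B (a \<otimes> a') (cov_right B \<Delta>' b b')
               = tensor_pairing A B (cov_left A \<Delta> a a') (b \<otimes> b'))))"

definition dual_left_integral ::
  "'a::complex_vector calg \<Rightarrow> ('a \<Rightarrow> complex) \<Rightarrow> ('a \<Rightarrow> 'a) \<Rightarrow> ('a \<Rightarrow> complex)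
    \<Rightarrow> (('a \<Rightarrow> complex) \<Rightarrow> complex) \<Rightarrow> bool" where
  "dual_left_integral A \<psi> S \<epsilon> \<phi>' \<longleftrightarrow>
     (\<forall>a\<in>carrier A. \<phi>' (\<lambda>x. if x \<in> carrier A then \<psi> (S x \<cdot>\<^bsub>A\<^esub> a) else 0) = \<epsilon> a)"

text \<open>The actions \<open>a \<triangleleft> b = (b \<otimes> \<iota>)\<Delta>(a)\<close> and \<open>b \<triangleright> a = (\<iota> \<otimes> b)\<Delta>(a)\<close> of the dual on \<open>A\<close>.\<close>

definition right_action ::
  "'a::complex_vector calg \<Rightarrow> 'a coproduct \<Rightarrow> 'a \<Rightarrow> ('a \<Rightarrow> complex) \<Rightarrow> 'a" where
  "right_action A \<Delta> a b = unembed A (mslice_left A b (\<Delta> a))"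

definition left_action ::
  "'a::complex_vector calg \<Rightarrow> 'a coproduct \<Rightarrow> ('a \<Rightarrow> complex) \<Rightarrow> 'a \<Rightarrow> 'a" where
  "left_action A \<Delta> b a = unembed A (mslice_right A b (\<Delta> a))"

text \<open>The extension of the pairing \<open>\<langle>a, b\<rangle> = b a\<close> from \<open>A \<times> B\<close> to \<open>A \<times> M(B)\<close>.\<close>

definition extended_pairing ::
  "'a::complex_vector calg \<Rightarrow> 'a coproduct \<Rightarrow> ('a \<Rightarrow> complex)
    \<Rightarrow> ('a \<Rightarrow> ('a \<Rightarrow> complex) multiplier \<Rightarrow> complex) \<Rightarrow> bool" where
  "extended_pairing A \<Delta> \<phi> P \<longleftrightarrow> (let B = dual_alg A \<Delta> \<phi> in
     bilinear_on (carrier A) (carrier (mult_alg B)) UNIV P \<and>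
     (\<forall>a\<in>carrier A. \<forall>b\<in>carrier B. P a (embed B b) = b a) \<and>
     (\<forall>a\<in>carrier A. \<forall>b\<in>carrier B. \<forall>m\<in>carrier (mult_alg B).
        P a (embed B b \<cdot>\<^bsub>mult_alg B\<^esub> m) = P (right_action A \<Delta> a b) m \<and>
        P a (m \<cdot>\<^bsub>mult_alg B\<^esub> embed B b) = P (left_action A \<Delta> b a) m))"

end

theory Submission
  imports Defs
begin

text \<open>
  Put \<open>\<chi> = \<epsilon> \<circ> \<sigma>\<^sup>-\<^sup>1\<close> and \<open>\<eta> = \<epsilon> \<circ> \<sigma>\<close>; both are characters of \<open>A\<close>.  Every element of the dual has
  a left form \<open>\<phi>(c \<cdot>)\<close> and a right form \<open>\<phi>(\<cdot> d)\<close>, with \<open>d = \<sigma>(c)\<close>.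

  The pairing with \<open>\<delta>\<close>.  Let \<open>b = \<phi>(c \<cdot>)\<close>.  Pairing the second leg of \<open>\<Delta>(b)(1 \<otimes> b')\<close> with \<open>a\<close> leaves the
  functional \<open>\<phi>(c \<cdot> z)\<close> with \<open>z = b' \<triangleright> a\<close>, which is \<open>\<phi>(\<sigma>\<^sup>-\<^sup>1(z) c \<cdot>)\<close>.  The left integral of the dual sends
  \<open>\<phi>(w \<cdot>)\<close> to a fixed multiple of \<open>\<epsilon>(w)\<close>, hence this one to a multiple of \<open>\<chi>(z) \<epsilon>(c)\<close>.  By definition of
  \<open>\<delta>\<close> this means \<open>\<langle>a, \<delta> b'\<rangle> = \<chi>(b' \<triangleright> a)\<close>, and the elements \<open>b' \<triangleright> a\<close> span \<open>A\<close> (\<open>fst_modular\<close>,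
  \<open>pairing_modular\<close>).

  The pairing with \<open>\<delta>\<^sup>-\<^sup>1\<close>.  The relation \<open>\<Delta>(\<sigma>(a)) = (S\<^sup>2 \<otimes> \<sigma>)\<Delta>(a)\<close> (\<open>Q_sigma\<close>) turns the formula for \<open>\<delta>\<close>
  into \<open>b \<delta> = b \<circ> S\<^sup>2 \<circ> \<sigma>\<^sup>-\<^sup>1\<close>.  This can be solved, \<open>b \<delta>\<^sup>-\<^sup>1 = b \<circ> \<sigma> \<circ> S\<^sup>-\<^sup>2\<close>, and the same relation reads
  the right side as \<open>a \<mapsto> \<eta>(a \<triangleleft> b)\<close> (\<open>pairing_modular_inverse\<close>).

  Comparison of \<open>\<sigma>\<close> and \<open>\<sigma>'\<close>.  Since \<open>\<psi> = \<phi> \<circ> S\<close>, one has \<open>\<sigma>' = S\<^sup>-\<^sup>1 \<sigma>\<^sup>-\<^sup>1 S\<close>, and both remaining equations follow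
  from \<open>\<chi> \<circ> S = \<eta>\<close> (\<open>chi_S\<close>): the two sides are convolution inverses of \<open>\<chi>\<close>, the left one by the
  antipode axiom, the right one by the relation for \<open>\<Delta> \<circ> \<sigma>\<close>.

  The source of all this is the formula \<open>S((\<iota> \<otimes> \<phi>)(\<Delta>(a)(1 \<otimes> b))) = (\<iota> \<otimes> \<phi>)((1 \<otimes> a)\<Delta>(b))\<close> (\<open>S_E\<close>).  It gives
  faithfulness of \<open>\<phi>\<close>, the proportionality of \<open>\<psi> \<circ> S\<close> and \<open>\<phi>\<close>, hence that \<open>\<sigma>\<close> commutes with \<open>S\<^sup>2\<close>, and the
  relation for \<open>\<Delta> \<circ> \<sigma>\<close>.

  Multipliers of \<open>A \<otimes> A\<close> are used only to derive identities between the covered coproducts \<open>(y \<otimes> 1)\<Delta>(a)\<close>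
  and \<open>\<Delta>(a)(1 \<otimes> x)\<close>, which are elements of \<open>A \<otimes> A\<close>.  From then on an identity between linear maps on
  \<open>A \<otimes> A\<close> is checked either on pure tensors or on the covered coproducts, which span because the canonical
  maps are onto.
\<close>

section \<open>Linear maps on tensor products of subspaces\<close>

lemma linear_onI:
  assumes "\<And>x. x \<in> V \<Longrightarrow> f x \<in> W"
    and "\<And>x y. x \<in> V \<Longrightarrow> y \<in> V \<Longrightarrow> f (x + y) = f x + f y"
    and "\<And>c x. x \<in> V \<Longrightarrow> f (c *\<^sub>C x) = c *\<^sub>C f x"
  shows "linear_on V W f"
  using assms by (auto simp: linear_on_def)

lemma linear_on_mem: "linear_on V W f \<Longrightarrow> x \<in> V \<Longrightarrow> f x \<in> W"
  by (auto simp: linear_on_def)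

lemma linear_on_add: "linear_on V W f \<Longrightarrow> x \<in> V \<Longrightarrow> y \<in> V \<Longrightarrow> f (x + y) = f x + f y"
  by (auto simp: linear_on_def)

lemma linear_on_scaleC: "linear_on V W f \<Longrightarrow> x \<in> V \<Longrightarrow> f (c *\<^sub>C x) = c *\<^sub>C f x"
  by (auto simp: linear_on_def)

lemmas linear_rules = linear_on_mem linear_on_add linear_on_scaleC

lemma bilinear_onI:
  assumes "\<And>x y. x \<in> V \<Longrightarrow> y \<in> W \<Longrightarrow> f x y \<in> U"
    and "\<And>x x' y. x \<in> V \<Longrightarrow> x' \<in> V \<Longrightarrow> y \<in> W \<Longrightarrow> f (x + x') y = f x y + f x' y"
    and "\<And>c x y. x \<in> V \<Longrightarrow> y \<in> W \<Longrightarrow> f (c *\<^sub>C x) y = c *\<^sub>C f x y"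
    and "\<And>x y y'. x \<in> V \<Longrightarrow> y \<in> W \<Longrightarrow> y' \<in> W \<Longrightarrow> f x (y + y') = f x y + f x y'"
    and "\<And>c x y. x \<in> V \<Longrightarrow> y \<in> W \<Longrightarrow> f x (c *\<^sub>C y) = c *\<^sub>C f x y"
  shows "bilinear_on V W U f"
  using assms by (auto simp: bilinear_on_def linear_on_def)

lemma bilinear_onD:
  assumes "bilinear_on V W U f"
  shows "x \<in> V \<Longrightarrow> y \<in> W \<Longrightarrow> f x y \<in> U"
    and "x \<in> V \<Longrightarrow> x' \<in> V \<Longrightarrow> y \<in> W \<Longrightarrow> f (x + x') y = f x y + f x' y"
    and "x \<in> V \<Longrightarrow> y \<in> W \<Longrightarrow> f (c *\<^sub>C x) y = c *\<^sub>C f x y"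
    and "x \<in> V \<Longrightarrow> y \<in> W \<Longrightarrow> y' \<in> W \<Longrightarrow> f x (y + y') = f x y + f x y'"
    and "x \<in> V \<Longrightarrow> y \<in> W \<Longrightarrow> f x (c *\<^sub>C y) = c *\<^sub>C f x y"
  using assms unfolding bilinear_on_def by (blast dest: linear_on_mem linear_on_add linear_on_scaleC)+

lemma linear_on_UNIV: "linear_on V W f \<Longrightarrow> linear_on V UNIV f"
  by (auto simp: linear_on_def)

lemma bilinear_on_UNIV: "bilinear_on V W U f \<Longrightarrow> bilinear_on V W UNIV f"
  by (auto simp: bilinear_on_def intro: linear_on_UNIV)

lemmas subspace_mem = complex_vector.subspace_add complex_vector.subspace_scale
  complex_vector.subspace_0 complex_vector.subspace_diff

lemma linear_on_zero:
  assumes "linear_on V W f" "complex_vector.subspace V" shows "f 0 = 0"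
  using linear_on_scaleC[OF assms(1), of 0 0] complex_vector.subspace_0[OF assms(2)] by simp

lemma linear_on_diff:
  assumes "linear_on V W f" "complex_vector.subspace V" "x \<in> V" "y \<in> V"
  shows "f (x - y) = f x - f y"
proof -
  have "f (x + (-1) *\<^sub>C y) = f x + (-1) *\<^sub>C f y"
    using assms by (simp add: linear_on_add linear_on_scaleC complex_vector.subspace_scale
      del: complex_vector.scale_minus_left)
  then show ?thesis by (simp add: scaleC_one)
qed

lemma linear_on_sum:
  assumes f: "linear_on V W f" and V: "complex_vector.subspace V" and g: "\<And>k. k \<in> K \<Longrightarrow> g k \<in> V"
  shows "f (\<Sum>k\<in>K. g k) = (\<Sum>k\<in>K. f (g k))"
  using g
proof (induction K rule: infinite_finite_induct)
  case (insert k K)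
  have "(\<Sum>k\<in>K. g k) \<in> V" using insert by (intro complex_vector.subspace_sum[OF V]) simp
  then show ?case using insert by (simp add: linear_on_add[OF f])
qed (simp_all add: linear_on_zero[OF f V])

lemma pure_tensor_add_left: "(x + x') \<otimes> y = x \<otimes> y + x' \<otimes> y"
proof (transfer, unfold tensor_rel_def diff_diff_eq[symmetric], rule complex_vector.span_base)
  fix x x' :: 'a and y :: 'b
  show "Poly_Mapping.single (x + x', y) 1 - Poly_Mapping.single (x, y) 1
      - Poly_Mapping.single (x', y) 1 \<in> tensor_relators"
    unfolding tensor_relators_def by blast
qed

lemma pure_tensor_add_right: "x \<otimes> (y + y') = x \<otimes> y + x \<otimes> y'"
proof (transfer, unfold tensor_rel_def diff_diff_eq[symmetric], rule complex_vector.span_base)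
  fix x :: 'a and y y' :: 'b
  show "Poly_Mapping.single (x, y + y') 1 - Poly_Mapping.single (x, y) 1
      - Poly_Mapping.single (x, y') 1 \<in> tensor_relators"
    unfolding tensor_relators_def by blast
qed

lemma scaleC_single: "c *\<^sub>C Poly_Mapping.single p (d::complex) = Poly_Mapping.single p (c * d)"
  by transfer (simp add: fun_eq_iff when_def scaleC_complex_def)

lemma pure_tensor_scaleC_left: "(c *\<^sub>C x) \<otimes> y = c *\<^sub>C (x \<otimes> y)"
proof (transfer, unfold tensor_rel_def scaleC_single mult_1_right, rule complex_vector.span_base)
  fix c and x :: 'a and y :: 'b
  show "Poly_Mapping.single (c *\<^sub>C x, y) 1 - Poly_Mapping.single (x, y) c \<in> tensor_relators"
    unfolding tensor_relators_def by blast
qed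

lemma pure_tensor_scaleC_right: "x \<otimes> (c *\<^sub>C y) = c *\<^sub>C (x \<otimes> y)"
proof (transfer, unfold tensor_rel_def scaleC_single mult_1_right, rule complex_vector.span_base)
  fix c and x :: 'a and y :: 'b
  show "Poly_Mapping.single (x, c *\<^sub>C y) 1 - Poly_Mapping.single (x, y) c \<in> tensor_relators"
    unfolding tensor_relators_def by blast
qed

definition free_lift :: "('p \<Rightarrow> 'c::complex_vector) \<Rightarrow> ('p \<Rightarrow>\<^sub>0 complex) \<Rightarrow> 'c" where
  "free_lift g s = (\<Sum>p\<in>Poly_Mapping.keys s. Poly_Mapping.lookup s p *\<^sub>C g p)"

lemma free_lift_superset:
  assumes "finite K" "Poly_Mapping.keys s \<subseteq> K"
  shows "free_lift g s = (\<Sum>p\<in>K. Poly_Mapping.lookup s p *\<^sub>C g p)"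
  unfolding free_lift_def using assms
  by (intro sum.mono_neutral_left) (auto simp: in_keys_iff)

lemma free_lift_add: "free_lift g (s + t) = free_lift g s + free_lift g t"
proof -
  let ?K = "Poly_Mapping.keys s \<union> Poly_Mapping.keys t"
  have "finite ?K" "Poly_Mapping.keys (s + t) \<subseteq> ?K" by (auto dest: subsetD[OF Poly_Mapping.keys_add])
  then show ?thesis
    by (simp add: free_lift_superset[where K = ?K] lookup_add scaleC_add_left sum.distrib)
qed

lemma lookup_scaleC: "Poly_Mapping.lookup (c *\<^sub>C s) p = c *\<^sub>C Poly_Mapping.lookup s p"
  by transfer simp

lemma free_lift_scaleC: "free_lift g (c *\<^sub>C s) = c *\<^sub>C free_lift g s"
proof -
  have "Poly_Mapping.keys (c *\<^sub>C s) \<subseteq> Poly_Mapping.keys s"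
    by (auto simp: in_keys_iff lookup_scaleC)
  then show ?thesis
    by (simp add: free_lift_superset[where K = "Poly_Mapping.keys s"] lookup_scaleC scaleC_scaleC
       scaleC_complex_def complex_vector.scale_sum_right)
qed

lemma free_lift_single: "free_lift g (Poly_Mapping.single p d) = d *\<^sub>C g p"
  by (simp add: free_lift_def)

lemma free_lift_diff: "free_lift g (s - t) = free_lift g s - free_lift g t"
  by (metis add_diff_cancel_right' diff_add_cancel free_lift_add)

text \<open>A bilinear map kills the relators, so its linear extension to the free vector space
  descends to the quotient.\<close>

lemma free_lift_tensor_rel:
  assumes "bilinear_on UNIV UNIV UNIV f" "tensor_rel s t"
  shows "free_lift (case_prod f) s = free_lift (case_prod f) t"
proof -
  let ?F = "free_lift (case_prod f)"
  note f = bilinear_onD[OF assms(1), simplified]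
  have r0: "?F r = 0" if "r \<in> tensor_relators" for r
    using that f by (auto simp: tensor_relators_def free_lift_diff free_lift_single scaleC_one)
  have "?F r = 0" if "r \<in> complex_vector.span tensor_relators" for r
    using that
    by (induction rule: complex_vector.span_induct_alt)
       (simp_all add: r0 free_lift_add free_lift_scaleC free_lift_def[of _ 0])
  then show ?thesis using assms(2) by (metis tensor_rel_def free_lift_diff eq_iff_diff_eq_0)
qed

lemma subspace_projection:
  fixes V :: "'a::complex_vector set"
  assumes "complex_vector.subspace V"
  obtains p where "linear_on UNIV V p" "\<And>x. x \<in> V \<Longrightarrow> p x = x"
proof -
  interpret vsp: vector_space_pair "scaleC :: complex \<Rightarrow> 'a \<Rightarrow> 'a" "scaleC :: complex \<Rightarrow> 'a \<Rightarrow> 'a" ..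
  have "Vector_Spaces.linear scaleC scaleC (id :: 'a \<Rightarrow> 'a)"
    by (simp add: complex_vector.linear_id)
  from vsp.linear_exists_left_inverse_on[OF this assms]
  obtain g where g: "g ` UNIV \<subseteq> V" "Vector_Spaces.linear scaleC scaleC g" "\<forall>v\<in>V. g (id v) = v"
    by auto
  then have "linear_on UNIV V g"
    by (auto simp: linear_on_def vsp.linear_add vsp.linear_scale)
  then show ?thesis using that g(3) by simp
qed

text \<open>The relators defining a tensor range over the ambient spaces, while \<open>f\<close> is bilinear only on
  \<open>V \<times> W\<close>. Composing \<open>f\<close> with linear projections onto \<open>V\<close> and \<open>W\<close> makes it bilinear everywhere
  without changing it on \<open>V \<times> W\<close>.\<close>

lemma bilinear_sum_list_eq:
  fixes f :: "'a::complex_vector \<Rightarrow> 'b::complex_vector \<Rightarrow> 'c::complex_vector"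
  assumes V: "complex_vector.subspace V" and W: "complex_vector.subspace W"
    and f: "bilinear_on V W U f"
    and ps: "set ps \<subseteq> V \<times> W" and qs: "set qs \<subseteq> V \<times> W"
    and eq: "(\<Sum>(x, y)\<leftarrow>ps. x \<otimes> y) = (\<Sum>(x, y)\<leftarrow>qs. x \<otimes> y)"
  shows "(\<Sum>(x, y)\<leftarrow>ps. f x y) = (\<Sum>(x, y)\<leftarrow>qs. f x y)"
proof -
  obtain p where p: "linear_on UNIV V p" "\<And>x. x \<in> V \<Longrightarrow> p x = x"
    using subspace_projection[OF V] by blast
  obtain q where q: "linear_on UNIV W q" "\<And>x. x \<in> W \<Longrightarrow> q x = x"
    using subspace_projection[OF W] by blast
  define g where "g = (\<lambda>x y. f (p x) (q y))"
  have pm: "p x \<in> V" for x using linear_on_mem[OF p(1)] by simp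
  have qm: "q x \<in> W" for x using linear_on_mem[OF q(1)] by simp
  have g: "bilinear_on UNIV UNIV UNIV g"
    by (rule bilinear_onI)
      (simp_all add: g_def linear_on_add[OF p(1)] linear_on_add[OF q(1)]
        linear_on_scaleC[OF p(1)] linear_on_scaleC[OF q(1)] bilinear_onD[OF f] pm qm)
  have gf: "g x y = f x y" if "x \<in> V" "y \<in> W" for x y
    using that p q by (simp add: g_def)
  define r where "r = (\<lambda>ps::('a\<times>'b) list. \<Sum>(x, y)\<leftarrow>ps. Poly_Mapping.single (x, y) (1::complex))"
  have r: "abs_tensor (r xs) = (\<Sum>(x, y)\<leftarrow>xs. x \<otimes> y)" for xs
    by (induction xs) (auto simp: r_def zero_tensor_def pure_tensor.abs_eq plus_tensor.abs_eq[symmetric])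
  have Fr: "free_lift (case_prod g) (r xs) = (\<Sum>(x, y)\<leftarrow>xs. g x y)" for xs
    by (induction xs) (auto simp: r_def free_lift_add free_lift_single scaleC_one free_lift_def[of _ 0])
  have gsum: "(\<Sum>(x, y)\<leftarrow>xs. g x y) = (\<Sum>(x, y)\<leftarrow>xs. f x y)" if "set xs \<subseteq> V \<times> W" for xs
    using that by (induction xs) (auto simp: gf)
  have "tensor_rel (r ps) (r qs)"
    using eq r by (metis tensor.abs_eq_iff)
  from free_lift_tensor_rel[OF g this] show ?thesis
    using gsum[OF ps] gsum[OF qs] by (simp add: Fr)
qed

lemma tlift_sum_list:
  assumes "complex_vector.subspace V" "complex_vector.subspace W" "bilinear_on V W U f"
    and "set ps \<subseteq> V \<times> W"
  shows "tlift V W f (\<Sum>(x, y)\<leftarrow>ps. x \<otimes> y) = (\<Sum>(x, y)\<leftarrow>ps. f x y)"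
  unfolding tlift_def
proof (rule the_equality)
  show "\<exists>qs. set qs \<subseteq> V \<times> W \<and> (\<Sum>(x, y)\<leftarrow>ps. x \<otimes> y) = (\<Sum>(x, y)\<leftarrow>qs. x \<otimes> y) \<and>
     (\<Sum>(x, y)\<leftarrow>ps. f x y) = (\<Sum>(x, y)\<leftarrow>qs. f x y)"
    using assms(4) by blast
next
  fix z
  assume "\<exists>qs. set qs \<subseteq> V \<times> W \<and> (\<Sum>(x, y)\<leftarrow>ps. x \<otimes> y) = (\<Sum>(x, y)\<leftarrow>qs. x \<otimes> y) \<and>
     z = (\<Sum>(x, y)\<leftarrow>qs. f x y)"
  then obtain qs where qs: "set qs \<subseteq> V \<times> W"
    and eq: "(\<Sum>(x, y)\<leftarrow>ps. x \<otimes> y) = (\<Sum>(x, y)\<leftarrow>qs. x \<otimes> y)"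
    and z: "z = (\<Sum>(x, y)\<leftarrow>qs. f x y)"
    by (elim exE conjE)
  show "z = (\<Sum>(x, y)\<leftarrow>ps. f x y)"
    unfolding z by (rule bilinear_sum_list_eq[OF assms(1-3) qs assms(4) eq[symmetric]])
qed

lemma subspace_tensor_space: "complex_vector.subspace (tensor_space V W)"
  by (simp add: tensor_space_def complex_vector.subspace_span)

lemma pure_tensor_mem: "x \<in> V \<Longrightarrow> y \<in> W \<Longrightarrow> x \<otimes> y \<in> tensor_space V W"
  unfolding tensor_space_def by (rule complex_vector.span_base) auto

text \<open>Scalars can be absorbed into the first factor, so adding a pure tensor is the only step.\<close>

lemma tensor_space_induct [consumes 2, case_names zero add]:
  assumes t: "t \<in> tensor_space V W" and V: "complex_vector.subspace V"
    and z: "P 0"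
    and a: "\<And>x y t. x \<in> V \<Longrightarrow> y \<in> W \<Longrightarrow> t \<in> tensor_space V W \<Longrightarrow> P t \<Longrightarrow> P (x \<otimes> y + t)"
  shows "P t"
proof -
  have "t \<in> tensor_space V W \<and> P t"
    using t unfolding tensor_space_def
  proof (induction rule: complex_vector.span_induct_alt)
    case base then show ?case using z by (simp add: complex_vector.span_zero)
  next
    case (step c s t)
    then obtain x y where "s = x \<otimes> y" "x \<in> V" "y \<in> W" by auto
    then have "c *\<^sub>C s = (c *\<^sub>C x) \<otimes> y" "c *\<^sub>C x \<in> V"
      by (simp_all add: pure_tensor_scaleC_left complex_vector.subspace_scale[OF V])
    moreover have "t \<in> tensor_space V W" using step by (simp add: tensor_space_def)
    ultimately show ?case
      using a[of "c *\<^sub>C x" y t] step \<open>y \<in> W\<close> pure_tensor_mem[of "c *\<^sub>C x" V y W]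
      by (simp add: tensor_space_def complex_vector.span_add)
  qed
  then show ?thesis ..
qed

lemma tensor_space_sum_list:
  assumes "t \<in> tensor_space V W" "complex_vector.subspace V"
  shows "\<exists>ps. set ps \<subseteq> V \<times> W \<and> t = (\<Sum>(x, y)\<leftarrow>ps. x \<otimes> y)"
  using assms
proof (induction rule: tensor_space_induct)
  case zero then show ?case by (intro exI[of _ "[]"]) simp
next
  case (add x y t)
  then obtain ps where "set ps \<subseteq> V \<times> W" "t = (\<Sum>(x, y)\<leftarrow>ps. x \<otimes> y)" by blast
  then show ?case using add by (intro exI[of _ "(x, y) # ps"]) simp
qed

lemma tlift_pure:
  assumes "complex_vector.subspace V" "complex_vector.subspace W" "bilinear_on V W U f"
    "x \<in> V" "y \<in> W"
  shows "tlift V W f (x \<otimes> y) = f x y"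
proof -
  have "set [(x, y)] \<subseteq> V \<times> W" using assms(4,5) by simp
  from tlift_sum_list[OF assms(1-3) this] show ?thesis by simp
qed

lemma linear_on_tlift:
  assumes V: "complex_vector.subspace V" and W: "complex_vector.subspace W"
    and f: "bilinear_on V W U f" and U: "complex_vector.subspace U"
  shows "linear_on (tensor_space V W) U (tlift V W f)"
proof (rule linear_onI)
  fix t assume "t \<in> tensor_space V W"
  then obtain ps where ps: "set ps \<subseteq> V \<times> W" "t = (\<Sum>(x, y)\<leftarrow>ps. x \<otimes> y)"
    using tensor_space_sum_list[OF _ V] by blast
  have "(\<Sum>(x, y)\<leftarrow>ps. f x y) \<in> U"
    using ps(1) by (induction ps) (auto simp: subspace_mem[OF U] bilinear_onD[OF f])
  then show "tlift V W f t \<in> U" unfolding ps(2) tlift_sum_list[OF V W f ps(1)] .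
  {
    fix c
    let ?qs = "map (\<lambda>(x, y). (c *\<^sub>C x, y)) ps"
    have qs: "set ?qs \<subseteq> V \<times> W" using ps(1) by (auto simp: subspace_mem[OF V])
    have "c *\<^sub>C t = (\<Sum>(x, y)\<leftarrow>?qs. x \<otimes> y)" unfolding ps(2)
      by (induction ps) (auto simp: pure_tensor_scaleC_left complex_vector.scale_right_distrib)
    moreover have "c *\<^sub>C (\<Sum>(x, y)\<leftarrow>ps. f x y) = (\<Sum>(x, y)\<leftarrow>?qs. f x y)"
      using ps(1) by (induction ps) (auto simp: bilinear_onD[OF f] complex_vector.scale_right_distrib)
    ultimately show "tlift V W f (c *\<^sub>C t) = c *\<^sub>C tlift V W f t"
      using tlift_sum_list[OF V W f ps(1)] tlift_sum_list[OF V W f qs] ps(2) by metis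
  }
  fix s assume "s \<in> tensor_space V W"
  then obtain qs where qs: "set qs \<subseteq> V \<times> W" "s = (\<Sum>(x, y)\<leftarrow>qs. x \<otimes> y)"
    using tensor_space_sum_list[OF _ V] by blast
  have pq: "set (ps @ qs) \<subseteq> V \<times> W" using ps(1) qs(1) by simp
  show "tlift V W f (t + s) = tlift V W f t + tlift V W f s"
    using tlift_sum_list[OF V W f pq] unfolding ps(2) qs(2)
      tlift_sum_list[OF V W f ps(1)] tlift_sum_list[OF V W f qs(1)] by simp
qed

lemma linear_on_tensor_eqI:
  assumes V: "complex_vector.subspace V"
    and f: "linear_on (tensor_space V W) U f" and g: "linear_on (tensor_space V W) U' g"
    and eq: "\<And>x y. x \<in> V \<Longrightarrow> y \<in> W \<Longrightarrow> f (x \<otimes> y) = g (x \<otimes> y)"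
    and t: "t \<in> tensor_space V W"
  shows "f t = g t"
  using t V
proof (induction rule: tensor_space_induct)
  case zero
  show ?case using linear_on_zero[OF f] linear_on_zero[OF g] subspace_tensor_space by metis
next
  case (add x y t)
  then show ?case
    using eq by (simp add: linear_on_add[OF f] linear_on_add[OF g] pure_tensor_mem)
qed

lemma tensor_space_basis_expansion:
  fixes V :: "'a::complex_vector set" and W :: "'b::complex_vector set"
  assumes t: "t \<in> tensor_space V W"
    and V: "complex_vector.subspace V" and W: "complex_vector.subspace W"
    and B: "B \<subseteq> V" "V \<subseteq> complex_vector.span B" "complex_vector.independent B"
  shows "\<exists>F w. finite F \<and> F \<subseteq> B \<and> (\<forall>b\<in>B. w b \<in> W) \<and> t = (\<Sum>b\<in>F. b \<otimes> w b)"
  using t V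
proof (induction rule: tensor_space_induct)
  case zero
  show ?case by (intro exI[of _ "{}"] exI[of _ "\<lambda>_. 0"]) (simp add: subspace_mem[OF W])
next
  case (add x y t)
  from add.IH[OF add.prems] obtain F w where F: "finite F" "F \<subseteq> B" "\<forall>b\<in>B. w b \<in> W" "t = (\<Sum>b\<in>F. b \<otimes> w b)"
    by (elim exE conjE)
  let ?r = "complex_vector.representation B x"
  define G where "G = {b. ?r b \<noteq> 0}"
  have G: "finite G" "G \<subseteq> B"
    using complex_vector.finite_representation complex_vector.representation_ne_zero
    by (auto simp: G_def)
  have x: "x = (\<Sum>b\<in>G. ?r b *\<^sub>C b)"
    using complex_vector.sum_nonzero_representation_eq[OF B(3)] add(1) B(2) by (auto simp: G_def)
  have sumt: "(\<Sum>b\<in>K. f b) \<otimes> y = (\<Sum>b\<in>K. f b \<otimes> y)" for K and f :: "'a \<Rightarrow> 'a"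
  proof (induction K rule: infinite_finite_induct)
    case (insert k K) then show ?case by (simp add: pure_tensor_add_left)
  qed (use pure_tensor_scaleC_left[of 0 "0::'a" y] in simp_all)
  have z0: "0 \<otimes> y = (0::('a,'b) tensor)"
    using pure_tensor_scaleC_left[of 0 0 y] by simp
  have z: "b \<otimes> 0 = (0::('a,'b) tensor)" for b
    using pure_tensor_scaleC_right[of b 0 0] by simp
  define w' where "w' b = (if b \<in> F then w b else 0) + ?r b *\<^sub>C y" for b
  have "(\<Sum>b\<in>F \<union> G. b \<otimes> w' b)
     = (\<Sum>b\<in>F \<union> G. b \<otimes> (if b \<in> F then w b else 0)) + (\<Sum>b\<in>F \<union> G. (?r b *\<^sub>C b) \<otimes> y)"
    by (simp add: w'_def pure_tensor_add_right sum.distrib pure_tensor_scaleC_left pure_tensor_scaleC_right)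
  also have "(\<Sum>b\<in>F \<union> G. b \<otimes> (if b \<in> F then w b else 0)) = (\<Sum>b\<in>F. b \<otimes> w b)"
    using F G by (intro sum.mono_neutral_cong_right) (auto simp: z)
  also have "(\<Sum>b\<in>F \<union> G. (?r b *\<^sub>C b) \<otimes> y) = (\<Sum>b\<in>G. (?r b *\<^sub>C b) \<otimes> y)"
    using F G by (intro sum.mono_neutral_cong_right) (auto simp: G_def z0)
  also have "\<dots> = x \<otimes> y" by (simp only: sumt[symmetric] x[symmetric])
  finally have "x \<otimes> y + t = (\<Sum>b\<in>F \<union> G. b \<otimes> w' b)" using F(4) by (simp add: add.commute)
  moreover have "\<forall>b\<in>B. w' b \<in> W" using F(3) add(2) by (auto simp: w'_def subspace_mem[OF W])
  moreover have "finite (F \<union> G)" "F \<union> G \<subseteq> B" using F G by simp_all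
  ultimately show ?case by (intro exI[of _ "F \<union> G"] exI[of _ w'] conjI)
qed

lemma bilinear_on_slice_left:
  assumes "linear_on V UNIV f" and W: "complex_vector.subspace (W :: 'b::complex_vector set)"
  shows "bilinear_on V W W (\<lambda>x y. f x *\<^sub>C y)"
  using assms by (intro bilinear_onI) (simp_all add: linear_on_add linear_on_scaleC scaleC_add_left
     scaleC_add_right scaleC_scaleC scaleC_complex_def mult.commute complex_vector.subspace_scale)

lemma linear_on_representation:
  assumes "complex_vector.independent B" "V \<subseteq> complex_vector.span B"
  shows "linear_on V UNIV (\<lambda>x. complex_vector.representation B x b)"
proof (rule linear_onI)
  fix x y c assume x: "x \<in> V"
  have "x \<in> complex_vector.span B" using x assms(2) by blast
  from complex_vector.representation_scale[OF assms(1) this]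
  show "complex_vector.representation B (c *\<^sub>C x) b = c *\<^sub>C complex_vector.representation B x b"
    by (simp add: scaleC_complex_def)
next
  fix x y assume "x \<in> V" "y \<in> V"
  then have "x \<in> complex_vector.span B" "y \<in> complex_vector.span B" using assms(2) by blast+
  from complex_vector.representation_add[OF assms(1) this]
  show "complex_vector.representation B (x + y) b
     = complex_vector.representation B x b + complex_vector.representation B y b"
    by (simp add: add.commute)
qed simp

text \<open>Membership in \<open>V \<otimes> N\<close> is decided by slices: in an expansion \<open>\<Sum> b \<otimes> w\<^sub>b\<close> over a basis of
  \<open>V\<close>, the coordinate functionals of the basis return the coefficients \<open>w\<^sub>b\<close>.\<close>

lemma tensor_space_memI_slice:
  fixes V :: "'a::complex_vector set" and W :: "'b::complex_vector set"
  assumes t: "t \<in> tensor_space V W"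
    and V: "complex_vector.subspace V" and W: "complex_vector.subspace W"
    and N: "\<And>f. linear_on V UNIV f \<Longrightarrow> tlift V W (\<lambda>x y. f x *\<^sub>C y) t \<in> N"
  shows "t \<in> tensor_space V N"
proof -
  obtain B where B: "B \<subseteq> V" "complex_vector.independent B" "V \<subseteq> complex_vector.span B"
    by (rule complex_vector.basis_exists[of V])
  obtain F w where F: "finite F" "F \<subseteq> B" "\<forall>b\<in>B. w b \<in> W" "t = (\<Sum>b\<in>F. b \<otimes> w b)"
    using tensor_space_basis_expansion[OF t V W B(1,3,2)] by (elim exE conjE)
  have "w b \<in> N" if b: "b \<in> F" for b
  proof -
    define f where "f = (\<lambda>x. complex_vector.representation B x b)"
    have f: "linear_on V UNIV f"
      unfolding f_def by (rule linear_on_representation[OF B(2,3)])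
    have bl: "bilinear_on V W UNIV (\<lambda>x y. f x *\<^sub>C y)"
      by (rule bilinear_on_UNIV[OF bilinear_on_slice_left[OF f W]])
    have ft: "linear_on (tensor_space V W) UNIV (tlift V W (\<lambda>x y. f x *\<^sub>C y))"
      by (rule linear_on_tlift[OF V W bl]) (simp add: complex_vector.subspace_UNIV)
    have mem: "b \<in> V" "w b \<in> W" if "b \<in> F" for b
      using that F(2,3) B(1) by blast+
    have "tlift V W (\<lambda>x y. f x *\<^sub>C y) t = (\<Sum>b'\<in>F. tlift V W (\<lambda>x y. f x *\<^sub>C y) (b' \<otimes> w b'))"
      unfolding F(4) by (rule linear_on_sum[OF ft subspace_tensor_space]) (intro pure_tensor_mem mem)
    also have "\<dots> = (\<Sum>b'\<in>F. f b' *\<^sub>C w b')"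
      by (rule sum.cong[OF refl], rule tlift_pure[OF V W bl]) (rule mem, assumption)+
    also have "\<dots> = (\<Sum>b'\<in>F. if b' = b then w b' else 0)"
    proof (rule sum.cong[OF refl])
      fix b' assume "b' \<in> F"
      then have "b' \<in> B" using F(2) by blast
      then show "f b' *\<^sub>C w b' = (if b' = b then w b' else 0)"
        using complex_vector.representation_basis[OF B(2)] by (simp add: f_def scaleC_one)
    qed
    also have "\<dots> = w b" using b F(1) by simp
    finally show ?thesis using N[OF f] by simp
  qed
  then show ?thesis unfolding F(4)
    using F(2) B(1) by (intro complex_vector.subspace_sum[OF subspace_tensor_space] pure_tensor_mem) blast+
qed

lemma functionals_separate:
  assumes V: "complex_vector.subspace V" and x: "x \<in> V"
    and "\<And>f::'a::complex_vector \<Rightarrow> complex. linear_on V UNIV f \<Longrightarrow> f x = 0"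
  shows "x = 0"
proof -
  obtain B where B: "B \<subseteq> V" "complex_vector.independent B" "V \<subseteq> complex_vector.span B"
    by (rule complex_vector.basis_exists[of V])
  have "complex_vector.representation B x b = 0" for b
    by (rule assms(3)[OF linear_on_representation[OF B(2,3)]])
  then have "complex_vector.representation B x = (\<lambda>b. 0)" by auto
  then show ?thesis
    using complex_vector.sum_nonzero_representation_eq[OF B(2), of x] B(3) x by auto
qed

lemma tlift_cong:
  assumes "\<And>x y. x \<in> V \<Longrightarrow> y \<in> W \<Longrightarrow> f x y = g x y"
  shows "tlift V W f = tlift V W g"
proof -
  have "(\<Sum>(x, y)\<leftarrow>ps. f x y) = (\<Sum>(x, y)\<leftarrow>ps. g x y)" if "set ps \<subseteq> V \<times> W" for ps
    using that by (induction ps) (auto simp: assms)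
  then show ?thesis unfolding tlift_def fun_eq_iff by (intro allI arg_cong[of _ _ The] ext) metis
qed

lemma tlift_comp:
  assumes V: "complex_vector.subspace V" and W: "complex_vector.subspace W"
    and f: "bilinear_on V W U f" and U: "complex_vector.subspace U" and g: "linear_on U Z g"
    and t: "t \<in> tensor_space V W"
  shows "g (tlift V W f t) = tlift V W (\<lambda>x y. g (f x y)) t"
proof -
  have gf: "bilinear_on V W UNIV (\<lambda>x y. g (f x y))"
    by (rule bilinear_onI) (simp_all add: bilinear_onD[OF f] linear_rules[OF g])
  note lf = linear_on_tlift[OF V W f U]
  note lgf = linear_on_tlift[OF V W gf complex_vector.subspace_UNIV]
  have "linear_on (tensor_space V W) UNIV (\<lambda>t. g (tlift V W f t))"
    by (rule linear_onI) (simp_all add: linear_rules[OF lf]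
        linear_on_mem[OF lf] linear_rules[OF g])
  from linear_on_tensor_eqI[OF V this lgf _ t] show ?thesis
    by (simp add: tlift_pure[OF V W f] tlift_pure[OF V W gf])
qed

lemma tlift_add:
  assumes V: "complex_vector.subspace V" and W: "complex_vector.subspace W"
    and f: "bilinear_on V W U f" and g: "bilinear_on V W U' g" and t: "t \<in> tensor_space V W"
  shows "tlift V W (\<lambda>x y. f x y + g x y) t = tlift V W f t + tlift V W g t"
proof -
  have fg: "bilinear_on V W UNIV (\<lambda>x y. f x y + g x y)"
    by (rule bilinear_onI) (simp_all add: bilinear_onD[OF f] bilinear_onD[OF g] scaleC_add_right)
  obtain ps where ps: "set ps \<subseteq> V \<times> W" "t = (\<Sum>(x, y)\<leftarrow>ps. x \<otimes> y)"
    using tensor_space_sum_list[OF t V] by (elim exE conjE)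
  show ?thesis
    unfolding ps(2) tlift_sum_list[OF V W fg ps(1)] tlift_sum_list[OF V W f ps(1)] tlift_sum_list[OF V W g ps(1)]
    by (induction ps) auto
qed

lemma tlift_scaleC:
  assumes V: "complex_vector.subspace V" and W: "complex_vector.subspace W"
    and f: "bilinear_on V W U f" and t: "t \<in> tensor_space V W"
  shows "tlift V W (\<lambda>x y. c *\<^sub>C f x y) t = c *\<^sub>C tlift V W f t"
proof -
  have fg: "bilinear_on V W UNIV (\<lambda>x y. c *\<^sub>C f x y)"
    by (rule bilinear_onI) (simp_all add: bilinear_onD[OF f] scaleC_add_right scaleC_scaleC mult.commute)
  obtain ps where ps: "set ps \<subseteq> V \<times> W" "t = (\<Sum>(x, y)\<leftarrow>ps. x \<otimes> y)"
    using tensor_space_sum_list[OF t V] by (elim exE conjE)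
  show ?thesis
    unfolding ps(2) tlift_sum_list[OF V W fg ps(1)] tlift_sum_list[OF V W f ps(1)]
    by (induction ps) (auto simp: scaleC_add_right)
qed

lemma bilinear_on_tmap:
  assumes "linear_on V V' p" "linear_on W W' q"
  shows "bilinear_on V W (tensor_space V' W') (\<lambda>x y. p x \<otimes> q y)"
  by (rule bilinear_onI) (simp_all add: pure_tensor_mem linear_on_mem[OF assms(1)] linear_on_mem[OF assms(2)]
      linear_on_add[OF assms(1)] linear_on_add[OF assms(2)] linear_on_scaleC[OF assms(1)] linear_on_scaleC[OF assms(2)]
      pure_tensor_add_left pure_tensor_add_right pure_tensor_scaleC_left pure_tensor_scaleC_right)

lemma linear_on_tmap:
  assumes "complex_vector.subspace V" "complex_vector.subspace W"
    and "linear_on V V' p" "linear_on W W' q"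
  shows "linear_on (tensor_space V W) (tensor_space V' W') (tmap V W p q)"
  unfolding tmap_def
  by (rule linear_on_tlift[OF assms(1,2) bilinear_on_tmap[OF assms(3,4)] subspace_tensor_space])

lemma tmap_pure:
  assumes "complex_vector.subspace V" "complex_vector.subspace W"
    and "linear_on V V' p" "linear_on W W' q" "x \<in> V" "y \<in> W"
  shows "tmap V W p q (x \<otimes> y) = p x \<otimes> q y"
  unfolding tmap_def
  by (rule tlift_pure[OF assms(1,2) bilinear_on_tmap[OF assms(3,4)] assms(5,6)])

lemma bilinear_on_comp:
  assumes f: "bilinear_on V' W' U f" and p: "linear_on V V' p" and q: "linear_on W W' q"
  shows "bilinear_on V W U (\<lambda>x y. f (p x) (q y))"
  by (rule bilinear_onI) (simp_all add: bilinear_onD[OF f] linear_on_mem[OF p] linear_on_mem[OF q]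
     linear_on_add[OF p] linear_on_add[OF q] linear_on_scaleC[OF p] linear_on_scaleC[OF q])

lemma tlift_tmap:
  assumes V: "complex_vector.subspace V" and W: "complex_vector.subspace W"
    and V': "complex_vector.subspace V'" and W': "complex_vector.subspace W'"
    and p: "linear_on V V' p" and q: "linear_on W W' q"
    and f: "bilinear_on V' W' U f" and t: "t \<in> tensor_space V W"
  shows "tlift V' W' f (tmap V W p q t) = tlift V W (\<lambda>x y. f (p x) (q y)) t"
proof -
  note fU = bilinear_on_UNIV[OF f]
  note lf = linear_on_tlift[OF V' W' fU complex_vector.subspace_UNIV]
  have "tlift V' W' f (tmap V W p q t) = tlift V W (\<lambda>x y. tlift V' W' f (p x \<otimes> q y)) t"
    unfolding tmap_def
    by (rule tlift_comp[OF V W bilinear_on_tmap[OF p q] subspace_tensor_space lf t])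
  also have "\<dots> = tlift V W (\<lambda>x y. f (p x) (q y)) t"
    by (rule fun_cong[OF tlift_cong])
      (simp add: tlift_pure[OF V' W' f] linear_on_mem[OF p] linear_on_mem[OF q])
  finally show ?thesis .
qed

lemma tmap_cong:
  assumes "\<And>x. x \<in> V \<Longrightarrow> p x = p' x" "\<And>y. y \<in> W \<Longrightarrow> q y = q' y"
  shows "tmap V W p q = tmap V W p' q'"
  unfolding tmap_def by (rule tlift_cong) (simp add: assms)

context
  fixes V :: "'a::complex_vector set" and W :: "'b::complex_vector set"
  assumes V: "complex_vector.subspace V" and W: "complex_vector.subspace W"
begin

lemma tmap_add_left:
  assumes "linear_on V V' p" "linear_on V V' p'" "linear_on W W' q" "t \<in> tensor_space V W"
  shows "tmap V W (\<lambda>x. p x + p' x) q t = tmap V W p q t + tmap V W p' q t"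
  unfolding tmap_def pure_tensor_add_left
  by (rule tlift_add[OF V W bilinear_on_tmap[OF assms(1,3)] bilinear_on_tmap[OF assms(2,3)] assms(4)])

lemma tmap_add_right:
  assumes "linear_on V V' p" "linear_on W W' q" "linear_on W W' q'" "t \<in> tensor_space V W"
  shows "tmap V W p (\<lambda>x. q x + q' x) t = tmap V W p q t + tmap V W p q' t"
  unfolding tmap_def pure_tensor_add_right
  by (rule tlift_add[OF V W bilinear_on_tmap[OF assms(1,2)] bilinear_on_tmap[OF assms(1,3)] assms(4)])

lemma tmap_scaleC:
  assumes "linear_on V V' p" "linear_on W W' q" "t \<in> tensor_space V W"
  shows "tmap V W (\<lambda>x. c *\<^sub>C p x) q t = c *\<^sub>C tmap V W p q t"
    and "tmap V W p (\<lambda>x. c *\<^sub>C q x) t = c *\<^sub>C tmap V W p q t"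
  unfolding tmap_def pure_tensor_scaleC_left pure_tensor_scaleC_right
  by (rule tlift_scaleC[OF V W bilinear_on_tmap[OF assms(1,2)] assms(3)])+

end

section \<open>Nondegenerate algebras and their multipliers\<close>

locale nondeg_alg =
  fixes A :: "'a::complex_vector calg"
  assumes nondeg: "nondegenerate_algebra A"
begin

lemma subspace: "complex_vector.subspace (carrier A)"
  using nondeg by (simp add: nondegenerate_algebra_def)

lemma bilinear_mult: "bilinear_on (carrier A) (carrier A) (carrier A) (mult A)"
  using nondeg by (simp add: nondegenerate_algebra_def)

lemmas add_mem = complex_vector.subspace_add[OF subspace]
lemmas scale_mem = complex_vector.subspace_scale[OF subspace]
lemmas zero_mem = complex_vector.subspace_0[OF subspace]
lemmas mult_mem = bilinear_onD(1)[OF bilinear_mult]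
lemmas mult_add_left = bilinear_onD(2)[OF bilinear_mult]
lemmas mult_scale_left = bilinear_onD(3)[OF bilinear_mult]
lemmas mult_add_right = bilinear_onD(4)[OF bilinear_mult]
lemmas mult_scale_right = bilinear_onD(5)[OF bilinear_mult]
lemmas mem_simps = add_mem scale_mem zero_mem mult_mem
lemmas lin_simps = mult_add_left mult_scale_left mult_add_right mult_scale_right

lemma assoc: "x \<in> carrier A \<Longrightarrow> y \<in> carrier A \<Longrightarrow> z \<in> carrier A
    \<Longrightarrow> (x \<cdot>\<^bsub>A\<^esub> y) \<cdot>\<^bsub>A\<^esub> z = x \<cdot>\<^bsub>A\<^esub> (y \<cdot>\<^bsub>A\<^esub> z)"
  using nondeg by (simp add: nondegenerate_algebra_def)

lemma linear_mult_left: "a \<in> carrier A \<Longrightarrow> linear_on (carrier A) (carrier A) (\<lambda>x. a \<cdot>\<^bsub>A\<^esub> x)"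
  by (rule linear_onI) (simp_all add: mem_simps lin_simps)

lemma linear_mult_right: "a \<in> carrier A \<Longrightarrow> linear_on (carrier A) (carrier A) (\<lambda>x. x \<cdot>\<^bsub>A\<^esub> a)"
  by (rule linear_onI) (simp_all add: mem_simps lin_simps)

lemma right_zero: "x \<in> carrier A \<Longrightarrow> (\<And>y. y \<in> carrier A \<Longrightarrow> x \<cdot>\<^bsub>A\<^esub> y = 0) \<Longrightarrow> x = 0"
  and left_zero: "x \<in> carrier A \<Longrightarrow> (\<And>y. y \<in> carrier A \<Longrightarrow> y \<cdot>\<^bsub>A\<^esub> x = 0) \<Longrightarrow> x = 0"
  using nondeg unfolding nondegenerate_algebra_def by blast+

lemma right_cancel:
  assumes x: "x \<in> carrier A" and y: "y \<in> carrier A"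
    and eq: "\<And>z. z \<in> carrier A \<Longrightarrow> x \<cdot>\<^bsub>A\<^esub> z = y \<cdot>\<^bsub>A\<^esub> z"
  shows "x = y"
  using right_zero[OF complex_vector.subspace_diff[OF subspace x y]]
  by (simp add: eq linear_on_diff[OF linear_mult_right subspace x y])

lemma left_cancel:
  assumes x: "x \<in> carrier A" and y: "y \<in> carrier A"
    and eq: "\<And>z. z \<in> carrier A \<Longrightarrow> z \<cdot>\<^bsub>A\<^esub> x = z \<cdot>\<^bsub>A\<^esub> y"
  shows "x = y"
  using left_zero[OF complex_vector.subspace_diff[OF subspace x y]]
  by (simp add: eq linear_on_diff[OF linear_mult_left subspace x y])

lemma fst_embed: "x \<in> carrier A \<Longrightarrow> fst (embed A a) x = a \<cdot>\<^bsub>A\<^esub> x"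
  by (simp add: embed_def)

lemma snd_embed: "x \<in> carrier A \<Longrightarrow> snd (embed A a) x = x \<cdot>\<^bsub>A\<^esub> a"
  by (simp add: embed_def)

lemma mult_algD:
  assumes "m \<in> carrier (mult_alg A)"
  shows "linear_on (carrier A) (carrier A) (fst m)" "linear_on (carrier A) (carrier A) (snd m)"
    and "x \<notin> carrier A \<Longrightarrow> fst m x = 0" "x \<notin> carrier A \<Longrightarrow> snd m x = 0"
    and "x \<in> carrier A \<Longrightarrow> y \<in> carrier A \<Longrightarrow> x \<cdot>\<^bsub>A\<^esub> fst m y = snd m x \<cdot>\<^bsub>A\<^esub> y"
  using assms by (auto simp: mult_alg_def)

lemma fst_mem: "m \<in> carrier (mult_alg A) \<Longrightarrow> x \<in> carrier A \<Longrightarrow> fst m x \<in> carrier A"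
  by (rule linear_on_mem[OF mult_algD(1)])

lemma snd_mem: "m \<in> carrier (mult_alg A) \<Longrightarrow> x \<in> carrier A \<Longrightarrow> snd m x \<in> carrier A"
  by (rule linear_on_mem[OF mult_algD(2)])

lemma mult_algI:
  assumes "linear_on (carrier A) (carrier A) (fst m)" "linear_on (carrier A) (carrier A) (snd m)"
    and "\<And>x. x \<notin> carrier A \<Longrightarrow> fst m x = 0" "\<And>x. x \<notin> carrier A \<Longrightarrow> snd m x = 0"
    and "\<And>x y. x \<in> carrier A \<Longrightarrow> y \<in> carrier A \<Longrightarrow> x \<cdot>\<^bsub>A\<^esub> fst m y = snd m x \<cdot>\<^bsub>A\<^esub> y"
  shows "m \<in> carrier (mult_alg A)"
  using assms by (cases m) (simp add: mult_alg_def)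

lemma fst_mult_alg: "fst (m \<cdot>\<^bsub>mult_alg A\<^esub> n) x = fst m (fst n x)"
  by (simp add: mult_alg_def)

lemma snd_mult_alg: "snd (m \<cdot>\<^bsub>mult_alg A\<^esub> n) x = snd n (snd m x)"
  by (simp add: mult_alg_def)

lemma mult_alg_assoc:
  "(l \<cdot>\<^bsub>mult_alg A\<^esub> m) \<cdot>\<^bsub>mult_alg A\<^esub> n = l \<cdot>\<^bsub>mult_alg A\<^esub> (m \<cdot>\<^bsub>mult_alg A\<^esub> n)"
  by (simp add: mult_alg_def o_assoc)

lemma embed_mem: "a \<in> carrier A \<Longrightarrow> embed A a \<in> carrier (mult_alg A)"
  by (rule mult_algI)
    (auto simp: embed_def assoc mem_simps lin_simps intro!: linear_onI)

lemma linear_embed: "linear_on (carrier A) (carrier (mult_alg A)) (embed A)"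
proof (rule linear_onI, rule embed_mem)
  fix x y assume "x \<in> carrier A" "y \<in> carrier A"
  then show "embed A (x + y) = embed A x + embed A y"
    by (auto simp: embed_def lin_simps fun_eq_iff)
next
  fix c x assume "x \<in> carrier A"
  then show "embed A (c *\<^sub>C x) = c *\<^sub>C embed A x"
    by (auto simp: embed_def lin_simps scaleC_prod_def scaleC_fun_def fun_eq_iff)
qed

lemma fst_mult:
  assumes "m \<in> carrier (mult_alg A)" "x \<in> carrier A" "y \<in> carrier A"
  shows "fst m (x \<cdot>\<^bsub>A\<^esub> y) = fst m x \<cdot>\<^bsub>A\<^esub> y"
proof (rule left_cancel)
  fix z assume z: "z \<in> carrier A"
  show "z \<cdot>\<^bsub>A\<^esub> fst m (x \<cdot>\<^bsub>A\<^esub> y) = z \<cdot>\<^bsub>A\<^esub> (fst m x \<cdot>\<^bsub>A\<^esub> y)"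
    using assms z by (simp add: mult_algD(5) mem_simps fst_mem snd_mem flip: assoc)
qed (simp_all add: assms mem_simps fst_mem)

text \<open>The right action of a multiplier is determined by its left action, through
  \<open>R(x) z = x L(z)\<close> and nondegeneracy.\<close>

lemma multiplier_eqI:
  assumes m: "m \<in> carrier (mult_alg A)" and n: "n \<in> carrier (mult_alg A)"
    and eq: "\<And>x. x \<in> carrier A \<Longrightarrow> fst m x = fst n x"
  shows "m = n"
proof (rule prod_eqI; rule ext)
  fix x
  show "fst m x = fst n x"
    by (cases "x \<in> carrier A") (simp_all add: eq mult_algD(3)[OF m] mult_algD(3)[OF n])
  show "snd m x = snd n x"
  proof (cases "x \<in> carrier A")
    case True
    show ?thesis
    proof (rule right_cancel)
      fix z assume "z \<in> carrier A"
      then show "snd m x \<cdot>\<^bsub>A\<^esub> z = snd n x \<cdot>\<^bsub>A\<^esub> z"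
        using True eq mult_algD(5)[OF m True] mult_algD(5)[OF n True] by simp
    qed (simp_all add: m n snd_mem True)
  qed (simp add: mult_algD(4)[OF m] mult_algD(4)[OF n])
qed

lemma mult_alg_mult_mem:
  assumes m: "m \<in> carrier (mult_alg A)" and n: "n \<in> carrier (mult_alg A)"
  shows "m \<cdot>\<^bsub>mult_alg A\<^esub> n \<in> carrier (mult_alg A)"
proof (rule mult_algI)
  show "linear_on (carrier A) (carrier A) (fst (m \<cdot>\<^bsub>mult_alg A\<^esub> n))"
    by (rule linear_onI) (simp_all add: fst_mult_alg fst_mem m n linear_rules[OF mult_algD(1)])
  show "linear_on (carrier A) (carrier A) (snd (m \<cdot>\<^bsub>mult_alg A\<^esub> n))"
    by (rule linear_onI) (simp_all add: snd_mult_alg snd_mem m n linear_rules[OF mult_algD(2)])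
qed (simp_all add: fst_mult_alg snd_mult_alg mult_algD[OF m] mult_algD[OF n]
    fst_mem[OF n] snd_mem[OF m] linear_on_zero[OF mult_algD(1)[OF m] subspace]
    linear_on_zero[OF mult_algD(2)[OF n] subspace])

lemma inj_embed: "inj_on (embed A) (carrier A)"
proof (rule inj_onI)
  fix x y assume x: "x \<in> carrier A" and y: "y \<in> carrier A" and eq: "embed A x = embed A y"
  show "x = y"
  proof (rule right_cancel[OF x y])
    fix z assume z: "z \<in> carrier A"
    show "x \<cdot>\<^bsub>A\<^esub> z = y \<cdot>\<^bsub>A\<^esub> z"
      using fst_embed[OF z, of x] fst_embed[OF z, of y] eq by simp
  qed
qed

lemma unembed_embed: "a \<in> carrier A \<Longrightarrow> unembed A (embed A a) = a"
  by (simp add: unembed_def inj_embed)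

lemma unembedI: "m = embed A a \<Longrightarrow> a \<in> carrier A \<Longrightarrow> unembed A m = a"
  by (simp add: unembed_embed)

lemma in_algD:
  assumes "in_alg A m"
  shows "unembed A m \<in> carrier A" "embed A (unembed A m) = m"
proof -
  obtain a where "a \<in> carrier A" "m = embed A a" using assms by (auto simp: in_alg_def)
  then show "unembed A m \<in> carrier A" "embed A (unembed A m) = m" by (simp_all add: unembed_embed)
qed

lemma mult_embed:
  assumes m: "m \<in> carrier (mult_alg A)" and c: "c \<in> carrier A"
  shows "m \<cdot>\<^bsub>mult_alg A\<^esub> embed A c = embed A (fst m c)"
  by (rule multiplier_eqI)
    (simp_all add: m c mult_alg_mult_mem embed_mem fst_mem fst_mult_alg fst_embed fst_mult)

lemma embed_mult:
  assumes m: "m \<in> carrier (mult_alg A)" and c: "c \<in> carrier A"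
  shows "embed A c \<cdot>\<^bsub>mult_alg A\<^esub> m = embed A (snd m c)"
  by (rule multiplier_eqI)
    (simp_all add: m c mult_alg_mult_mem embed_mem fst_mem snd_mem fst_mult_alg fst_embed mult_algD(5))

lemma mult_one_mem: "mult_one A \<in> carrier (mult_alg A)"
  by (rule mult_algI) (auto simp: mult_one_def mem_simps intro!: linear_onI)

lemma fst_mult_one: "x \<in> carrier A \<Longrightarrow> fst (mult_one A) x = x"
  and snd_mult_one: "x \<in> carrier A \<Longrightarrow> snd (mult_one A) x = x"
  by (simp_all add: mult_one_def)

end

section \<open>Tensor products of nondegenerate algebras\<close>

lemma carrier_tensor_alg: "carrier (A \<otimes>\<^sub>A B) = tensor_space (carrier A) (carrier B)"
  by (simp add: tensor_alg_def)

lemma linear_on_compose: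
  assumes "linear_on V W f" "linear_on W U g" shows "linear_on V U (\<lambda>x. g (f x))"
  by (rule linear_onI) (simp_all add: linear_on_mem[OF assms(1)] linear_on_mem[OF assms(2)]
      linear_on_add[OF assms(1)] linear_on_add[OF assms(2)] linear_on_scaleC[OF assms(1)] linear_on_scaleC[OF assms(2)])

lemma bilinear_on_product:
  fixes f :: "'a::complex_vector \<Rightarrow> complex" and g :: "'b::complex_vector \<Rightarrow> complex"
  assumes "linear_on V UNIV f" "linear_on W UNIV g"
  shows "bilinear_on V W UNIV (\<lambda>x y. f x * g y)"
  by (rule bilinear_onI) (simp_all add: linear_on_add[OF assms(1)] linear_on_add[OF assms(2)]
      linear_on_scaleC[OF assms(1)] linear_on_scaleC[OF assms(2)] scaleC_complex_def algebra_simps)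

lemma bilinear_on_slice_right:
  assumes "linear_on W UNIV g" and V: "complex_vector.subspace (V :: 'b::complex_vector set)"
  shows "bilinear_on V W V (\<lambda>x y. g y *\<^sub>C x)"
  using assms by (intro bilinear_onI) (simp_all add: linear_on_add linear_on_scaleC scaleC_add_left
     scaleC_add_right scaleC_scaleC scaleC_complex_def mult.commute complex_vector.subspace_scale)

context
  fixes V :: "'a::complex_vector set" and W :: "'b::complex_vector set"
  assumes V: "complex_vector.subspace V" and W: "complex_vector.subspace W"
begin

lemma tlift_slice_left:
  assumes f: "linear_on V UNIV f" and t: "t \<in> tensor_space V W"
  shows "tlift V W (\<lambda>x y. f x *\<^sub>C y) t \<in> W"
    and "linear_on W UNIV g \<Longrightarrow> g (tlift V W (\<lambda>x y. f x *\<^sub>C y) t) = tlift V W (\<lambda>x y. f x * g y) t"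
proof -
  note bl = bilinear_on_slice_left[OF f W]
  show "tlift V W (\<lambda>x y. f x *\<^sub>C y) t \<in> W" by (rule linear_on_mem[OF linear_on_tlift[OF V W bl W] t])
  assume g: "linear_on W UNIV g"
  have "tlift V W (\<lambda>x y. g (f x *\<^sub>C y)) = tlift V W (\<lambda>x y. f x * g y)"
    by (rule tlift_cong) (simp add: linear_on_scaleC[OF g] scaleC_complex_def)
  then show "g (tlift V W (\<lambda>x y. f x *\<^sub>C y) t) = tlift V W (\<lambda>x y. f x * g y) t"
    by (simp add: tlift_comp[OF V W bl W g t])
qed

lemma tlift_slice_right:
  assumes g: "linear_on W UNIV g" and t: "t \<in> tensor_space V W"
  shows "tlift V W (\<lambda>x y. g y *\<^sub>C x) t \<in> V"
    and "linear_on V UNIV f \<Longrightarrow> f (tlift V W (\<lambda>x y. g y *\<^sub>C x) t) = tlift V W (\<lambda>x y. f x * g y) t"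
proof -
  note bl = bilinear_on_slice_right[OF g V]
  show "tlift V W (\<lambda>x y. g y *\<^sub>C x) t \<in> V" by (rule linear_on_mem[OF linear_on_tlift[OF V W bl V] t])
  assume f: "linear_on V UNIV f"
  have "tlift V W (\<lambda>x y. f (g y *\<^sub>C x)) = tlift V W (\<lambda>x y. f x * g y)"
    by (rule tlift_cong) (simp add: linear_on_scaleC[OF f] scaleC_complex_def)
  then show "f (tlift V W (\<lambda>x y. g y *\<^sub>C x) t) = tlift V W (\<lambda>x y. f x * g y) t"
    by (simp add: tlift_comp[OF V W bl V f t])
qed

lemma tensor_separation:
  assumes t: "t \<in> tensor_space V W"
    and eq: "\<And>(f :: 'a \<Rightarrow> complex) (g :: 'b \<Rightarrow> complex). linear_on V UNIV f \<Longrightarrow> linear_on W UNIV g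
      \<Longrightarrow> tlift V W (\<lambda>x y. f x * g y) t = 0"
  shows "t = 0"
proof -
  have "t \<in> tensor_space V {0}"
  proof (rule tensor_space_memI_slice[OF t V W])
    fix f :: "'a \<Rightarrow> complex" assume f: "linear_on V UNIV f"
    have "tlift V W (\<lambda>x y. f x *\<^sub>C y) t = 0"
      by (rule functionals_separate[OF W tlift_slice_left(1)[OF f t]])
        (simp add: tlift_slice_left(2)[OF f t] eq[OF f])
    then show "tlift V W (\<lambda>x y. f x *\<^sub>C y) t \<in> {0}" by simp
  qed
  then show ?thesis using V
  proof (induction rule: tensor_space_induct)
    case (add x y t)
    then show ?case using pure_tensor_scaleC_right[of x 0 0] by simp
  qed simp
qed

text \<open>Two jointly injective families of operators have a jointly injective family of tensor
  products. The operators are stripped from one leg at a time, by testing with functionals of the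
  other leg. Taking multiplications as operators shows that \<open>A \<otimes> B\<close> is nondegenerate.\<close>

lemma tensor_separation_tmap:
  assumes t: "t \<in> tensor_space V W"
    and P: "\<And>i. i \<in> I \<Longrightarrow> linear_on V V (p i)" and Q: "\<And>j. j \<in> J \<Longrightarrow> linear_on W W (q j)"
    and Pinj: "\<And>x. x \<in> V \<Longrightarrow> (\<And>i. i \<in> I \<Longrightarrow> p i x = 0) \<Longrightarrow> x = 0"
    and Qinj: "\<And>y. y \<in> W \<Longrightarrow> (\<And>j. j \<in> J \<Longrightarrow> q j y = 0) \<Longrightarrow> y = 0"
    and eq: "\<And>i j. i \<in> I \<Longrightarrow> j \<in> J \<Longrightarrow> tmap V W (p i) (q j) t = 0"
  shows "t = 0"
proof -
  have fg: "tlift V W (\<lambda>x y. f (p i x) * g (q j y)) t = 0"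
    if f: "linear_on V UNIV f" and g: "linear_on W UNIV g" and p: "i \<in> I" and q: "j \<in> J"
    for f :: "'a \<Rightarrow> complex" and g :: "'b \<Rightarrow> complex" and i j
  proof -
    have bl: "bilinear_on V W UNIV (\<lambda>x y. f x * g y)" by (rule bilinear_on_product[OF f g])
    have "tlift V W (\<lambda>x y. f (p i x) * g (q j y)) t = tlift V W (\<lambda>x y. f x * g y) (tmap V W (p i) (q j) t)"
      by (rule tlift_tmap[symmetric, OF V W V W P[OF p] Q[OF q] bl t])
    also have "\<dots> = 0" using eq[OF p q]
      linear_on_zero[OF linear_on_tlift[OF V W bl complex_vector.subspace_UNIV] subspace_tensor_space] by simp
    finally show ?thesis .
  qed
  have fg': "tlift V W (\<lambda>x y. f (p i x) * g y) t = 0"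
    if f: "linear_on V UNIV f" and g: "linear_on W UNIV g" and p: "i \<in> I"
    for f :: "'a \<Rightarrow> complex" and g :: "'b \<Rightarrow> complex" and i
  proof -
    let ?w = "tlift V W (\<lambda>x y. f (p i x) *\<^sub>C y) t"
    note w = tlift_slice_left[OF linear_on_compose[OF P[OF p] f] t]
    have "?w = 0"
    proof (rule Qinj[OF w(1)])
      fix j assume q: "j \<in> J"
      show "q j ?w = 0"
        by (rule functionals_separate[OF W linear_on_mem[OF Q[OF q] w(1)]])
          (simp add: w(2)[OF linear_on_compose[OF Q[OF q]]] fg[OF f _ p q])
    qed
    then show ?thesis using w(2)[OF g] linear_on_zero[OF g W] by simp
  qed
  show ?thesis
  proof (rule tensor_separation[OF t])
    fix f g assume f: "linear_on V UNIV (f :: 'a \<Rightarrow> complex)" and g: "linear_on W UNIV (g :: 'b \<Rightarrow> complex)"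
    let ?w = "tlift V W (\<lambda>x y. g y *\<^sub>C x) t"
    note w = tlift_slice_right[OF g t]
    have "?w = 0"
    proof (rule Pinj[OF w(1)])
      fix i assume p: "i \<in> I"
      show "p i ?w = 0"
        by (rule functionals_separate[OF V linear_on_mem[OF P[OF p] w(1)]])
          (simp add: w(2)[OF linear_on_compose[OF P[OF p]]] fg'[OF _ g p])
    qed
    then show "tlift V W (\<lambda>x y. f x * g y) t = 0" using w(2)[OF f] linear_on_zero[OF f V] by simp
  qed
qed

end

locale nondeg_pair = A: nondeg_alg A + B: nondeg_alg B
  for A :: "'a::complex_vector calg" and B :: "'b::complex_vector calg"
begin

abbreviation "T \<equiv> tensor_space (carrier A) (carrier B)"

lemma mult_tensor_alg_def: "mult (A \<otimes>\<^sub>A B) s t = tlift (carrier A) (carrier B) (\<lambda>x y.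
     tmap (carrier A) (carrier B) (\<lambda>x'. x \<cdot>\<^bsub>A\<^esub> x') (\<lambda>y'. y \<cdot>\<^bsub>B\<^esub> y') t) s"
  by (simp add: tensor_alg_def tmap_def)

lemma bilinear_outer:
  assumes t: "t \<in> T"
  shows "bilinear_on (carrier A) (carrier B) T
    (\<lambda>x y. tmap (carrier A) (carrier B) (\<lambda>x'. x \<cdot>\<^bsub>A\<^esub> x') (\<lambda>y'. y \<cdot>\<^bsub>B\<^esub> y') t)"
proof (rule bilinear_onI)
  let ?h = "\<lambda>x y. tmap (carrier A) (carrier B) (\<lambda>x'. x \<cdot>\<^bsub>A\<^esub> x') (\<lambda>y'. y \<cdot>\<^bsub>B\<^esub> y')"
  note sub = A.subspace B.subspace
  fix x y c assume x: "x \<in> carrier A" and y: "y \<in> carrier B"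
  note lx = A.linear_mult_left[OF x] and ly = B.linear_mult_left[OF y]
  show "?h x y t \<in> T" by (rule linear_on_mem[OF linear_on_tmap[OF sub lx ly] t])
  show "?h (c *\<^sub>C x) y t = c *\<^sub>C ?h x y t" "?h x (c *\<^sub>C y) t = c *\<^sub>C ?h x y t"
    using tmap_scaleC[OF sub lx ly t] by (simp_all add: x y A.lin_simps B.lin_simps cong: tmap_cong)
  show "?h (x + x') y t = ?h x y t + ?h x' y t" if x': "x' \<in> carrier A" for x'
    using tmap_add_left[OF sub lx A.linear_mult_left[OF x'] ly t]
    by (simp add: x x' A.lin_simps cong: tmap_cong)
  show "?h x (y + y') t = ?h x y t + ?h x y' t" if y': "y' \<in> carrier B" for y'
    using tmap_add_right[OF sub lx ly B.linear_mult_left[OF y'] t]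
    by (simp add: y y' B.lin_simps cong: tmap_cong)
qed

lemma tensor_mult_pure_left:
  assumes "x \<in> carrier A" "y \<in> carrier B" "t \<in> T"
  shows "(x \<otimes> y) \<cdot>\<^bsub>A \<otimes>\<^sub>A B\<^esub> t = tmap (carrier A) (carrier B) (\<lambda>x'. x \<cdot>\<^bsub>A\<^esub> x') (\<lambda>y'. y \<cdot>\<^bsub>B\<^esub> y') t"
  unfolding mult_tensor_alg_def
  by (rule tlift_pure[OF A.subspace B.subspace bilinear_outer[OF assms(3)] assms(1,2)])

lemma tensor_mult_pure:
  assumes "x \<in> carrier A" "y \<in> carrier B" "x' \<in> carrier A" "y' \<in> carrier B"
  shows "(x \<otimes> y) \<cdot>\<^bsub>A \<otimes>\<^sub>A B\<^esub> (x' \<otimes> y') = (x \<cdot>\<^bsub>A\<^esub> x') \<otimes> (y \<cdot>\<^bsub>B\<^esub> y')"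
  using assms by (simp add: tensor_mult_pure_left pure_tensor_mem
     tmap_pure[OF A.subspace B.subspace A.linear_mult_left B.linear_mult_left])

lemma linear_tensor_mult_right: "t \<in> T \<Longrightarrow> linear_on T T (\<lambda>s. s \<cdot>\<^bsub>A \<otimes>\<^sub>A B\<^esub> t)"
  unfolding mult_tensor_alg_def
  by (rule linear_on_tlift[OF A.subspace B.subspace bilinear_outer subspace_tensor_space])

lemma linear_tensor_mult_left:
  assumes "s \<in> T"
  shows "linear_on T T (\<lambda>t. s \<cdot>\<^bsub>A \<otimes>\<^sub>A B\<^esub> t)"
proof (rule linear_onI)
  fix t u c assume t: "t \<in> T"
  show "s \<cdot>\<^bsub>A \<otimes>\<^sub>A B\<^esub> t \<in> T" by (rule linear_on_mem[OF linear_tensor_mult_right[OF t] assms])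
  have lin: "linear_on T T (tmap (carrier A) (carrier B) (\<lambda>x'. x \<cdot>\<^bsub>A\<^esub> x') (\<lambda>y'. y \<cdot>\<^bsub>B\<^esub> y'))"
    if "x \<in> carrier A" "y \<in> carrier B" for x y
    by (rule linear_on_tmap[OF A.subspace B.subspace A.linear_mult_left[OF that(1)] B.linear_mult_left[OF that(2)]])
  show "s \<cdot>\<^bsub>A \<otimes>\<^sub>A B\<^esub> (c *\<^sub>C t) = c *\<^sub>C (s \<cdot>\<^bsub>A \<otimes>\<^sub>A B\<^esub> t)"
    using assms A.subspace
  proof (induction rule: tensor_space_induct)
    case (add x y s)
    then show ?case using t
      by (simp add: linear_on_add[OF linear_tensor_mult_right] pure_tensor_mem tensor_mult_pure_left
         linear_on_scaleC[OF lin] complex_vector.subspace_scale[OF subspace_tensor_space] scaleC_add_right)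
  qed (simp add: linear_on_zero[OF linear_tensor_mult_right subspace_tensor_space] t
      complex_vector.subspace_scale[OF subspace_tensor_space])
  show "s \<cdot>\<^bsub>A \<otimes>\<^sub>A B\<^esub> (t + u) = s \<cdot>\<^bsub>A \<otimes>\<^sub>A B\<^esub> t + s \<cdot>\<^bsub>A \<otimes>\<^sub>A B\<^esub> u" if u: "u \<in> T"
    using assms A.subspace
  proof (induction rule: tensor_space_induct)
    case (add x y s)
    then show ?case using t u
      by (simp add: linear_on_add[OF linear_tensor_mult_right] pure_tensor_mem tensor_mult_pure_left
         linear_on_add[OF lin] complex_vector.subspace_add[OF subspace_tensor_space])
  qed (simp add: linear_on_zero[OF linear_tensor_mult_right subspace_tensor_space] t u
      complex_vector.subspace_add[OF subspace_tensor_space])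
qed

lemma tensor_mult_pure_right:
  assumes x: "x \<in> carrier A" and y: "y \<in> carrier B" and t: "t \<in> T"
  shows "t \<cdot>\<^bsub>A \<otimes>\<^sub>A B\<^esub> (x \<otimes> y) = tmap (carrier A) (carrier B) (\<lambda>x'. x' \<cdot>\<^bsub>A\<^esub> x) (\<lambda>y'. y' \<cdot>\<^bsub>B\<^esub> y) t"
proof -
  note lin = linear_on_tmap[OF A.subspace B.subspace A.linear_mult_right[OF x] B.linear_mult_right[OF y]]
  show ?thesis
    by (rule linear_on_tensor_eqI[OF A.subspace linear_tensor_mult_right lin _ t])
      (simp_all add: x y pure_tensor_mem tensor_mult_pure
        tmap_pure[OF A.subspace B.subspace A.linear_mult_right[OF x] B.linear_mult_right[OF y]])
qed

lemma tensor_assoc: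
  assumes s: "s \<in> T" and t: "t \<in> T" and u: "u \<in> T"
  shows "(s \<cdot>\<^bsub>A \<otimes>\<^sub>A B\<^esub> t) \<cdot>\<^bsub>A \<otimes>\<^sub>A B\<^esub> u = s \<cdot>\<^bsub>A \<otimes>\<^sub>A B\<^esub> (t \<cdot>\<^bsub>A \<otimes>\<^sub>A B\<^esub> u)"
proof -
  note R = linear_tensor_mult_right and L = linear_tensor_mult_left
  note mem = linear_on_mem[OF R]
  have 1: "((x \<otimes> y) \<cdot>\<^bsub>A \<otimes>\<^sub>A B\<^esub> (x' \<otimes> y')) \<cdot>\<^bsub>A \<otimes>\<^sub>A B\<^esub> u = (x \<otimes> y) \<cdot>\<^bsub>A \<otimes>\<^sub>A B\<^esub> ((x' \<otimes> y') \<cdot>\<^bsub>A \<otimes>\<^sub>A B\<^esub> u)"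
    if "x \<in> carrier A" "y \<in> carrier B" "x' \<in> carrier A" "y' \<in> carrier B" for x y x' y'
  proof (rule linear_on_tensor_eqI[OF A.subspace L linear_on_compose[OF L L] _ u])
    fix v w assume "v \<in> carrier A" "w \<in> carrier B"
    with that show "((x \<otimes> y) \<cdot>\<^bsub>A \<otimes>\<^sub>A B\<^esub> (x' \<otimes> y')) \<cdot>\<^bsub>A \<otimes>\<^sub>A B\<^esub> (v \<otimes> w)
       = (x \<otimes> y) \<cdot>\<^bsub>A \<otimes>\<^sub>A B\<^esub> ((x' \<otimes> y') \<cdot>\<^bsub>A \<otimes>\<^sub>A B\<^esub> (v \<otimes> w))"
      by (simp add: tensor_mult_pure A.mem_simps B.mem_simps A.assoc B.assoc)
  qed (use that in \<open>simp_all add: pure_tensor_mem mem\<close>)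
  have 2: "((x \<otimes> y) \<cdot>\<^bsub>A \<otimes>\<^sub>A B\<^esub> t) \<cdot>\<^bsub>A \<otimes>\<^sub>A B\<^esub> u = (x \<otimes> y) \<cdot>\<^bsub>A \<otimes>\<^sub>A B\<^esub> (t \<cdot>\<^bsub>A \<otimes>\<^sub>A B\<^esub> u)"
    if "x \<in> carrier A" "y \<in> carrier B" for x y
    by (rule linear_on_tensor_eqI[OF A.subspace linear_on_compose[OF L R] linear_on_compose[OF R L] 1 t])
      (simp_all add: that pure_tensor_mem u)
  show ?thesis
    by (rule linear_on_tensor_eqI[OF A.subspace linear_on_compose[OF R R] R 2 s])
      (simp_all add: t u mem)
qed

lemma nondegenerate_tensor_alg: "nondegenerate_algebra (A \<otimes>\<^sub>A B)"
  unfolding nondegenerate_algebra_def carrier_tensor_alg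
proof (intro conjI ballI impI)
  show "complex_vector.subspace T" by (rule subspace_tensor_space)
  show "bilinear_on T T T (mult (A \<otimes>\<^sub>A B))"
    unfolding bilinear_on_def using linear_tensor_mult_left linear_tensor_mult_right by simp
  show "(s \<cdot>\<^bsub>A \<otimes>\<^sub>A B\<^esub> t) \<cdot>\<^bsub>A \<otimes>\<^sub>A B\<^esub> u = s \<cdot>\<^bsub>A \<otimes>\<^sub>A B\<^esub> (t \<cdot>\<^bsub>A \<otimes>\<^sub>A B\<^esub> u)"
    if "s \<in> T" "t \<in> T" "u \<in> T" for s t u using that by (rule tensor_assoc)
  show "t = 0" if t: "t \<in> T" and z: "\<forall>s\<in>T. t \<cdot>\<^bsub>A \<otimes>\<^sub>A B\<^esub> s = 0" for t
  proof (rule tensor_separation_tmap[OF A.subspace B.subspace t])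
    show "tmap (carrier A) (carrier B) (\<lambda>x. x \<cdot>\<^bsub>A\<^esub> a) (\<lambda>y. y \<cdot>\<^bsub>B\<^esub> b) t = 0"
      if "a \<in> carrier A" "b \<in> carrier B" for a b
      using z pure_tensor_mem[OF that] by (simp add: tensor_mult_pure_right[OF that t, symmetric])
  qed (simp_all add: A.linear_mult_right B.linear_mult_right A.right_zero B.right_zero)
  show "t = 0" if t: "t \<in> T" and z: "\<forall>s\<in>T. s \<cdot>\<^bsub>A \<otimes>\<^sub>A B\<^esub> t = 0" for t
  proof (rule tensor_separation_tmap[OF A.subspace B.subspace t])
    show "tmap (carrier A) (carrier B) (\<lambda>x. a \<cdot>\<^bsub>A\<^esub> x) (\<lambda>y. b \<cdot>\<^bsub>B\<^esub> y) t = 0"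
      if "a \<in> carrier A" "b \<in> carrier B" for a b
      using z pure_tensor_mem[OF that] by (simp add: tensor_mult_pure_left[OF that t, symmetric])
  qed (simp_all add: A.linear_mult_left B.linear_mult_left A.left_zero B.left_zero)
qed

end

sublocale nondeg_pair \<subseteq> AB: nondeg_alg "A \<otimes>\<^sub>A B"
  by (rule nondeg_alg.intro[OF nondegenerate_tensor_alg])

lemma linear_on_ident: "linear_on V V (\<lambda>x. x)"
  by (rule linear_onI) simp_all

context nondeg_pair
begin

lemma fst_mult_tensor:
  assumes "t \<in> T"
  shows "fst (mult_tensor A B m n) t = tmap (carrier A) (carrier B) (fst m) (fst n) t"
    and "snd (mult_tensor A B m n) t = tmap (carrier A) (carrier B) (snd m) (snd n) t"
  using assms by (simp_all add: mult_tensor_def carrier_tensor_alg)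

lemma fst_mult_tensor_pure:
  assumes m: "m \<in> carrier (mult_alg A)" and n: "n \<in> carrier (mult_alg B)"
    and x: "x \<in> carrier A" and y: "y \<in> carrier B"
  shows "fst (mult_tensor A B m n) (x \<otimes> y) = fst m x \<otimes> fst n y"
    and "snd (mult_tensor A B m n) (x \<otimes> y) = snd m x \<otimes> snd n y"
  using tmap_pure[OF A.subspace B.subspace A.mult_algD(1)[OF m] B.mult_algD(1)[OF n] x y]
    tmap_pure[OF A.subspace B.subspace A.mult_algD(2)[OF m] B.mult_algD(2)[OF n] x y]
  by (simp_all add: fst_mult_tensor pure_tensor_mem[OF x y])

lemma mult_tensor_mem:
  assumes m: "m \<in> carrier (mult_alg A)" and n: "n \<in> carrier (mult_alg B)"
  shows "mult_tensor A B m n \<in> carrier (mult_alg (A \<otimes>\<^sub>A B))"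
proof (rule AB.mult_algI, unfold carrier_tensor_alg)
  note L = linear_on_tmap[OF A.subspace B.subspace A.mult_algD(1)[OF m] B.mult_algD(1)[OF n]]
  note R = linear_on_tmap[OF A.subspace B.subspace A.mult_algD(2)[OF m] B.mult_algD(2)[OF n]]
  show 1: "linear_on T T (fst (mult_tensor A B m n))"
    by (rule linear_onI) (simp_all add: fst_mult_tensor linear_rules[OF L] complex_vector.subspace_add[OF subspace_tensor_space]
      complex_vector.subspace_scale[OF subspace_tensor_space])
  show 2: "linear_on T T (snd (mult_tensor A B m n))"
    by (rule linear_onI) (simp_all add: fst_mult_tensor linear_rules[OF R] complex_vector.subspace_add[OF subspace_tensor_space]
      complex_vector.subspace_scale[OF subspace_tensor_space])
  show "fst (mult_tensor A B m n) t = 0" "snd (mult_tensor A B m n) t = 0" if "t \<notin> T" for t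
    using that by (simp_all add: mult_tensor_def carrier_tensor_alg)
  show "s \<cdot>\<^bsub>A \<otimes>\<^sub>A B\<^esub> fst (mult_tensor A B m n) t = snd (mult_tensor A B m n) s \<cdot>\<^bsub>A \<otimes>\<^sub>A B\<^esub> t"
    if s: "s \<in> T" and t: "t \<in> T" for s t
  proof -
    note LM = linear_tensor_mult_left and RM = linear_tensor_mult_right
    have *: "(x \<otimes> y) \<cdot>\<^bsub>A \<otimes>\<^sub>A B\<^esub> fst (mult_tensor A B m n) t = snd (mult_tensor A B m n) (x \<otimes> y) \<cdot>\<^bsub>A \<otimes>\<^sub>A B\<^esub> t"
      if xy: "x \<in> carrier A" "y \<in> carrier B" for x y
      by (rule linear_on_tensor_eqI[OF A.subspace linear_on_compose[OF 1 LM] LM _ t])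
        (simp_all add: xy pure_tensor_mem fst_mult_tensor_pure[OF m n] A.snd_mem[OF m] B.snd_mem[OF n]
          A.fst_mem[OF m] B.fst_mem[OF n] tensor_mult_pure A.mult_algD(5)[OF m] B.mult_algD(5)[OF n])
    show ?thesis
      by (rule linear_on_tensor_eqI[OF A.subspace RM linear_on_compose[OF 2 RM] * s])
        (simp_all add: t linear_on_mem[OF 1])
  qed
qed

lemma bilinear_mult_tensor:
  "bilinear_on (carrier (mult_alg A)) (carrier (mult_alg B)) UNIV (mult_tensor A B)"
proof (rule bilinear_onI)
  fix m m' n n' c assume m: "m \<in> carrier (mult_alg A)" and n: "n \<in> carrier (mult_alg B)"
  note ml = A.mult_algD(1) and mr = A.mult_algD(2) and nl = B.mult_algD(1) and nr = B.mult_algD(2)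
  note sub = A.subspace B.subspace
  show "mult_tensor A B (m + m') n = mult_tensor A B m n + mult_tensor A B m' n"
    if m': "m' \<in> carrier (mult_alg A)"
    by (rule prod_eqI; rule ext)
      (simp_all add: mult_tensor_def carrier_tensor_alg plus_fun_def
        tmap_add_left[OF sub ml[OF m] ml[OF m'] nl[OF n]] tmap_add_left[OF sub mr[OF m] mr[OF m'] nr[OF n]])
  show "mult_tensor A B m (n + n') = mult_tensor A B m n + mult_tensor A B m n'"
    if n': "n' \<in> carrier (mult_alg B)"
    by (rule prod_eqI; rule ext)
      (simp_all add: mult_tensor_def carrier_tensor_alg plus_fun_def
        tmap_add_right[OF sub ml[OF m] nl[OF n] nl[OF n']] tmap_add_right[OF sub mr[OF m] nr[OF n] nr[OF n']])
  show "mult_tensor A B (c *\<^sub>C m) n = c *\<^sub>C mult_tensor A B m n"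
    "mult_tensor A B m (c *\<^sub>C n) = c *\<^sub>C mult_tensor A B m n"
    by (auto simp: prod_eq_iff fun_eq_iff mult_tensor_def carrier_tensor_alg scaleC_prod_def scaleC_fun_def
        tmap_scaleC[OF sub ml[OF m] nl[OF n]] tmap_scaleC[OF sub mr[OF m] nr[OF n]])
qed simp

end

section \<open>Covered coproducts\<close>

locale hopf =
  fixes A :: "'a::complex_vector calg" and \<Delta> :: "'a coproduct"
  assumes hopf: "regular_multiplier_hopf_algebra A \<Delta>"

sublocale hopf \<subseteq> nondeg_alg A
  using hopf by (intro nondeg_alg.intro) (simp add: regular_multiplier_hopf_algebra_def)

text \<open>\<open>A\<close>, \<open>A \<otimes> A\<close> and both bracketings of \<open>A \<otimes> A \<otimes> A\<close> are nondegenerate, so identities between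
  their elements can be checked in their multiplier algebras.\<close>

sublocale hopf \<subseteq> AA: nondeg_pair A A ..

sublocale hopf \<subseteq> LA: nondeg_pair "A \<otimes>\<^sub>A A" A ..

sublocale hopf \<subseteq> AR: nondeg_pair A "A \<otimes>\<^sub>A A" ..

context hopf
begin

abbreviation "C \<equiv> carrier A"
abbreviation "T \<equiv> tensor_space C C"
abbreviation "tL \<equiv> tlift C C"
abbreviation "cl \<equiv> cov_left A \<Delta>"
abbreviation "cr \<equiv> cov_right A \<Delta>"
abbreviation amult (infixl "\<bullet>" 75) where "amult \<equiv> mult A"

lemmas pure_mem = pure_tensor_mem[of _ C _ C]
lemmas T_add = complex_vector.subspace_add[OF subspace_tensor_space[of C C]]
lemmas T_scale = complex_vector.subspace_scale[OF subspace_tensor_space[of C C]]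
lemmas UNIV_sub = complex_vector.subspace_UNIV

lemma cop_mem: "a \<in> C \<Longrightarrow> \<Delta> a \<in> carrier (M2 A)"
  using hopf by (auto simp: regular_multiplier_hopf_algebra_def alg_hom_def linear_on_def)

lemma cop_mult: "a \<in> C \<Longrightarrow> b \<in> C \<Longrightarrow> \<Delta> (a \<bullet> b) = \<Delta> a \<cdot>\<^bsub>M2 A\<^esub> \<Delta> b"
  using hopf by (simp add: regular_multiplier_hopf_algebra_def alg_hom_def)

lemma cop_add: "a \<in> C \<Longrightarrow> b \<in> C \<Longrightarrow> \<Delta> (a + b) = \<Delta> a + \<Delta> b"
  and cop_scale: "a \<in> C \<Longrightarrow> \<Delta> (c *\<^sub>C a) = c *\<^sub>C \<Delta> a"
  using hopf by (simp_all add: regular_multiplier_hopf_algebra_def alg_hom_def linear_on_def)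

lemma in_left_mem: "a \<in> C \<Longrightarrow> in_left A a \<in> carrier (M2 A)"
  and in_right_mem: "a \<in> C \<Longrightarrow> in_right A a \<in> carrier (M2 A)"
  unfolding in_left_def in_right_def by (simp_all add: AA.mult_tensor_mem embed_mem mult_one_mem)

lemma in_left_simps:
  assumes "t \<in> T"
  shows "fst (in_left A a) t = tmap C C (\<lambda>x. a \<bullet> x) (\<lambda>y. y) t"
    and "snd (in_left A a) t = tmap C C (\<lambda>x. x \<bullet> a) (\<lambda>y. y) t"
    and "fst (in_right A a) t = tmap C C (\<lambda>x. x) (\<lambda>y. a \<bullet> y) t"
    and "snd (in_right A a) t = tmap C C (\<lambda>x. x) (\<lambda>y. y \<bullet> a) t"
  unfolding in_left_def in_right_def AA.fst_mult_tensor[OF assms]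
  by (simp_all add: fst_embed snd_embed fst_mult_one snd_mult_one cong: tmap_cong)

lemma in_pure:
  assumes "a \<in> C" "x \<in> C" "y \<in> C"
  shows "fst (in_left A a) (x \<otimes> y) = (a \<bullet> x) \<otimes> y"
    and "snd (in_left A a) (x \<otimes> y) = (x \<bullet> a) \<otimes> y"
    and "fst (in_right A a) (x \<otimes> y) = x \<otimes> (a \<bullet> y)"
    and "snd (in_right A a) (x \<otimes> y) = x \<otimes> (y \<bullet> a)"
  unfolding in_left_def in_right_def
  by (simp_all add: AA.fst_mult_tensor_pure assms embed_mem mult_one_mem fst_embed snd_embed fst_mult_one snd_mult_one)

lemma in_alg_cov:
  assumes "a \<in> C" "b \<in> C"
  shows "in_alg (A \<otimes>\<^sub>A A) (\<Delta> a \<cdot>\<^bsub>M2 A\<^esub> in_right A b)"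
    and "in_alg (A \<otimes>\<^sub>A A) (in_left A a \<cdot>\<^bsub>M2 A\<^esub> \<Delta> b)"
    and "in_alg (A \<otimes>\<^sub>A A) (\<Delta> a \<cdot>\<^bsub>M2 A\<^esub> in_left A b)"
    and "in_alg (A \<otimes>\<^sub>A A) (in_right A a \<cdot>\<^bsub>M2 A\<^esub> \<Delta> b)"
  using hopf assms by (simp_all add: regular_multiplier_hopf_algebra_def)

lemma cr_mem: "a \<in> C \<Longrightarrow> b \<in> C \<Longrightarrow> cr a b \<in> T"
  and embed_cr: "a \<in> C \<Longrightarrow> b \<in> C \<Longrightarrow> embed (A \<otimes>\<^sub>A A) (cr a b) = \<Delta> a \<cdot>\<^bsub>M2 A\<^esub> in_right A b"
  unfolding cov_right_def using AA.AB.in_algD[OF in_alg_cov(1)] by (simp_all add: carrier_tensor_alg)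

lemma cl_mem: "a \<in> C \<Longrightarrow> b \<in> C \<Longrightarrow> cl a b \<in> T"
  and embed_cl: "a \<in> C \<Longrightarrow> b \<in> C \<Longrightarrow> embed (A \<otimes>\<^sub>A A) (cl a b) = in_left A a \<cdot>\<^bsub>M2 A\<^esub> \<Delta> b"
  unfolding cov_left_def using AA.AB.in_algD[OF in_alg_cov(2)] by (simp_all add: carrier_tensor_alg)

lemma embed_cancel: "s \<in> T \<Longrightarrow> t \<in> T \<Longrightarrow> embed (A \<otimes>\<^sub>A A) s = embed (A \<otimes>\<^sub>A A) t \<Longrightarrow> s = t"
  using inj_onD[OF AA.AB.inj_embed] by (simp add: carrier_tensor_alg)

lemmas fst_mem2 = AA.AB.fst_mem[unfolded carrier_tensor_alg]
lemmas snd_mem2 = AA.AB.snd_mem[unfolded carrier_tensor_alg]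
lemmas mult_embed2 = AA.AB.mult_embed[unfolded carrier_tensor_alg]
lemmas embed_mult2 = AA.AB.embed_mult[unfolded carrier_tensor_alg]
lemmas lin_fst2 = AA.AB.mult_algD(1)[unfolded carrier_tensor_alg]
lemmas lin_snd2 = AA.AB.mult_algD(2)[unfolded carrier_tensor_alg]

text \<open>\<open>((y \<otimes> 1)\<Delta>(a))(1 \<otimes> x) = (y \<otimes> 1)(\<Delta>(a)(1 \<otimes> x))\<close>: the way to pass from one covered coproduct
  to the other.\<close>

lemma cl_right:
  assumes "y \<in> C" "a \<in> C" "x \<in> C"
  shows "tmap C C (\<lambda>u. u) (\<lambda>v. v \<bullet> x) (cl y a) = tmap C C (\<lambda>u. y \<bullet> u) (\<lambda>v. v) (cr a x)"
proof -
  have "snd (in_right A x) (cl y a) = fst (in_left A y) (cr a x)"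
    by (rule embed_cancel)
      (simp_all add: assms cr_mem cl_mem fst_mem2 snd_mem2 in_left_mem in_right_mem
        AA.AB.mult_alg_assoc embed_cl embed_cr flip: mult_embed2 embed_mult2)
  then show ?thesis by (simp add: in_left_simps assms cl_mem cr_mem)
qed

lemma embed_pure:
  assumes "x \<in> C" "a \<in> C"
  shows "embed (A \<otimes>\<^sub>A A) (x \<otimes> a) = in_right A a \<cdot>\<^bsub>M2 A\<^esub> in_left A x"
proof (rule AA.AB.multiplier_eqI)
  fix t assume "t \<in> carrier (A \<otimes>\<^sub>A A)"
  then have t: "t \<in> T" by (simp add: carrier_tensor_alg)
  note f = linear_on_compose[OF lin_fst2[OF in_left_mem] lin_fst2[OF in_right_mem]]
  have "(x \<otimes> a) \<cdot>\<^bsub>A \<otimes>\<^sub>A A\<^esub> t = fst (in_right A a) (fst (in_left A x) t)"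
    by (rule linear_on_tensor_eqI[OF subspace AA.linear_tensor_mult_left f _ t])
      (simp_all add: assms pure_mem AA.tensor_mult_pure in_pure mem_simps)
  then show "fst (embed (A \<otimes>\<^sub>A A) (x \<otimes> a)) t = fst (in_right A a \<cdot>\<^bsub>M2 A\<^esub> in_left A x) t"
    using t by (simp add: AA.AB.fst_mult_alg AA.AB.fst_embed carrier_tensor_alg)
qed (simp_all add: assms AA.AB.embed_mem AA.AB.mult_alg_mult_mem in_left_mem in_right_mem carrier_tensor_alg pure_mem)

lemma in_left_mult:
  assumes "x \<in> C" "y \<in> C"
  shows "in_left A (x \<bullet> y) = in_left A x \<cdot>\<^bsub>M2 A\<^esub> in_left A y"
proof (rule AA.AB.multiplier_eqI)
  fix t assume "t \<in> carrier (A \<otimes>\<^sub>A A)"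
  then have t: "t \<in> T" by (simp add: carrier_tensor_alg)
  show "fst (in_left A (x \<bullet> y)) t = fst (in_left A x \<cdot>\<^bsub>M2 A\<^esub> in_left A y) t"
    unfolding AA.AB.fst_mult_alg
    by (rule linear_on_tensor_eqI[OF subspace lin_fst2[OF in_left_mem]
         linear_on_compose[OF lin_fst2[OF in_left_mem] lin_fst2[OF in_left_mem]] _ t])
      (simp_all add: assms in_pure mem_simps assoc)
qed (simp_all add: assms AA.AB.mult_alg_mult_mem in_left_mem mem_simps)

lemma in_right_mult:
  assumes "x \<in> C" "y \<in> C"
  shows "in_right A (x \<bullet> y) = in_right A x \<cdot>\<^bsub>M2 A\<^esub> in_right A y"
proof (rule AA.AB.multiplier_eqI)
  fix t assume "t \<in> carrier (A \<otimes>\<^sub>A A)"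
  then have t: "t \<in> T" by (simp add: carrier_tensor_alg)
  show "fst (in_right A (x \<bullet> y)) t = fst (in_right A x \<cdot>\<^bsub>M2 A\<^esub> in_right A y) t"
    unfolding AA.AB.fst_mult_alg
    by (rule linear_on_tensor_eqI[OF subspace lin_fst2[OF in_right_mem]
         linear_on_compose[OF lin_fst2[OF in_right_mem] lin_fst2[OF in_right_mem]] _ t])
      (simp_all add: assms in_pure mem_simps assoc)
qed (simp_all add: assms AA.AB.mult_alg_mult_mem in_right_mem mem_simps)

lemma in_left_in_right:
  assumes "x \<in> C" "y \<in> C"
  shows "in_left A x \<cdot>\<^bsub>M2 A\<^esub> in_right A y = in_right A y \<cdot>\<^bsub>M2 A\<^esub> in_left A x"
proof (rule AA.AB.multiplier_eqI)
  fix t assume "t \<in> carrier (A \<otimes>\<^sub>A A)"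
  then have t: "t \<in> T" by (simp add: carrier_tensor_alg)
  show "fst (in_left A x \<cdot>\<^bsub>M2 A\<^esub> in_right A y) t = fst (in_right A y \<cdot>\<^bsub>M2 A\<^esub> in_left A x) t"
    unfolding AA.AB.fst_mult_alg
    by (rule linear_on_tensor_eqI[OF subspace
          linear_on_compose[OF lin_fst2[OF in_right_mem] lin_fst2[OF in_left_mem]]
          linear_on_compose[OF lin_fst2[OF in_left_mem] lin_fst2[OF in_right_mem]] _ t])
      (simp_all add: assms in_pure mem_simps)
qed (simp_all add: assms AA.AB.mult_alg_mult_mem in_left_mem in_right_mem)

lemma cr_mult:
  assumes "a \<in> C" "x \<in> C" "y \<in> C"
  shows "cr a (x \<bullet> y) = tmap C C (\<lambda>u. u) (\<lambda>v. v \<bullet> y) (cr a x)"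
proof -
  have "cr a (x \<bullet> y) = snd (in_right A y) (cr a x)"
    by (rule embed_cancel)
      (simp_all add: assms cr_mem snd_mem2 in_right_mem mem_simps
        AA.AB.mult_alg_assoc embed_cr in_right_mult flip: embed_mult2)
  then show ?thesis by (simp add: in_left_simps assms cr_mem)
qed

lemma cl_mult:
  assumes "a \<in> C" "x \<in> C" "y \<in> C"
  shows "cl (x \<bullet> y) a = tmap C C (\<lambda>u. x \<bullet> u) (\<lambda>v. v) (cl y a)"
proof -
  have "cl (x \<bullet> y) a = fst (in_left A x) (cl y a)"
    by (rule embed_cancel)
      (simp_all add: assms cl_mem fst_mem2 in_left_mem mem_simps
        AA.AB.mult_alg_assoc embed_cl in_left_mult flip: mult_embed2)
  then show ?thesis by (simp add: in_left_simps assms cl_mem)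
qed

text \<open>The multiplier \<open>\<Delta>(b)\<close> acts on pure tensors through the covered coproducts, as
  \<open>x \<otimes> a = (1 \<otimes> a)(x \<otimes> 1) = (x \<otimes> 1)(1 \<otimes> a)\<close>; and \<open>snd\<close> of it is multiplication from the right, which
  fits the multiplicativity of \<open>\<Delta>\<close>.\<close>

lemma snd_cop_pure:
  assumes "x \<in> C" "a \<in> C" "b \<in> C"
  shows "snd (\<Delta> b) (x \<otimes> a) = tmap C C (\<lambda>u. u) (\<lambda>v. a \<bullet> v) (cl x b)"
proof -
  have "snd (\<Delta> b) (x \<otimes> a) = fst (in_right A a) (cl x b)"
    by (rule embed_cancel)
      (simp_all add: assms cl_mem fst_mem2 snd_mem2 in_right_mem cop_mem pure_mem
        AA.AB.mult_alg_assoc embed_cl embed_pure flip: mult_embed2 embed_mult2)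
  then show ?thesis by (simp add: in_left_simps assms cl_mem)
qed

lemma snd_cop_cl:
  assumes "p \<in> C" "q \<in> C" "b \<in> C"
  shows "snd (\<Delta> b) (cl p q) = cl p (q \<bullet> b)"
  by (rule embed_cancel)
    (simp_all add: assms cl_mem snd_mem2 cop_mem mem_simps
      AA.AB.mult_alg_assoc embed_cl cop_mult flip: embed_mult2)

lemma fst_cop_pure:
  assumes "x \<in> C" "y \<in> C" "a \<in> C"
  shows "fst (\<Delta> a) (x \<otimes> y) = tmap C C (\<lambda>u. u \<bullet> x) (\<lambda>v. v) (cr a y)"
proof -
  have "fst (\<Delta> a) (x \<otimes> y) = snd (in_left A x) (cr a y)"
    by (rule embed_cancel)
      (simp_all add: assms cr_mem fst_mem2 snd_mem2 in_left_mem cop_mem pure_mem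
        embed_cr embed_pure flip: mult_embed2 embed_mult2, simp add: AA.AB.mult_alg_assoc)
  then show ?thesis by (simp add: in_left_simps assms cr_mem)
qed

lemma cr_times: "a \<in> C \<Longrightarrow> b \<in> C \<Longrightarrow> s \<in> T
    \<Longrightarrow> cr a b \<cdot>\<^bsub>A \<otimes>\<^sub>A A\<^esub> s = fst (\<Delta> a) (fst (in_right A b) s)"
  using embed_cr[of a b] AA.AB.fst_mult_alg[of "\<Delta> a" "in_right A b" s]
    AA.AB.fst_embed[unfolded carrier_tensor_alg, of s "cr a b"] by simp

lemma times_cl: "a \<in> C \<Longrightarrow> b \<in> C \<Longrightarrow> s \<in> T
    \<Longrightarrow> s \<cdot>\<^bsub>A \<otimes>\<^sub>A A\<^esub> cl a b = snd (\<Delta> b) (snd (in_left A a) s)"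
  using embed_cl[of a b] AA.AB.snd_mult_alg[of "in_left A a" "\<Delta> b" s]
    AA.AB.snd_embed[unfolded carrier_tensor_alg, of s "cl a b"] by simp

lemma cl_times: "a \<in> C \<Longrightarrow> b \<in> C \<Longrightarrow> s \<in> T
    \<Longrightarrow> cl a b \<cdot>\<^bsub>A \<otimes>\<^sub>A A\<^esub> s = fst (in_left A a) (fst (\<Delta> b) s)"
  using embed_cl[of a b] AA.AB.fst_mult_alg[of "in_left A a" "\<Delta> b" s]
    AA.AB.fst_embed[unfolded carrier_tensor_alg, of s "cl a b"] by simp

lemmas right_cancel2 = AA.AB.right_cancel[unfolded carrier_tensor_alg]

lemma in_left_linear:
  assumes "a \<in> C"
  shows "b \<in> C \<Longrightarrow> in_left A (a + b) = in_left A a + in_left A b"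
    and "in_left A (c *\<^sub>C a) = c *\<^sub>C in_left A a"
    and "b \<in> C \<Longrightarrow> in_right A (a + b) = in_right A a + in_right A b"
    and "in_right A (c *\<^sub>C a) = c *\<^sub>C in_right A a"
  unfolding in_left_def in_right_def
  by (simp_all add: bilinear_onD[OF AA.bilinear_mult_tensor] linear_rules[OF linear_embed] mult_one_mem assms)

lemma bilinear_cr: "bilinear_on C C T cr"
proof (rule bilinear_onI)
  fix a a' b b' c assume a: "a \<in> C" and b: "b \<in> C"
  show "cr a b \<in> T" using a b by (rule cr_mem)
  note R = AA.linear_tensor_mult_right
  note simps = cr_times cr_mem mem_simps T_add T_scale linear_rules[OF R]
    cop_add cop_scale in_left_linear fst_mem2 in_right_mem cop_mem linear_rules[OF lin_fst2]
    scaleC_prod_def scaleC_fun_def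
  show "cr (a + a') b = cr a b + cr a' b" if "a' \<in> C"
    by (rule right_cancel2) (simp_all add: simps a b that)
  show "cr (c *\<^sub>C a) b = c *\<^sub>C cr a b"
    by (rule right_cancel2) (simp_all add: simps a b)
  show "cr a (b + b') = cr a b + cr a b'" if "b' \<in> C"
    by (rule right_cancel2) (simp_all add: simps a b that)
  show "cr a (c *\<^sub>C b) = c *\<^sub>C cr a b"
    by (rule right_cancel2) (simp_all add: simps a b)
qed

lemmas left_cancel2 = AA.AB.left_cancel[unfolded carrier_tensor_alg]

lemma bilinear_cl: "bilinear_on C C T cl"
proof (rule bilinear_onI)
  fix a a' b b' c assume a: "a \<in> C" and b: "b \<in> C"
  show "cl a b \<in> T" using a b by (rule cl_mem)
  note L = AA.linear_tensor_mult_left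
  note simps = times_cl cl_mem mem_simps T_add T_scale linear_rules[OF L]
    cop_add cop_scale in_left_linear snd_mem2 in_left_mem cop_mem linear_rules[OF lin_snd2]
    scaleC_prod_def scaleC_fun_def
  show "cl (a + a') b = cl a b + cl a' b" if "a' \<in> C"
    by (rule left_cancel2) (simp_all add: simps a b that)
  show "cl (c *\<^sub>C a) b = c *\<^sub>C cl a b"
    by (rule left_cancel2) (simp_all add: simps a b)
  show "cl a (b + b') = cl a b + cl a b'" if "b' \<in> C"
    by (rule left_cancel2) (simp_all add: simps a b that)
  show "cl a (c *\<^sub>C b) = c *\<^sub>C cl a b"
    by (rule left_cancel2) (simp_all add: simps a b)
qed

text \<open>The covered coproducts span \<open>A \<otimes> A\<close>, as the canonical maps are onto. Most identities below
  are proved in this form: a claim about pure tensors is checked on covered coproducts, where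
  counit, antipode and integrals can be evaluated.\<close>

lemma linear_on_eqI_cr:
  assumes f: "linear_on T U f" and g: "linear_on T U' g"
    and eq: "\<And>p q. p \<in> C \<Longrightarrow> q \<in> C \<Longrightarrow> f (cr p q) = g (cr p q)" and t: "t \<in> T"
  shows "f t = g t"
proof -
  have "bij_betw (tL cr) T T"
    using hopf by (simp add: regular_multiplier_hopf_algebra_def canonical_maps_bijective_def carrier_tensor_alg)
  from bij_betw_imp_surj_on[OF this] have "t \<in> tL cr ` T" using t by simp
  then obtain s where s: "s \<in> T" "tL cr s = t" by (elim imageE) simp
  note l = linear_on_tlift[OF subspace subspace bilinear_cr subspace_tensor_space]
  have "f (tL cr s) = g (tL cr s)"
    by (rule linear_on_tensor_eqI[OF subspace linear_on_compose[OF l f] linear_on_compose[OF l g] _ s(1)])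
      (simp add: tlift_pure[OF subspace subspace bilinear_cr] eq)
  then show ?thesis using s by simp
qed

lemma linear_on_eqI_cl:
  assumes f: "linear_on T U f" and g: "linear_on T U' g"
    and eq: "\<And>p q. p \<in> C \<Longrightarrow> q \<in> C \<Longrightarrow> f (cl p q) = g (cl p q)" and t: "t \<in> T"
  shows "f t = g t"
proof -
  have "bij_betw (tL cl) T T"
    using hopf by (simp add: regular_multiplier_hopf_algebra_def canonical_maps_bijective_def carrier_tensor_alg)
  from bij_betw_imp_surj_on[OF this] have "t \<in> tL cl ` T" using t by simp
  then obtain s where s: "s \<in> T" "tL cl s = t" by (elim imageE) simp
  note l = linear_on_tlift[OF subspace subspace bilinear_cl subspace_tensor_space]
  have "f (tL cl s) = g (tL cl s)"
    by (rule linear_on_tensor_eqI[OF subspace linear_on_compose[OF l f] linear_on_compose[OF l g] _ s(1)])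
      (simp add: tlift_pure[OF subspace subspace bilinear_cl] eq)
  then show ?thesis using s by simp
qed

end

section \<open>Coassociativity\<close>

lemma bilinear_on_assoc_inner:
  "bilinear_on U V (tensor_space U (tensor_space V W)) (\<lambda>x y. x \<otimes> y \<otimes> z)" if "z \<in> W"
  by (rule bilinear_onI) (simp_all add: that pure_tensor_mem pure_tensor_add_left pure_tensor_add_right
     pure_tensor_scaleC_left pure_tensor_scaleC_right)

lemma bilinear_on_assoc_outer:
  assumes U: "complex_vector.subspace U" and V: "complex_vector.subspace V"
  shows "bilinear_on (tensor_space U V) W (tensor_space U (tensor_space V W))
     (\<lambda>s z. tlift U V (\<lambda>x y. x \<otimes> y \<otimes> z) s)"
proof (rule bilinear_onI)
  fix s z c assume s: "s \<in> tensor_space U V" and z: "z \<in> W"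
  note bl = bilinear_on_assoc_inner
  show "tlift U V (\<lambda>x y. x \<otimes> y \<otimes> (z + z')) s =
      tlift U V (\<lambda>x y. x \<otimes> y \<otimes> z) s + tlift U V (\<lambda>x y. x \<otimes> y \<otimes> z') s" if "z' \<in> W" for z'
    unfolding pure_tensor_add_right by (rule tlift_add[OF U V bl[OF z] bl[OF that] s])
  show "tlift U V (\<lambda>x y. x \<otimes> y \<otimes> (c *\<^sub>C z)) s = c *\<^sub>C tlift U V (\<lambda>x y. x \<otimes> y \<otimes> z) s"
    unfolding pure_tensor_scaleC_right by (rule tlift_scaleC[OF U V bl[OF z] s])
qed (simp_all add: linear_rules[OF linear_on_tlift[OF U V bilinear_on_assoc_inner subspace_tensor_space]])

lemma linear_on_tassoc:
  assumes "complex_vector.subspace U" "complex_vector.subspace V" "complex_vector.subspace W"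
  shows "linear_on (tensor_space (tensor_space U V) W) (tensor_space U (tensor_space V W)) (tassoc U V W)"
  unfolding tassoc_def
  by (rule linear_on_tlift[OF subspace_tensor_space assms(3) bilinear_on_assoc_outer[OF assms(1,2)] subspace_tensor_space])

lemma tassoc_pure_right:
  assumes "complex_vector.subspace U" "complex_vector.subspace V" "complex_vector.subspace W"
    and "s \<in> tensor_space U V" "z \<in> W"
  shows "tassoc U V W (s \<otimes> z) = tlift U V (\<lambda>x y. x \<otimes> y \<otimes> z) s"
  unfolding tassoc_def
  by (rule tlift_pure[OF subspace_tensor_space assms(3) bilinear_on_assoc_outer[OF assms(1,2)] assms(4,5)])

lemma tassoc_pure:
  assumes "complex_vector.subspace U" "complex_vector.subspace V" "complex_vector.subspace W"
    and "x \<in> U" "y \<in> V" "z \<in> W"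
  shows "tassoc U V W ((x \<otimes> y) \<otimes> z) = x \<otimes> y \<otimes> z"
  using assms by (simp add: tassoc_pure_right pure_tensor_mem
     tlift_pure[OF assms(1,2) bilinear_on_assoc_inner])

definition tassoc_inv ::
  "'a::complex_vector set \<Rightarrow> 'b::complex_vector set \<Rightarrow> 'c::complex_vector set
    \<Rightarrow> ('a, ('b, 'c) tensor) tensor \<Rightarrow> (('a, 'b) tensor, 'c) tensor" where
  "tassoc_inv U V W = tlift U (tensor_space V W) (\<lambda>x s. tlift V W (\<lambda>y z. (x \<otimes> y) \<otimes> z) s)"

lemma bilinear_on_assoc_inv_inner:
  "bilinear_on V W (tensor_space (tensor_space U V) W) (\<lambda>y z. (x \<otimes> y) \<otimes> z)" if "x \<in> U"
  by (rule bilinear_onI) (simp_all add: that pure_tensor_mem pure_tensor_add_left pure_tensor_add_right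
     pure_tensor_scaleC_left pure_tensor_scaleC_right)

lemma bilinear_on_assoc_inv_outer:
  assumes V: "complex_vector.subspace V" and W: "complex_vector.subspace W"
  shows "bilinear_on U (tensor_space V W) (tensor_space (tensor_space U V) W)
     (\<lambda>x s. tlift V W (\<lambda>y z. (x \<otimes> y) \<otimes> z) s)"
proof (rule bilinear_onI)
  fix s x c assume s: "s \<in> tensor_space V W" and x: "x \<in> U"
  note bl = bilinear_on_assoc_inv_inner
  show "tlift V W (\<lambda>y z. ((x + x') \<otimes> y) \<otimes> z) s =
      tlift V W (\<lambda>y z. (x \<otimes> y) \<otimes> z) s + tlift V W (\<lambda>y z. (x' \<otimes> y) \<otimes> z) s" if "x' \<in> U" for x'
    unfolding pure_tensor_add_left by (rule tlift_add[OF V W bl[OF x] bl[OF that] s])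
  show "tlift V W (\<lambda>y z. ((c *\<^sub>C x) \<otimes> y) \<otimes> z) s = c *\<^sub>C tlift V W (\<lambda>y z. (x \<otimes> y) \<otimes> z) s"
    unfolding pure_tensor_scaleC_left by (rule tlift_scaleC[OF V W bl[OF x] s])
qed (simp_all add: linear_rules[OF linear_on_tlift[OF V W bilinear_on_assoc_inv_inner subspace_tensor_space]])

lemma tassoc_inv_tassoc:
  assumes U: "complex_vector.subspace U" and V: "complex_vector.subspace V" and W: "complex_vector.subspace W"
    and t: "t \<in> tensor_space (tensor_space U V) W"
  shows "tassoc_inv U V W (tassoc U V W t) = t"
proof -
  have l: "linear_on (tensor_space U (tensor_space V W)) (tensor_space (tensor_space U V) W) (tassoc_inv U V W)"
    unfolding tassoc_inv_def
    by (rule linear_on_tlift[OF U subspace_tensor_space bilinear_on_assoc_inv_outer[OF V W] subspace_tensor_space])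
  have pure: "tassoc_inv U V W (x \<otimes> y \<otimes> z) = (x \<otimes> y) \<otimes> z" if "x \<in> U" "y \<in> V" "z \<in> W" for x y z
    unfolding tassoc_inv_def using that
    by (simp add: tlift_pure[OF U subspace_tensor_space bilinear_on_assoc_inv_outer[OF V W]] pure_tensor_mem
       tlift_pure[OF V W bilinear_on_assoc_inv_inner[of x UNIV]])
  note comp = linear_on_compose[OF linear_on_tassoc[OF U V W] l]
  have 1: "tassoc_inv U V W (tassoc U V W (s \<otimes> z)) = s \<otimes> z" if s: "s \<in> tensor_space U V" and z: "z \<in> W" for s z
  proof (rule linear_on_tensor_eqI[OF U _ _ _ s])
    show p: "linear_on (tensor_space U V) (tensor_space (tensor_space U V) W) (\<lambda>s. s \<otimes> z)"
      by (rule linear_onI) (simp_all add: z pure_tensor_mem pure_tensor_add_left pure_tensor_scaleC_left)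
    show "linear_on (tensor_space U V) (tensor_space (tensor_space U V) W)
       (\<lambda>s. tassoc_inv U V W (tassoc U V W (s \<otimes> z)))"
      by (rule linear_on_compose[OF p comp])
  qed (simp add: tassoc_pure[OF U V W] pure z)
  show ?thesis
    by (rule linear_on_tensor_eqI[OF subspace_tensor_space comp linear_on_ident 1 t])
qed

lemma inj_on_tassoc:
  assumes "complex_vector.subspace U" "complex_vector.subspace V" "complex_vector.subspace W"
  shows "inj_on (tassoc U V W) (tensor_space (tensor_space U V) W)"
  by (rule inj_on_inverseI[where g = "tassoc_inv U V W"]) (rule tassoc_inv_tassoc[OF assms])

lemma linear_on_sum_list:
  assumes f: "linear_on V W f" and V: "complex_vector.subspace V"
    and g: "\<And>x y. (x, y) \<in> set ps \<Longrightarrow> g x y \<in> V"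
  shows "f (\<Sum>(x, y)\<leftarrow>ps. g x y) = (\<Sum>(x, y)\<leftarrow>ps. f (g x y))"
    and "(\<Sum>(x, y)\<leftarrow>ps. g x y) \<in> V"
proof -
  have "f (\<Sum>(x, y)\<leftarrow>ps. g x y) = (\<Sum>(x, y)\<leftarrow>ps. f (g x y)) \<and> (\<Sum>(x, y)\<leftarrow>ps. g x y) \<in> V"
    using g
  proof (induction ps)
    case (Cons p ps)
    obtain x y where p: "p = (x, y)" by (cases p)
    have "g x y \<in> V" using Cons.prems p by simp
    moreover have "f (\<Sum>(x, y)\<leftarrow>ps. g x y) = (\<Sum>(x, y)\<leftarrow>ps. f (g x y)) \<and> (\<Sum>(x, y)\<leftarrow>ps. g x y) \<in> V"
      by (rule Cons.IH) (use Cons.prems in simp)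
    ultimately show ?case by (simp add: p linear_on_add[OF f] complex_vector.subspace_add[OF V])
  qed (simp add: linear_on_zero[OF f V] complex_vector.subspace_0[OF V])
  then show "f (\<Sum>(x, y)\<leftarrow>ps. g x y) = (\<Sum>(x, y)\<leftarrow>ps. f (g x y))" "(\<Sum>(x, y)\<leftarrow>ps. g x y) \<in> V"
    by (rule conjunct1, rule conjunct2)
qed

lemma sum_list_cong_pairs:
  assumes "\<And>x y. (x, y) \<in> set ps \<Longrightarrow> f x y = g x y"
  shows "(\<Sum>(x, y)\<leftarrow>ps. f x y) = (\<Sum>(x, y)\<leftarrow>ps. g x y)"
  by (rule arg_cong[where f = sum_list], rule map_cong[OF refl]) (auto simp: assms)

lemma fst_sum_list_apply: "fst (\<Sum>(x, y)\<leftarrow>ps. F x y) z = (\<Sum>(x, y)\<leftarrow>ps. fst (F x y) z)"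
  by (induction ps) auto

context hopf
begin

abbreviation "T3 \<equiv> tensor_space C T"

lemma tassoc_mult:
  assumes r: "r \<in> T" and h: "h \<in> C" and u: "u \<in> C" "v \<in> C" "w \<in> C"
  shows "tassoc C C C ((r \<cdot>\<^bsub>A \<otimes>\<^sub>A A\<^esub> (u \<otimes> v)) \<otimes> (h \<bullet> w))
     = tassoc C C C (r \<otimes> h) \<cdot>\<^bsub>A \<otimes>\<^sub>A A \<otimes>\<^sub>A A\<^esub> (u \<otimes> v \<otimes> w)"
proof -
  note ta = linear_on_tassoc[OF subspace subspace subspace]
  have 1: "linear_on T (tensor_space T C) (\<lambda>r. r \<otimes> h)" if "h \<in> C" for h
    by (rule linear_onI) (simp_all add: that pure_tensor_mem pure_tensor_add_left pure_tensor_scaleC_left)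
  have uv: "u \<otimes> v \<in> T" "v \<otimes> w \<in> T" using u by (simp_all add: pure_mem)
  have uvw: "u \<otimes> v \<otimes> w \<in> T3" using u uv by (simp add: pure_tensor_mem)
  note R3 = AR.linear_tensor_mult_right[unfolded carrier_tensor_alg, OF uvw]
  have hw: "h \<bullet> w \<in> C" using h u by (simp add: mem_simps)
  show ?thesis
    by (rule linear_on_tensor_eqI[OF subspace
        linear_on_compose[OF linear_on_compose[OF AA.linear_tensor_mult_right[OF uv(1)] 1[OF hw]] ta]
        linear_on_compose[OF linear_on_compose[OF 1[OF h] ta] R3] _ r])
      (simp_all add: tassoc_pure[OF subspace subspace subspace] h hw u uv AA.tensor_mult_pure mem_simps
        AR.tensor_mult_pure carrier_tensor_alg pure_mem)
qed

lemma bilinear_cl_tensor: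
  assumes "a \<in> C"
  shows "bilinear_on C C T3 (\<lambda>g h. tassoc C C C (cl a g \<otimes> h))"
  by (rule bilinear_onI) (simp_all add: linear_rules[OF linear_on_tassoc[OF subspace subspace subspace]]
    bilinear_onD[OF bilinear_cl] assms pure_tensor_mem
    pure_tensor_add_left pure_tensor_add_right pure_tensor_scaleC_left pure_tensor_scaleC_right)

lemma bilinear_tensor_cr:
  assumes "b \<in> C"
  shows "bilinear_on C C T3 (\<lambda>s t. s \<otimes> cr t b)"
  by (rule bilinear_onI) (simp_all add: bilinear_onD[OF bilinear_cr] assms pure_tensor_mem
    pure_tensor_add_left pure_tensor_add_right pure_tensor_scaleC_left pure_tensor_scaleC_right)

text \<open>Coassociativity is given as an equation of multipliers. Both sides act on \<open>u \<otimes> (v \<otimes> w)\<close> as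
  multiplication by an element of \<open>A \<otimes> (A \<otimes> A)\<close>, and nondegeneracy identifies the two elements.\<close>

lemma coassoc_tensor:
  assumes a: "a \<in> C" and c: "c \<in> C" and b: "b \<in> C"
  shows "tL (\<lambda>g h. tassoc C C C (cl a g \<otimes> h)) (cr c b) = tL (\<lambda>s t. s \<otimes> cr t b) (cl a c)"
proof -
  note sub = subspace subspace
  note ta = linear_on_tassoc[OF subspace subspace subspace]
  obtain ps where ps: "set ps \<subseteq> C \<times> C" "cr c b = (\<Sum>(x, y)\<leftarrow>ps. x \<otimes> y)"
    using tensor_space_sum_list[OF cr_mem[OF c b] subspace] by (elim exE conjE)
  obtain qs where qs: "set qs \<subseteq> C \<times> C" "cl a c = (\<Sum>(x, y)\<leftarrow>qs. x \<otimes> y)"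
    using tensor_space_sum_list[OF cl_mem[OF a c] subspace] by (elim exE conjE)
  have lcop: "linear_on C (carrier (M2 A)) \<Delta>"
    using hopf by (simp add: regular_multiplier_hopf_algebra_def alg_hom_def)
  have bl: "bilinear_on C C UNIV (\<lambda>x y. mult_tensor (A \<otimes>\<^sub>A A) A (\<Delta> x) (embed A y))"
    by (rule bilinear_on_comp[OF LA.bilinear_mult_tensor lcop linear_embed])
  have br: "bilinear_on C C UNIV (\<lambda>x y. mult_tensor A (A \<otimes>\<^sub>A A) (embed A x) (\<Delta> y))"
    by (rule bilinear_on_comp[OF AR.bilinear_mult_tensor linear_embed lcop])
  note bX = bilinear_cl_tensor[OF a] and bY = bilinear_tensor_cr[OF b]
  define X where "X = tL (\<lambda>g h. tassoc C C C (cl a g \<otimes> h)) (cr c b)"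
  define Y where "Y = tL (\<lambda>s t. s \<otimes> cr t b) (cl a c)"
  have Xps: "X = (\<Sum>(g, h)\<leftarrow>ps. tassoc C C C (cl a g \<otimes> h))"
    unfolding X_def ps(2) by (rule tlift_sum_list[OF sub bX ps(1)])
  have Yqs: "Y = (\<Sum>(s, t)\<leftarrow>qs. s \<otimes> cr t b)"
    unfolding Y_def qs(2) by (rule tlift_sum_list[OF sub bY qs(1)])
  have XT: "X \<in> T3" unfolding X_def
    by (rule linear_on_mem[OF linear_on_tlift[OF sub bX subspace_tensor_space] cr_mem[OF c b]])
  have YT: "Y \<in> T3" unfolding Y_def
    by (rule linear_on_mem[OF linear_on_tlift[OF sub bY subspace_tensor_space] cl_mem[OF a c]])
  let ?M = "mult_tensor (A \<otimes>\<^sub>A A) A (in_left A a) (mult_one A)"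
  let ?N = "\<Sum>(x, y)\<leftarrow>ps. mult_tensor (A \<otimes>\<^sub>A A) A (\<Delta> x) (embed A y)"
  let ?K = "\<Sum>(x, y)\<leftarrow>qs. mult_tensor A (A \<otimes>\<^sub>A A) (embed A x) (\<Delta> y)"
  let ?L = "mult_transport ((A \<otimes>\<^sub>A A) \<otimes>\<^sub>A A) (A \<otimes>\<^sub>A A \<otimes>\<^sub>A A) (tassoc C C C)
       (?M \<cdot>\<^bsub>mult_alg ((A \<otimes>\<^sub>A A) \<otimes>\<^sub>A A)\<^esub> ?N)"
  let ?J = "mult_tensor A (A \<otimes>\<^sub>A A) (mult_one A) (in_right A b)"
  have "coassociative A \<Delta>" using hopf by (simp add: regular_multiplier_hopf_algebra_def)
  note co = this[unfolded coassociative_def, rule_format, OF a b c, unfolded ps(2) qs(2)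
      tlift_sum_list[OF sub bl ps(1)] tlift_sum_list[OF sub br qs(1)]]
  have Mmem: "?M \<in> carrier (mult_alg ((A \<otimes>\<^sub>A A) \<otimes>\<^sub>A A))"
    by (rule LA.mult_tensor_mem[OF in_left_mem[OF a] mult_one_mem])
  note Mlin = LA.AB.mult_algD(1)[OF Mmem, unfolded carrier_tensor_alg]
  have eq: "X \<cdot>\<^bsub>A \<otimes>\<^sub>A A \<otimes>\<^sub>A A\<^esub> (u \<otimes> v \<otimes> w) = Y \<cdot>\<^bsub>A \<otimes>\<^sub>A A \<otimes>\<^sub>A A\<^esub> (u \<otimes> v \<otimes> w)"
    if u: "u \<in> C" "v \<in> C" "w \<in> C" for u v w
  proof -
    have uv: "u \<otimes> v \<in> T" "v \<otimes> w \<in> T" using u by (simp_all add: pure_mem)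
    have uvw: "u \<otimes> v \<otimes> w \<in> T3" "(u \<otimes> v) \<otimes> w \<in> tensor_space T C"
      using u uv by (simp_all add: pure_tensor_mem)
    note R3 = AR.linear_tensor_mult_right[unfolded carrier_tensor_alg, OF uvw(1)]
    have inv: "inv_into (tensor_space T C) (tassoc C C C) (u \<otimes> v \<otimes> w) = (u \<otimes> v) \<otimes> w"
      using inv_into_f_f[OF inj_on_tassoc[OF subspace subspace subspace] uvw(2)]
      by (simp add: tassoc_pure[OF subspace subspace subspace] u)
    have psm: "g \<in> C" "h \<in> C" if "(g, h) \<in> set ps" for g h using ps(1) that by auto
    have qsm: "g \<in> C" "h \<in> C" if "(g, h) \<in> set qs" for g h using qs(1) that by auto
    have cmem: "fst (\<Delta> g) (u \<otimes> v) \<otimes> (h \<bullet> w) \<in> tensor_space T C" if "(g, h) \<in> set ps" for g h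
      using psm[OF that] u uv by (simp add: pure_tensor_mem mem_simps fst_mem2 cop_mem)
    have "fst (?L) (u \<otimes> v \<otimes> w)
       = tassoc C C C (fst ?M (fst ?N ((u \<otimes> v) \<otimes> w)))"
      using uvw by (simp add: mult_transport_def carrier_tensor_alg inv LA.AB.fst_mult_alg)
    also have "fst ?N ((u \<otimes> v) \<otimes> w) = (\<Sum>(g, h)\<leftarrow>ps. fst (\<Delta> g) (u \<otimes> v) \<otimes> (h \<bullet> w))"
      unfolding fst_sum_list_apply
      by (rule sum_list_cong_pairs)
        (simp add: psm u uv LA.fst_mult_tensor_pure cop_mem embed_mem carrier_tensor_alg fst_embed)
    also have "fst ?M \<dots> = (\<Sum>(g, h)\<leftarrow>ps. fst ?M (fst (\<Delta> g) (u \<otimes> v) \<otimes> (h \<bullet> w)))"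
      by (rule linear_on_sum_list(1)[OF Mlin subspace_tensor_space cmem])
    also have "tassoc C C C \<dots> = (\<Sum>(g, h)\<leftarrow>ps. tassoc C C C (fst ?M (fst (\<Delta> g) (u \<otimes> v) \<otimes> (h \<bullet> w))))"
      by (rule linear_on_sum_list(1)[OF ta subspace_tensor_space linear_on_mem[OF Mlin cmem]])
    also have "\<dots> = (\<Sum>(g, h)\<leftarrow>ps. tassoc C C C (cl a g \<otimes> h) \<cdot>\<^bsub>A \<otimes>\<^sub>A A \<otimes>\<^sub>A A\<^esub> (u \<otimes> v \<otimes> w))"
    proof (rule sum_list_cong_pairs)
      fix g h assume gh: "(g, h) \<in> set ps"
      note m = psm[OF gh]
      have "fst ?M (fst (\<Delta> g) (u \<otimes> v) \<otimes> (h \<bullet> w)) = (cl a g \<cdot>\<^bsub>A \<otimes>\<^sub>A A\<^esub> (u \<otimes> v)) \<otimes> (h \<bullet> w)"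
        by (simp add: m u uv a LA.fst_mult_tensor_pure in_left_mem mult_one_mem carrier_tensor_alg
          fst_mem2 cop_mem mem_simps fst_mult_one cl_times)
      then show "tassoc C C C (fst ?M (fst (\<Delta> g) (u \<otimes> v) \<otimes> (h \<bullet> w)))
         = tassoc C C C (cl a g \<otimes> h) \<cdot>\<^bsub>A \<otimes>\<^sub>A A \<otimes>\<^sub>A A\<^esub> (u \<otimes> v \<otimes> w)"
        by (simp add: tassoc_mult m u cl_mem a)
    qed
    also have "\<dots> = X \<cdot>\<^bsub>A \<otimes>\<^sub>A A \<otimes>\<^sub>A A\<^esub> (u \<otimes> v \<otimes> w)"
      unfolding Xps
      by (rule linear_on_sum_list(1)[OF R3 subspace_tensor_space, symmetric])
        (simp add: bilinear_onD(1)[OF bX] psm)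
    finally have L: "fst (?L) (u \<otimes> v \<otimes> w) = X \<cdot>\<^bsub>A \<otimes>\<^sub>A A \<otimes>\<^sub>A A\<^esub> (u \<otimes> v \<otimes> w)" .
    have "fst (?K \<cdot>\<^bsub>mult_alg (A \<otimes>\<^sub>A A \<otimes>\<^sub>A A)\<^esub> ?J) (u \<otimes> v \<otimes> w)
       = (\<Sum>(s, t)\<leftarrow>qs. fst (mult_tensor A (A \<otimes>\<^sub>A A) (embed A s) (\<Delta> t)) (u \<otimes> fst (in_right A b) (v \<otimes> w)))"
      unfolding AR.AB.fst_mult_alg fst_sum_list_apply
      by (simp add: AR.fst_mult_tensor_pure u uv b in_right_mem mult_one_mem carrier_tensor_alg fst_mult_one)
    also have "\<dots> = (\<Sum>(s, t)\<leftarrow>qs. (s \<otimes> cr t b) \<cdot>\<^bsub>A \<otimes>\<^sub>A A \<otimes>\<^sub>A A\<^esub> (u \<otimes> v \<otimes> w))"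
      by (rule sum_list_cong_pairs)
        (simp add: AR.fst_mult_tensor_pure qsm u uv b embed_mem cop_mem carrier_tensor_alg fst_mem2
          in_right_mem fst_embed AR.tensor_mult_pure cr_mem cr_times)
    also have "\<dots> = Y \<cdot>\<^bsub>A \<otimes>\<^sub>A A \<otimes>\<^sub>A A\<^esub> (u \<otimes> v \<otimes> w)"
      unfolding Yqs
      by (rule linear_on_sum_list(1)[OF R3 subspace_tensor_space, symmetric])
        (simp add: bilinear_onD(1)[OF bY] qsm)
    finally show ?thesis using L co by simp
  qed
  have "X = Y"
  proof (rule AR.AB.right_cancel[unfolded carrier_tensor_alg, OF XT YT])
    fix z assume z: "z \<in> T3"
    note LX = AR.linear_tensor_mult_left[unfolded carrier_tensor_alg, OF XT]
    note LY = AR.linear_tensor_mult_left[unfolded carrier_tensor_alg, OF YT]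
    have 1: "X \<cdot>\<^bsub>A \<otimes>\<^sub>A A \<otimes>\<^sub>A A\<^esub> (u \<otimes> r) = Y \<cdot>\<^bsub>A \<otimes>\<^sub>A A \<otimes>\<^sub>A A\<^esub> (u \<otimes> r)" if u: "u \<in> C" and r: "r \<in> T" for u r
    proof -
      have p: "linear_on T T3 (\<lambda>r. u \<otimes> r)"
        by (rule linear_onI) (simp_all add: u pure_tensor_mem pure_tensor_add_right pure_tensor_scaleC_right)
      show ?thesis
        by (rule linear_on_tensor_eqI[OF subspace linear_on_compose[OF p LX] linear_on_compose[OF p LY] _ r])
          (simp add: eq u)
    qed
    show "X \<cdot>\<^bsub>A \<otimes>\<^sub>A A \<otimes>\<^sub>A A\<^esub> z = Y \<cdot>\<^bsub>A \<otimes>\<^sub>A A \<otimes>\<^sub>A A\<^esub> z"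
      by (rule linear_on_tensor_eqI[OF subspace LX LY 1 z])
  qed
  then show ?thesis unfolding X_def Y_def .
qed

text \<open>\<open>coassoc_tensor\<close> evaluated by a trilinear map: in Sweedler notation both sides are
  \<open>F(a c\<^sub>1, c\<^sub>2, c\<^sub>3 b)\<close>.\<close>

lemma coassoc:
  assumes a: "a \<in> C" and c: "c \<in> C" and b: "b \<in> C"
    and F23: "\<And>x. x \<in> C \<Longrightarrow> bilinear_on C C UNIV (F x)"
    and F1: "\<And>y z. y \<in> C \<Longrightarrow> z \<in> C \<Longrightarrow> linear_on C UNIV (\<lambda>x. F x y z)"
  shows "tL (\<lambda>g h. tL (\<lambda>x y. F x y h) (cl a g)) (cr c b) = tL (\<lambda>s t. tL (F s) (cr t b)) (cl a c)"
proof -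
  note sub = subspace subspace
  note ta = linear_on_tassoc[OF subspace subspace subspace]
  define G where "G = (\<lambda>s. tL (F s))"
  note lF = linear_on_tlift[OF sub F23 UNIV_sub]
  have G: "bilinear_on C T UNIV G"
  proof (rule bilinear_onI)
    fix s s' r c assume s: "s \<in> C" and r: "r \<in> T"
    show "G (s + s') r = G s r + G s' r" if s': "s' \<in> C"
    proof -
      have "G (s + s') r = tL (\<lambda>y z. F s y z + F s' y z) r"
        unfolding G_def by (rule fun_cong[OF tlift_cong]) (simp add: linear_on_add[OF F1] s s')
      also have "\<dots> = G s r + G s' r" unfolding G_def by (rule tlift_add[OF sub F23[OF s] F23[OF s'] r])
      finally show ?thesis .
    qed
    have "G (c *\<^sub>C s) r = tL (\<lambda>y z. c *\<^sub>C F s y z) r"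
      unfolding G_def by (rule fun_cong[OF tlift_cong]) (simp add: linear_on_scaleC[OF F1] s)
    also have "\<dots> = c *\<^sub>C G s r" unfolding G_def by (rule tlift_scaleC[OF sub F23[OF s] r])
    finally show "G (c *\<^sub>C s) r = c *\<^sub>C G s r" .
  qed (simp_all add: G_def linear_rules[OF lF])
  note lG = linear_on_tlift[OF subspace subspace_tensor_space G UNIV_sub]
  note bX = bilinear_cl_tensor[OF a] and bY = bilinear_tensor_cr[OF b]
  have "tL (\<lambda>g h. tL (\<lambda>x y. F x y h) (cl a g)) (cr c b)
      = tL (\<lambda>g h. tlift C T G (tassoc C C C (cl a g \<otimes> h))) (cr c b)"
  proof (rule fun_cong[OF tlift_cong])
    fix g h assume gh: "g \<in> C" "h \<in> C"
    have r: "cl a g \<in> T" using a gh by (simp add: cl_mem)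
    have "tlift C T G (tassoc C C C (cl a g \<otimes> h)) = tlift C T G (tL (\<lambda>x y. x \<otimes> y \<otimes> h) (cl a g))"
      by (simp add: tassoc_pure_right[OF subspace subspace subspace r gh(2)])
    also have "\<dots> = tL (\<lambda>x y. tlift C T G (x \<otimes> y \<otimes> h)) (cl a g)"
      by (rule tlift_comp[OF sub bilinear_on_assoc_inner[OF gh(2)] subspace_tensor_space lG r])
    also have "\<dots> = tL (\<lambda>x y. F x y h) (cl a g)"
    proof (rule fun_cong[OF tlift_cong])
      fix x y assume xy: "x \<in> C" "y \<in> C"
      have "tlift C T G (x \<otimes> y \<otimes> h) = G x (y \<otimes> h)"
        by (rule tlift_pure[OF subspace subspace_tensor_space G xy(1) pure_mem[OF xy(2) gh(2)]])
      also have "\<dots> = F x y h" unfolding G_def by (rule tlift_pure[OF sub F23[OF xy(1)] xy(2) gh(2)])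
      finally show "tlift C T G (x \<otimes> y \<otimes> h) = F x y h" .
    qed
    finally show "tL (\<lambda>x y. F x y h) (cl a g) = tlift C T G (tassoc C C C (cl a g \<otimes> h))" by simp
  qed
  also have "\<dots> = tlift C T G (tL (\<lambda>g h. tassoc C C C (cl a g \<otimes> h)) (cr c b))"
    by (rule tlift_comp[OF sub bX subspace_tensor_space lG cr_mem[OF c b], symmetric])
  also have "\<dots> = tlift C T G (tL (\<lambda>s t. s \<otimes> cr t b) (cl a c))"
    by (simp only: coassoc_tensor[OF a c b])
  also have "\<dots> = tL (\<lambda>s t. tlift C T G (s \<otimes> cr t b)) (cl a c)"
    by (rule tlift_comp[OF sub bY subspace_tensor_space lG cl_mem[OF a c]])
  also have "\<dots> = tL (\<lambda>s t. tL (F s) (cr t b)) (cl a c)"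
    by (rule fun_cong[OF tlift_cong])
      (simp add: tlift_pure[OF subspace subspace_tensor_space G] cr_mem b, simp add: G_def)
  finally show ?thesis .
qed

end

section \<open>Slices, counit and antipode\<close>

lemma tensor_space_mono: "N \<subseteq> W \<Longrightarrow> tensor_space V N \<subseteq> tensor_space V W"
  unfolding tensor_space_def by (rule complex_vector.span_mono) auto

context hopf
begin

abbreviation "sl \<equiv> slice_left A"
abbreviation "sr \<equiv> slice_right A"
abbreviation "func f \<equiv> linear_on C (UNIV :: complex set) f"

lemmas sub2 = subspace subspace

lemma sl_cong: "(\<And>x. x \<in> C \<Longrightarrow> f x = g x) \<Longrightarrow> sl f = sl g"
  unfolding slice_left_def by (rule tlift_cong) simp

lemma sr_cong: "(\<And>x. x \<in> C \<Longrightarrow> f x = g x) \<Longrightarrow> sr f = sr g"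
  unfolding slice_right_def by (rule tlift_cong) simp

lemma lin_sl: "func f \<Longrightarrow> linear_on T C (sl f)"
  unfolding slice_left_def
  by (rule linear_on_tlift[OF sub2 bilinear_on_slice_left[OF _ subspace] subspace])

lemma lin_sr: "func f \<Longrightarrow> linear_on T C (sr f)"
  unfolding slice_right_def
  by (rule linear_on_tlift[OF sub2 bilinear_on_slice_right[OF _ subspace] subspace])

lemma sl_pure: "func f \<Longrightarrow> x \<in> C \<Longrightarrow> y \<in> C \<Longrightarrow> sl f (x \<otimes> y) = f x *\<^sub>C y"
  unfolding slice_left_def
  by (rule tlift_pure[OF sub2 bilinear_on_slice_left[OF _ subspace]])

lemma sr_pure: "func f \<Longrightarrow> x \<in> C \<Longrightarrow> y \<in> C \<Longrightarrow> sr f (x \<otimes> y) = f y *\<^sub>C x"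
  unfolding slice_right_def
  by (rule tlift_pure[OF sub2 bilinear_on_slice_right[OF _ subspace]])

lemmas sl_mem = linear_on_mem[OF lin_sl]
lemmas sr_mem = linear_on_mem[OF lin_sr]

lemmas lin_lmul = linear_mult_left
lemmas lin_rmul = linear_mult_right
lemmas lin_id = linear_on_ident[of C]

lemma func_lmul: "func f \<Longrightarrow> a \<in> C \<Longrightarrow> func (\<lambda>x. f (a \<bullet> x))"
  by (rule linear_on_compose[OF lin_lmul])

lemma func_rmul: "func f \<Longrightarrow> a \<in> C \<Longrightarrow> func (\<lambda>x. f (x \<bullet> a))"
  by (rule linear_on_compose[OF lin_rmul])

lemma tmap_T:
  assumes "linear_on C C p" "linear_on C C q"
  shows "linear_on T T (tmap C C p q)"
  by (rule linear_on_tmap[OF sub2 assms])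

lemma sl_tmap:
  assumes f: "func f" and p: "linear_on C C p" and q: "linear_on C C q" and t: "t \<in> T"
  shows "sl f (tmap C C p q t) = q (sl (\<lambda>x. f (p x)) t)"
  by (rule linear_on_tensor_eqI[OF subspace linear_on_compose[OF tmap_T[OF p q] lin_sl[OF f]]
       linear_on_compose[OF lin_sl[OF linear_on_compose[OF p f]] q] _ t])
    (simp add: tmap_pure[OF sub2 p q] sl_pure f linear_on_compose[OF p f] linear_on_mem[OF p]
      linear_on_mem[OF q] linear_on_scaleC[OF q])

lemma sr_tmap:
  assumes f: "func f" and p: "linear_on C C p" and q: "linear_on C C q" and t: "t \<in> T"
  shows "sr f (tmap C C p q t) = p (sr (\<lambda>x. f (q x)) t)"
  by (rule linear_on_tensor_eqI[OF subspace linear_on_compose[OF tmap_T[OF p q] lin_sr[OF f]]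
       linear_on_compose[OF lin_sr[OF linear_on_compose[OF q f]] p] _ t])
    (simp add: tmap_pure[OF sub2 p q] sr_pure f linear_on_compose[OF q f] linear_on_mem[OF p]
      linear_on_mem[OF q] linear_on_scaleC[OF p])

lemma fubini:
  assumes f: "func f" and g: "func g" and t: "t \<in> T"
  shows "f (sr g t) = g (sl f t)"
  by (rule linear_on_tensor_eqI[OF subspace linear_on_compose[OF lin_sr[OF g] f]
       linear_on_compose[OF lin_sl[OF f] g] _ t])
    (simp add: sl_pure sr_pure f g linear_on_scaleC[OF f] linear_on_scaleC[OF g] scaleC_complex_def)

lemma func_scale: "func f \<Longrightarrow> func (\<lambda>x. c * f x)"
  by (rule linear_onI) (simp_all add: linear_on_add linear_on_scaleC scaleC_complex_def algebra_simps)

lemma sl_scale: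
  assumes f: "func f" and t: "t \<in> T"
  shows "sl (\<lambda>x. c * f x) t = c *\<^sub>C sl f t"
proof (rule linear_on_tensor_eqI[OF subspace lin_sl[OF func_scale[OF f]] _ _ t])
  show "linear_on T UNIV (\<lambda>t. c *\<^sub>C sl f t)"
    by (rule linear_onI) (simp_all add: linear_rules[OF lin_sl[OF f]]
      scaleC_add_right scaleC_scaleC mult.commute)
qed (simp add: sl_pure f func_scale scaleC_scaleC)

lemma sr_scale:
  assumes f: "func f" and t: "t \<in> T"
  shows "sr (\<lambda>x. c * f x) t = c *\<^sub>C sr f t"
proof (rule linear_on_tensor_eqI[OF subspace lin_sr[OF func_scale[OF f]] _ _ t])
  show "linear_on T UNIV (\<lambda>t. c *\<^sub>C sr f t)"
    by (rule linear_onI) (simp_all add: linear_rules[OF lin_sr[OF f]]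
      scaleC_add_right scaleC_scaleC mult.commute)
qed (simp add: sr_pure f func_scale scaleC_scaleC)

lemma func_zero: "func (\<lambda>x. 0)"
  by (rule linear_onI) simp_all

lemma sl_zero: "t \<in> T \<Longrightarrow> sl (\<lambda>x. 0) t = 0"
  and sr_zero: "t \<in> T \<Longrightarrow> sr (\<lambda>x. 0) t = 0"
  using sl_scale[OF func_zero, of t 0] sr_scale[OF func_zero, of t 0] by simp_all

lemma sl_cr_lmul:
  assumes "func f" "y \<in> C" "a \<in> C" "x \<in> C"
  shows "sl (\<lambda>u. f (y \<bullet> u)) (cr a x) = sl f (cl y a) \<bullet> x"
  using arg_cong[OF cl_right[OF assms(2-4)], of "sl f"]
  by (simp add: sl_tmap lin_lmul lin_rmul lin_id assms cl_mem cr_mem)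

lemma sr_cl_rmul:
  assumes "func f" "y \<in> C" "a \<in> C" "x \<in> C"
  shows "sr (\<lambda>v. f (v \<bullet> x)) (cl y a) = y \<bullet> sr f (cr a x)"
  using arg_cong[OF cl_right[OF assms(2-4)], of "sr f"]
  by (simp add: sr_tmap lin_lmul lin_rmul lin_id assms cl_mem cr_mem)

lemma sl_cr_mult:
  assumes "func f" "a \<in> C" "x \<in> C" "y \<in> C"
  shows "sl f (cr a (x \<bullet> y)) = sl f (cr a x) \<bullet> y"
  using arg_cong[OF cr_mult[OF assms(2-4)], of "sl f"]
  by (simp add: sl_tmap lin_lmul lin_rmul lin_id assms cr_mem)

lemma sr_cl_mult:
  assumes "func f" "a \<in> C" "x \<in> C" "y \<in> C"
  shows "sr f (cl (x \<bullet> y) a) = x \<bullet> sr f (cl y a)"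
  using arg_cong[OF cl_mult[OF assms(2-4)], of "sr f"]
  by (simp add: sr_tmap lin_lmul lin_rmul lin_id assms cl_mem)

end

locale hopf_antipode = hopf A \<Delta>
  for A :: "'a::complex_vector calg" and \<Delta> :: "'a coproduct" +
  fixes \<epsilon> :: "'a \<Rightarrow> complex" and S :: "'a \<Rightarrow> 'a"
  assumes counit: "is_counit A \<Delta> \<epsilon>" and antipode: "is_antipode A \<Delta> \<epsilon> S"
begin

lemma eps_lin: "func \<epsilon>"
  using counit by (simp add: is_counit_def alg_hom_def complex_alg_def)

lemma eps_mult: "x \<in> C \<Longrightarrow> y \<in> C \<Longrightarrow> \<epsilon> (x \<bullet> y) = \<epsilon> x * \<epsilon> y"
  using counit by (simp add: is_counit_def alg_hom_def complex_alg_def)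

lemma sl_eps_cr: "a \<in> C \<Longrightarrow> b \<in> C \<Longrightarrow> sl \<epsilon> (cr a b) = a \<bullet> b"
  and sr_eps_cl: "a \<in> C \<Longrightarrow> b \<in> C \<Longrightarrow> sr \<epsilon> (cl a b) = a \<bullet> b"
  using counit by (simp_all add: is_counit_def)

lemma S_lin: "linear_on C C S"
  and S_anti: "x \<in> C \<Longrightarrow> y \<in> C \<Longrightarrow> S (x \<bullet> y) = S y \<bullet> S x"
  and S_bij: "bij_betw S C C"
  using antipode by (simp_all add: is_antipode_def)

lemmas S_mem = linear_on_mem[OF S_lin]

lemma antipode_cr: "a \<in> C \<Longrightarrow> b \<in> C \<Longrightarrow> tL (\<lambda>x y. S x \<bullet> y) (cr a b) = \<epsilon> a *\<^sub>C b"
  and antipode_cl: "a \<in> C \<Longrightarrow> b \<in> C \<Longrightarrow> tL (\<lambda>x y. x \<bullet> S y) (cl a b) = \<epsilon> b *\<^sub>C a"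
  using antipode by (simp_all add: is_antipode_def)

definition "Si = inv_into C S"

lemma Si_mem: "x \<in> C \<Longrightarrow> Si x \<in> C"
  and S_Si: "x \<in> C \<Longrightarrow> S (Si x) = x"
  and Si_S: "x \<in> C \<Longrightarrow> Si (S x) = x"
  unfolding Si_def using S_bij
  by (simp_all add: inv_into_into bij_betw_def f_inv_into_f)

lemma S_inj: "x \<in> C \<Longrightarrow> y \<in> C \<Longrightarrow> S x = S y \<longleftrightarrow> x = y"
  using Si_S by metis

lemma Si_lin: "linear_on C C Si"
proof (rule linear_onI)
  fix x y c assume x: "x \<in> C"
  show "Si (c *\<^sub>C x) = c *\<^sub>C Si x"
    using x by (subst S_inj[symmetric]) (simp_all add: Si_mem mem_simps S_Si linear_on_scaleC[OF S_lin])
  show "Si (x + y) = Si x + Si y" if "y \<in> C"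
    using x that by (subst S_inj[symmetric]) (simp_all add: Si_mem mem_simps S_Si linear_on_add[OF S_lin])
qed (rule Si_mem)

lemma Si_anti: "x \<in> C \<Longrightarrow> y \<in> C \<Longrightarrow> Si (x \<bullet> y) = Si y \<bullet> Si x"
  by (subst S_inj[symmetric]) (simp_all add: Si_mem mem_simps S_Si S_anti)

lemma bilinear_S_left: "bilinear_on C C C (\<lambda>x y. S x \<bullet> y)"
  by (rule bilinear_onI) (simp_all add: S_mem mem_simps lin_simps linear_rules[OF S_lin])

lemma bilinear_S_right: "bilinear_on C C C (\<lambda>x y. x \<bullet> S y)"
  by (rule bilinear_onI) (simp_all add: S_mem mem_simps lin_simps linear_rules[OF S_lin])

text \<open>The counit axiom is about the second leg of \<open>(y \<otimes> 1)\<Delta>(a)\<close>; multiplicativity of \<open>\<epsilon>\<close> carries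
  it over to \<open>\<Delta>(a)(1 \<otimes> b)\<close>.\<close>

lemma sr_eps_cr:
  assumes a: "a \<in> C" and b: "b \<in> C"
  shows "sr \<epsilon> (cr a b) = \<epsilon> b *\<^sub>C a"
proof (rule left_cancel)
  fix y assume y: "y \<in> C"
  have "y \<bullet> sr \<epsilon> (cr a b) = sr (\<lambda>v. \<epsilon> (v \<bullet> b)) (cl y a)"
    by (simp add: sr_cl_rmul eps_lin a b y)
  also have "\<dots> = sr (\<lambda>v. \<epsilon> b * \<epsilon> v) (cl y a)"
    by (rule fun_cong[OF sr_cong]) (simp add: eps_mult b mult.commute)
  also have "\<dots> = y \<bullet> (\<epsilon> b *\<^sub>C a)"
    by (simp add: sr_scale eps_lin cl_mem a y sr_eps_cl lin_simps)
  finally show "y \<bullet> sr \<epsilon> (cr a b) = y \<bullet> (\<epsilon> b *\<^sub>C a)" .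
qed (simp_all add: a b sr_mem eps_lin cr_mem mem_simps)

end

section \<open>Left integrals are faithful\<close>

locale hopf_integral = hopf_antipode A \<Delta> \<epsilon> S
  for A :: "'a::complex_vector calg" and \<Delta> :: "'a coproduct" and \<epsilon> and S +
  fixes \<phi> :: "'a \<Rightarrow> complex"
  assumes left_integral: "left_integral A \<Delta> \<phi>"
begin

lemma phi_lin: "func \<phi>"
  using left_integral by (simp add: left_integral_def)

lemma phi_nonzero: "\<exists>a\<in>C. \<phi> a \<noteq> 0"
  using left_integral by (simp add: left_integral_def)

lemma sr_phi_cl:
  assumes "x \<in> C" "a \<in> C"
  shows "sr \<phi> (cl x a) = \<phi> a *\<^sub>C x"
proof -
  have "mslice_right A \<phi> (\<Delta> a) = \<phi> a *\<^sub>C mult_one A"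
    using left_integral assms by (simp add: left_integral_def)
  then have "snd (mslice_right A \<phi> (\<Delta> a)) x = snd (\<phi> a *\<^sub>C mult_one A) x" by simp
  then show ?thesis
    using assms by (simp add: mslice_right_def cov_left_def scaleC_prod_def scaleC_fun_def mult_one_def)
qed

text \<open>\<open>E a b = (\<iota> \<otimes> \<phi>)(\<Delta>(a)(1 \<otimes> b))\<close> is \<open>\<phi>(\<cdot> b) \<triangleright> a\<close>, and \<open>Q y a = (\<phi> \<otimes> \<iota>)((y \<otimes> 1)\<Delta>(a))\<close> is
  \<open>a \<triangleleft> \<phi>(y \<cdot>)\<close>: the two actions of the dual on \<open>A\<close>.\<close>

definition "E a b = sr \<phi> (cr a b)"

definition "Q y a = sl \<phi> (cl y a)"

lemma E_mem: "a \<in> C \<Longrightarrow> b \<in> C \<Longrightarrow> E a b \<in> C"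
  by (simp add: E_def sr_mem phi_lin cr_mem)

lemma Q_mem: "y \<in> C \<Longrightarrow> a \<in> C \<Longrightarrow> Q y a \<in> C"
  by (simp add: Q_def sl_mem phi_lin cl_mem)

lemma E_lin: "d \<in> C \<Longrightarrow> linear_on C C (\<lambda>a. E a d)"
  by (rule linear_onI) (simp_all add: E_mem, simp_all add: E_def bilinear_onD[OF bilinear_cr] cr_mem
      linear_rules[OF lin_sr[OF phi_lin]])

lemma Q_lin: "y \<in> C \<Longrightarrow> linear_on C C (Q y)"
  by (rule linear_onI) (simp_all add: Q_mem, simp_all add: Q_def bilinear_onD[OF bilinear_cl] cl_mem
      linear_rules[OF lin_sl[OF phi_lin]])

text \<open>\<open>S((\<iota> \<otimes> \<phi>)(\<Delta>(a)(1 \<otimes> b))) = (\<iota> \<otimes> \<phi>)((1 \<otimes> a)\<Delta>(b))\<close>, covered by \<open>x\<close> on the left. Both sides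
  are linear in \<open>x \<otimes> a\<close>, so it suffices to insert \<open>(p \<otimes> 1)\<Delta>(q)\<close>. The left side becomes
  \<open>p q\<^sub>1 S(q\<^sub>2) \<phi>(q\<^sub>3 b) = p \<phi>(q b)\<close> by coassociativity and the antipode axiom, the right side
  becomes \<open>(\<iota> \<otimes> \<phi>)((p \<otimes> 1)\<Delta>(q b)) = p \<phi>(q b)\<close> by left invariance.\<close>

lemma S_E:
  assumes x: "x \<in> C" and a: "a \<in> C" and b: "b \<in> C"
  shows "x \<bullet> S (E a b) = sr (\<lambda>v. \<phi> (a \<bullet> v)) (cl x b)"
proof -
  have bG: "bilinear_on C C C (\<lambda>x a. x \<bullet> S (E a b))"
    by (rule bilinear_on_comp[OF bilinear_S_right linear_on_ident E_lin[OF b]])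
  \<comment> \<open>the trilinear map \<open>s \<otimes> g \<otimes> d \<mapsto> \<phi>(d) s S(g)\<close>, to be applied to \<open>p q\<^sub>1 \<otimes> q\<^sub>2 \<otimes> q\<^sub>3 b\<close>\<close>
  define F where "F = (\<lambda>s g d. \<phi> d *\<^sub>C (s \<bullet> S g))"
  have F23: "bilinear_on C C UNIV (F s)" if "s \<in> C" for s
    by (rule bilinear_onI) (simp_all add: that F_def S_mem mem_simps lin_simps linear_rules[OF S_lin] linear_rules[OF phi_lin]
        scaleC_add_right scaleC_add_left scaleC_scaleC scaleC_complex_def mult.commute)
  have F1: "linear_on C UNIV (\<lambda>s. F s g d)" if "g \<in> C" "d \<in> C" for g d
    by (rule linear_onI) (simp_all add: that F_def S_mem mem_simps lin_simps
        scaleC_add_right scaleC_scaleC mult.commute)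
  have G: "tL (\<lambda>x a. x \<bullet> S (E a b)) (cl p q) = \<phi> (q \<bullet> b) *\<^sub>C p" if p: "p \<in> C" and q: "q \<in> C" for p q
  proof -
    have "tL (\<lambda>x a. x \<bullet> S (E a b)) (cl p q) = tL (\<lambda>s t. tL (F s) (cr t b)) (cl p q)"
    proof (rule fun_cong[OF tlift_cong])
      fix s t assume s: "s \<in> C" and t: "t \<in> C"
      have l: "linear_on C C (\<lambda>z. s \<bullet> S z)" by (rule linear_on_compose[OF S_lin lin_lmul[OF s]])
      have "s \<bullet> S (E t b) = tL (\<lambda>x y. s \<bullet> S (\<phi> y *\<^sub>C x)) (cr t b)"
        unfolding E_def slice_right_def
        by (rule tlift_comp[OF sub2 bilinear_on_slice_right[OF phi_lin subspace] subspace l])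
          (simp add: cr_mem t b)
      also have "\<dots> = tL (F s) (cr t b)"
        by (rule fun_cong[OF tlift_cong]) (simp add: F_def linear_on_scaleC[OF S_lin] S_mem s lin_simps)
      finally show "s \<bullet> S (E t b) = tL (F s) (cr t b)" .
    qed
    also have "\<dots> = tL (\<lambda>g h. tL (\<lambda>x y. F x y h) (cl p g)) (cr q b)"
      by (rule coassoc[OF p q b F23 F1, symmetric])
    also have "\<dots> = tL (\<lambda>g h. \<phi> (\<epsilon> g *\<^sub>C h) *\<^sub>C p) (cr q b)"
    proof (rule fun_cong[OF tlift_cong])
      fix g h assume g: "g \<in> C" and h: "h \<in> C"
      have "tL (\<lambda>x y. F x y h) (cl p g) = \<phi> h *\<^sub>C tL (\<lambda>x y. x \<bullet> S y) (cl p g)"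
        unfolding F_def by (rule tlift_scaleC[OF sub2 bilinear_S_right]) (simp add: cl_mem p g)
      also have "\<dots> = \<phi> (\<epsilon> g *\<^sub>C h) *\<^sub>C p"
        by (simp add: antipode_cl p g h linear_on_scaleC[OF phi_lin] scaleC_scaleC scaleC_complex_def mult.commute)
      finally show "tL (\<lambda>x y. F x y h) (cl p g) = \<phi> (\<epsilon> g *\<^sub>C h) *\<^sub>C p" .
    qed
    also have "\<dots> = \<phi> (sl \<epsilon> (cr q b)) *\<^sub>C p"
      unfolding slice_left_def
    proof (rule tlift_comp[OF sub2 bilinear_on_slice_left[OF eps_lin subspace] subspace, symmetric])
      show "linear_on C UNIV (\<lambda>z. \<phi> z *\<^sub>C p)"
        by (rule linear_onI) (simp_all add: linear_rules[OF phi_lin]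
          scaleC_add_left scaleC_scaleC scaleC_complex_def)
    qed (simp add: cr_mem q b)
    also have "\<dots> = \<phi> (q \<bullet> b) *\<^sub>C p" by (simp add: sl_eps_cr q b)
    finally show ?thesis .
  qed
  have H: "sr \<phi> (snd (\<Delta> b) (cl p q)) = \<phi> (q \<bullet> b) *\<^sub>C p" if "p \<in> C" "q \<in> C" for p q
    using that b by (simp add: snd_cop_cl sr_phi_cl mem_simps)
  have "tL (\<lambda>x a. x \<bullet> S (E a b)) (x \<otimes> a) = sr \<phi> (snd (\<Delta> b) (x \<otimes> a))"
    by (rule linear_on_eqI_cl[OF linear_on_tlift[OF sub2 bG subspace]
         linear_on_compose[OF lin_snd2[OF cop_mem[OF b]] lin_sr[OF phi_lin]]])
      (simp_all add: G H pure_mem x a)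
  then show ?thesis
    by (simp add: tlift_pure[OF sub2 bG x a] snd_cop_pure x a b sr_tmap phi_lin lin_id lin_lmul cl_mem)
qed

lemma eps_one: "\<exists>e\<in>C. \<epsilon> e = 1"
proof -
  have "\<exists>e\<in>C. \<epsilon> e \<noteq> 0"
  proof (rule ccontr)
    assume "\<not> ?thesis"
    then have z: "\<epsilon> x = 0" if "x \<in> C" for x using that by auto
    have "x \<bullet> y = 0" if "x \<in> C" "y \<in> C" for x y
    proof -
      have "x \<bullet> y = \<epsilon> y *\<^sub>C 0 + sl \<epsilon> (cr x y)" using that by (simp add: sl_eps_cr)
      also have "sl \<epsilon> (cr x y) = sl (\<lambda>x. 0) (cr x y)"
        by (rule fun_cong[OF sl_cong]) (simp add: z)
      also have "\<dots> = 0" using that by (simp add: sl_zero cr_mem)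
      finally show ?thesis by simp
    qed
    then have "x = 0" if "x \<in> C" for x
      using that linear_on_zero[OF lin_rmul subspace]
      by (intro right_cancel[OF that zero_mem]) simp
    then show False using phi_nonzero linear_on_zero[OF phi_lin subspace] by blast
  qed
  then obtain e where e: "e \<in> C" "\<epsilon> e \<noteq> 0" by blast
  then have "\<epsilon> ((1 / \<epsilon> e) *\<^sub>C e) = 1" by (simp add: linear_on_scaleC[OF eps_lin] scaleC_complex_def)
  then show ?thesis using e scale_mem by blast
qed

text \<open>Products span \<open>A\<close>: an element \<open>z\<close> is \<open>(\<epsilon> \<otimes> \<iota>)(e \<otimes> z)\<close> when \<open>\<epsilon>(e) = 1\<close>, and
  \<open>(\<epsilon> \<otimes> \<iota>)(\<Delta>(p)(1 \<otimes> q)) = p q\<close>.\<close>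

lemma linear_on_eqI_mult:
  assumes f: "linear_on C U f" and g: "linear_on C U' g"
    and eq: "\<And>x y. x \<in> C \<Longrightarrow> y \<in> C \<Longrightarrow> f (x \<bullet> y) = g (x \<bullet> y)" and z: "z \<in> C"
  shows "f z = g z"
proof -
  obtain e where e: "e \<in> C" "\<epsilon> e = 1" using eps_one by blast
  have "f (sl \<epsilon> (e \<otimes> z)) = g (sl \<epsilon> (e \<otimes> z))"
    by (rule linear_on_eqI_cr[OF linear_on_compose[OF lin_sl[OF eps_lin] f]
          linear_on_compose[OF lin_sl[OF eps_lin] g]])
      (simp_all add: sl_eps_cr eq pure_mem e z)
  then show ?thesis using e z by (simp add: sl_pure eps_lin scaleC_one)
qed

text \<open>This right ideal is shown to vanish. By \<open>S_E\<close> the slices of \<open>(y \<otimes> 1)\<Delta>(a)\<close> stay in it if \<open>a\<close>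
  is in it (\<open>right_kernel_slice\<close>). A right ideal with this property contains \<open>v S\<^sup>-\<^sup>1(u)\<close> summed
  over \<open>(y \<otimes> 1)\<Delta>(a) = \<Sum> u \<otimes> v\<close>, which is \<open>\<epsilon>(a) S\<^sup>-\<^sup>1(y)\<close>; as it is not all of \<open>A\<close>, the counit
  vanishes on it, also on the slices \<open>(f \<otimes> \<iota>)((y \<otimes> 1)\<Delta>(a))\<close>, whose counit is \<open>f(y a)\<close>.\<close>

definition "right_kernel = {q \<in> C. \<forall>b\<in>C. \<phi> (q \<bullet> b) = 0}"

lemma right_kernel_E: "a \<in> right_kernel \<Longrightarrow> b \<in> C \<Longrightarrow> E a b = 0"
proof -
  assume a: "a \<in> right_kernel" and b: "b \<in> C"
  have aC: "a \<in> C" using a by (simp add: right_kernel_def)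
  have "S (E a b) = 0"
  proof (rule left_cancel)
    fix x assume x: "x \<in> C"
    have "x \<bullet> S (E a b) = sr (\<lambda>v. 0) (cl x b)"
      unfolding S_E[OF x aC b] by (rule fun_cong[OF sr_cong]) (use a in \<open>simp add: right_kernel_def\<close>)
    also have "\<dots> = 0" by (simp add: sr_zero cl_mem x b)
    finally show "x \<bullet> S (E a b) = x \<bullet> 0" using linear_on_zero[OF lin_lmul[OF x] subspace] by simp
  qed (simp_all add: S_mem E_mem aC b mem_simps)
  then show "E a b = 0"
    using S_inj[OF E_mem[OF aC b] zero_mem] linear_on_zero[OF S_lin subspace] by simp
qed

lemma right_kernel_slice:
  assumes f: "func f" and y: "y \<in> C" and a: "a \<in> right_kernel"
  shows "sl f (cl y a) \<in> right_kernel"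
proof -
  have aC: "a \<in> C" using a by (simp add: right_kernel_def)
  have "\<phi> (sl f (cl y a) \<bullet> b) = 0" if b: "b \<in> C" for b
  proof -
    have "\<phi> (sl f (cl y a) \<bullet> b) = \<phi> (sl (\<lambda>u. f (y \<bullet> u)) (cr a b))"
      by (simp add: sl_cr_lmul f y aC b)
    also have "\<dots> = f (y \<bullet> E a b)"
      unfolding E_def by (rule fubini[OF func_lmul[OF f y] phi_lin cr_mem[OF aC b], symmetric])
    also have "\<dots> = 0" using right_kernel_E[OF a b] linear_on_zero[OF lin_lmul[OF y] subspace]
        linear_on_zero[OF f subspace] by simp
    finally show ?thesis .
  qed
  then show ?thesis by (simp add: right_kernel_def sl_mem f cl_mem y aC)
qed

lemma right_kernel_eps: "a \<in> right_kernel \<Longrightarrow> \<epsilon> a = 0"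
proof (rule ccontr)
  assume a: "a \<in> right_kernel" and eps: "\<epsilon> a \<noteq> 0"
  have aC: "a \<in> C" using a by (simp add: right_kernel_def)
  let ?h = "tL (\<lambda>x y. x \<bullet> S y)"
  note lh = linear_on_tlift[OF sub2 bilinear_S_right subspace]
  have key: "\<phi> (Si (?h t) \<bullet> b) = 0" if t: "t \<in> tensor_space C right_kernel" and b: "b \<in> C" for t b
  proof -
    note l = linear_on_compose[OF linear_on_compose[OF lh Si_lin] func_rmul[OF phi_lin b]]
    show ?thesis using t subspace
    proof (induction rule: tensor_space_induct)
      case zero show ?case using linear_on_zero[OF l subspace_tensor_space] .
    next
      case (add x y t)
      have y: "y \<in> C" "\<And>b. b \<in> C \<Longrightarrow> \<phi> (y \<bullet> b) = 0" using add(2) by (auto simp: right_kernel_def)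
      have t: "t \<in> T" using add(3) tensor_space_mono[of right_kernel C C] by (auto simp: right_kernel_def)
      have "\<phi> (Si (?h (x \<otimes> y)) \<bullet> b) = 0"
        using add(1) y b by (simp add: tlift_pure[OF sub2 bilinear_S_right] Si_anti S_mem Si_S Si_mem assoc mem_simps)
      then show ?case using add(4) linear_on_add[OF l pure_mem[OF add(1) y(1)] t] subspace by simp
    qed
  qed
  have "\<phi> (z \<bullet> b) = 0" if z: "z \<in> C" and b: "b \<in> C" for z b
  proof -
    \<comment> \<open>covering by \<open>S(z)\<close> makes \<open>\<epsilon>(a) S\<^sup>-\<^sup>1(S(z)) = \<epsilon>(a) z\<close> an element of the kernel\<close>
    have "cl (S z) a \<in> tensor_space C right_kernel"
      by (rule tensor_space_memI_slice[OF cl_mem[OF S_mem[OF z] aC] subspace subspace])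
        (simp add: right_kernel_slice S_mem z a flip: slice_left_def)
    from key[OF this b] have "\<epsilon> a * \<phi> (z \<bullet> b) = 0"
      by (simp add: antipode_cl S_mem z b aC linear_on_scaleC[OF Si_lin] Si_S lin_simps mem_simps
        linear_on_scaleC[OF phi_lin] scaleC_complex_def)
    then show ?thesis using eps by simp
  qed
  then have "\<phi> z = 0 * \<phi> z" if "z \<in> C" for z
    by (intro linear_on_eqI_mult[OF phi_lin func_scale[OF phi_lin] _ that]) simp
  then show False using phi_nonzero by auto
qed

lemma faithful_right:
  assumes a: "a \<in> C" and z: "\<And>b. b \<in> C \<Longrightarrow> \<phi> (a \<bullet> b) = 0"
  shows "a = 0"
proof (rule left_cancel[OF a zero_mem])
  have ak: "a \<in> right_kernel" using a z by (simp add: right_kernel_def)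
  fix y assume y: "y \<in> C"
  have "y \<bullet> a = 0"
  proof (rule functionals_separate[OF subspace mult_mem[OF y a]])
    fix f :: "'a \<Rightarrow> complex" assume f: "func f"
    have "f (y \<bullet> a) = f (sr \<epsilon> (cl y a))" by (simp add: sr_eps_cl y a)
    also have "\<dots> = \<epsilon> (sl f (cl y a))" by (rule fubini[OF f eps_lin cl_mem[OF y a]])
    also have "\<dots> = 0" by (rule right_kernel_eps[OF right_kernel_slice[OF f y ak]])
    finally show "f (y \<bullet> a) = 0" .
  qed
  then show "y \<bullet> a = y \<bullet> 0" using linear_on_zero[OF lin_lmul[OF y] subspace] by simp
qed

end

section \<open>Modular automorphisms\<close>

locale quantum_group = hopf_integral A \<Delta> \<epsilon> S \<phi>
  for A :: "'a::complex_vector calg" and \<Delta> :: "'a coproduct" and \<epsilon> and S and \<phi> +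
  fixes \<psi> :: "'a \<Rightarrow> complex" and \<sigma> \<sigma>' :: "'a \<Rightarrow> 'a"
  assumes right_integral: "right_integral A \<Delta> \<psi>"
    and psi_phi: "\<And>a. a \<in> carrier A \<Longrightarrow> \<psi> a = \<phi> (S a)"
    and modular: "modular_automorphism A \<phi> \<sigma>"
    and modular': "modular_automorphism A \<psi> \<sigma>'"
begin

lemma phi_sigma: "x \<in> C \<Longrightarrow> y \<in> C \<Longrightarrow> \<phi> (x \<bullet> y) = \<phi> (y \<bullet> \<sigma> x)"
  and sigma_lin: "linear_on C C \<sigma>"
  and sigma_mult: "x \<in> C \<Longrightarrow> y \<in> C \<Longrightarrow> \<sigma> (x \<bullet> y) = \<sigma> x \<bullet> \<sigma> y"
  and sigma_bij: "bij_betw \<sigma> C C"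
  using modular by (simp_all add: modular_automorphism_def alg_hom_def)

lemmas sigma_mem = linear_on_mem[OF sigma_lin]

lemma psi_sigma': "x \<in> C \<Longrightarrow> y \<in> C \<Longrightarrow> \<psi> (x \<bullet> y) = \<psi> (y \<bullet> \<sigma>' x)"
  and sigma'_lin: "linear_on C C \<sigma>'"
  and sigma'_bij: "bij_betw \<sigma>' C C"
  using modular' by (simp_all add: modular_automorphism_def alg_hom_def)

lemmas sigma'_mem = linear_on_mem[OF sigma'_lin]

abbreviation "si \<equiv> inv_into C \<sigma>"

lemma si_mem: "x \<in> C \<Longrightarrow> si x \<in> C"
  and sigma_si: "x \<in> C \<Longrightarrow> \<sigma> (si x) = x"
  and si_sigma: "x \<in> C \<Longrightarrow> si (\<sigma> x) = x"
  using sigma_bij by (simp_all add: inv_into_into bij_betw_def f_inv_into_f)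

lemma sigma_inj: "x \<in> C \<Longrightarrow> y \<in> C \<Longrightarrow> \<sigma> x = \<sigma> y \<longleftrightarrow> x = y"
  using si_sigma by metis

lemma si_lin: "linear_on C C si"
proof (rule linear_onI)
  fix x y c assume x: "x \<in> C"
  show "si (c *\<^sub>C x) = c *\<^sub>C si x"
    using x by (subst sigma_inj[symmetric]) (simp_all add: si_mem mem_simps sigma_si linear_on_scaleC[OF sigma_lin])
  show "si (x + y) = si x + si y" if "y \<in> C"
    using x that by (subst sigma_inj[symmetric]) (simp_all add: si_mem mem_simps sigma_si linear_on_add[OF sigma_lin])
qed (rule si_mem)

lemma si_mult: "x \<in> C \<Longrightarrow> y \<in> C \<Longrightarrow> si (x \<bullet> y) = si x \<bullet> si y"
  by (subst sigma_inj[symmetric]) (simp_all add: si_mem mem_simps sigma_si sigma_mult)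

lemma phi_si: "x \<in> C \<Longrightarrow> y \<in> C \<Longrightarrow> \<phi> (x \<bullet> y) = \<phi> (si y \<bullet> x)"
  using phi_sigma[of "si y" x] by (simp add: si_mem sigma_si)

lemma phi_eqI_right:
  assumes x: "x \<in> C" and y: "y \<in> C" and eq: "\<And>b. b \<in> C \<Longrightarrow> \<phi> (x \<bullet> b) = \<phi> (y \<bullet> b)"
  shows "x = y"
proof -
  have "\<phi> ((x - y) \<bullet> b) = 0" if b: "b \<in> C" for b
    using linear_on_diff[OF func_rmul[OF phi_lin b] subspace x y] eq[OF b] by simp
  then have "x - y = 0" by (rule faithful_right[OF complex_vector.subspace_diff[OF subspace x y]])
  then show ?thesis by simp
qed

lemma phi_eqI_left:
  assumes x: "x \<in> C" and y: "y \<in> C" and eq: "\<And>b. b \<in> C \<Longrightarrow> \<phi> (b \<bullet> x) = \<phi> (b \<bullet> y)"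
  shows "x = y"
proof (rule phi_eqI_right[OF x y])
  fix b assume b: "b \<in> C"
  show "\<phi> (x \<bullet> b) = \<phi> (y \<bullet> b)" by (simp add: phi_si[of _ b] x y b si_mem eq)
qed

lemma S_E_sigma:
  assumes z: "z \<in> C" and a: "a \<in> C"
  shows "S (E z a) = E a (\<sigma> z)"
proof (rule left_cancel)
  fix x assume x: "x \<in> C"
  have "x \<bullet> S (E z a) = sr (\<lambda>v. \<phi> (v \<bullet> \<sigma> z)) (cl x a)"
    unfolding S_E[OF x z a] by (rule fun_cong[OF sr_cong]) (simp add: phi_sigma z)
  also have "\<dots> = x \<bullet> E a (\<sigma> z)"
    unfolding E_def by (rule sr_cl_rmul[OF phi_lin x a sigma_mem[OF z]])
  finally show "x \<bullet> S (E z a) = x \<bullet> E a (\<sigma> z)" .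
qed (simp_all add: S_mem E_mem z a sigma_mem)

lemma phi_sigma_inv: "z \<in> C \<Longrightarrow> \<phi> (\<sigma> z) = \<phi> z"
  by (rule linear_on_eqI_mult[OF linear_on_compose[OF sigma_lin phi_lin] phi_lin])
    (simp_all add: sigma_mult phi_sigma[symmetric] sigma_mem)

lemma psi_lin: "func \<psi>"
  using right_integral by (simp add: right_integral_def)

lemma psi_nonzero: "\<exists>a\<in>C. \<psi> a \<noteq> 0"
  using right_integral by (simp add: right_integral_def)

lemma sl_psi_cr:
  assumes "a \<in> C" "x \<in> C"
  shows "sl \<psi> (cr a x) = \<psi> a *\<^sub>C x"
proof -
  have "mslice_left A \<psi> (\<Delta> a) = \<psi> a *\<^sub>C mult_one A"
    using right_integral assms by (simp add: right_integral_def)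
  then have "fst (mslice_left A \<psi> (\<Delta> a)) x = fst (\<psi> a *\<^sub>C mult_one A) x" by simp
  then show ?thesis
    using assms by (simp add: mslice_left_def cov_right_def scaleC_prod_def scaleC_fun_def mult_one_def)
qed

lemma psiS_lin: "func (\<lambda>x. \<psi> (S x))"
  by (rule linear_on_compose[OF S_lin psi_lin])

text \<open>With \<open>S_E_sigma\<close> the functional \<open>\<psi> \<circ> S\<close> on the first leg is traded for \<open>\<psi>\<close>, which is right
  invariant.\<close>

lemma phi_sl_psiS:
  assumes z: "z \<in> C" and a: "a \<in> C"
  shows "\<phi> (sl (\<lambda>x. \<psi> (S x)) (cr z a)) = \<psi> a * \<phi> z"
proof -
  have "\<phi> (sl (\<lambda>x. \<psi> (S x)) (cr z a)) = \<psi> (S (E z a))"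
    unfolding E_def by (rule fubini[OF psiS_lin phi_lin cr_mem[OF z a], symmetric])
  also have "\<dots> = \<psi> (sr \<phi> (cr a (\<sigma> z)))" by (simp add: S_E_sigma z a, simp add: E_def)
  also have "\<dots> = \<phi> (sl \<psi> (cr a (\<sigma> z)))"
    by (rule fubini[OF psi_lin phi_lin cr_mem[OF a sigma_mem[OF z]]])
  also have "\<dots> = \<psi> a * \<phi> z"
    by (simp add: sl_psi_cr a z sigma_mem linear_on_scaleC[OF phi_lin] phi_sigma_inv scaleC_complex_def)
  finally show ?thesis .
qed

text \<open>If \<open>\<phi>(z) = 0\<close> then \<open>((\<psi> \<circ> S) \<otimes> \<iota>)(\<Delta>(z)(1 \<otimes> e))\<close> is annihilated by \<open>\<phi>\<close> after right
  multiplication with anything, so it is zero; its counit is \<open>\<psi>(S(z)) \<epsilon>(e)\<close>. Hence \<open>\<psi> \<circ> S\<close> and \<open>\<phi>\<close>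
  are proportional.\<close>

lemma psiS_zero:
  assumes z: "z \<in> C" and 0: "\<phi> z = 0"
  shows "\<psi> (S z) = 0"
proof -
  obtain e where e: "e \<in> C" "\<epsilon> e = 1" using eps_one by blast
  let ?D = "sl (\<lambda>x. \<psi> (S x)) (cr z e)"
  have "?D = 0"
  proof (rule faithful_right)
    fix b assume b: "b \<in> C"
    have "\<phi> (?D \<bullet> b) = \<phi> (sl (\<lambda>x. \<psi> (S x)) (cr z (e \<bullet> b)))"
      by (simp add: sl_cr_mult psiS_lin z e b)
    then show "\<phi> (?D \<bullet> b) = 0" using 0 by (simp add: phi_sl_psiS z e b mem_simps)
  qed (simp add: sl_mem psiS_lin cr_mem z e)
  then have "0 = \<epsilon> ?D" using linear_on_zero[OF eps_lin subspace] by simp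
  also have "\<dots> = \<psi> (S (sr \<epsilon> (cr z e)))" by (rule fubini[OF psiS_lin eps_lin cr_mem[OF z e(1)], symmetric])
  also have "\<dots> = \<psi> (S z)" by (simp add: sr_eps_cr z e scaleC_one)
  finally show ?thesis by simp
qed

lemma psiS_proportional: "\<exists>t. t \<noteq> 0 \<and> (\<forall>x\<in>C. \<psi> (S x) = t * \<phi> x)"
proof -
  obtain a where a: "a \<in> C" "\<phi> a \<noteq> 0" using phi_nonzero by blast
  let ?t = "\<psi> (S a) / \<phi> a"
  have eq: "\<psi> (S x) = ?t * \<phi> x" if x: "x \<in> C" for x
  proof -
    let ?z = "x - (\<phi> x / \<phi> a) *\<^sub>C a"
    have m: "(\<phi> x / \<phi> a) *\<^sub>C a \<in> C" using a by (simp add: mem_simps)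
    have "\<phi> ?z = 0" using a
      by (simp add: linear_on_diff[OF phi_lin subspace x m] linear_on_scaleC[OF phi_lin] scaleC_complex_def)
    then have "\<psi> (S ?z) = 0" by (intro psiS_zero complex_vector.subspace_diff[OF subspace x m])
    then show ?thesis using a
      by (simp add: linear_on_diff[OF psiS_lin subspace x m] linear_on_scaleC[OF psiS_lin] scaleC_complex_def)
  qed
  obtain b where "b \<in> C" "\<psi> b \<noteq> 0" using psi_nonzero by blast
  then have "?t \<noteq> 0" using eq[of "Si b"] by (auto simp: Si_mem S_Si)
  then show ?thesis using eq by blast
qed

definition "\<tau> = (SOME t. t \<noteq> 0 \<and> (\<forall>x\<in>C. \<psi> (S x) = t * \<phi> x))"

lemma tau_nonzero: "\<tau> \<noteq> 0"
  and psi_S: "x \<in> C \<Longrightarrow> \<psi> (S x) = \<tau> * \<phi> x"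
  using someI_ex[OF psiS_proportional] unfolding \<tau>_def[symmetric] by blast+

lemma phi_SS: "x \<in> C \<Longrightarrow> \<phi> (S (S x)) = \<tau> * \<phi> x"
  using psi_S psi_phi S_mem by simp

lemma SS_mult: "x \<in> C \<Longrightarrow> y \<in> C \<Longrightarrow> S (S (x \<bullet> y)) = S (S x) \<bullet> S (S y)"
  by (simp add: S_anti S_mem)

text \<open>\<open>S\<^sup>2\<close> is an automorphism that scales \<open>\<phi>\<close>, so it commutes with the modular automorphism of
  \<open>\<phi>\<close>.\<close>

lemma sigma_SS:
  assumes x: "x \<in> C"
  shows "\<sigma> (S (S x)) = S (S (\<sigma> x))"
proof (rule phi_eqI_left)
  fix b assume b: "b \<in> C"
  let ?y = "Si (Si b)"
  have y: "?y \<in> C" "S (S ?y) = b" using b by (simp_all add: Si_mem S_Si)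
  have "\<phi> (b \<bullet> \<sigma> (S (S x))) = \<phi> (S (S x) \<bullet> S (S ?y))"
    by (simp add: phi_sigma x b S_mem y(2))
  also have "\<dots> = \<tau> * \<phi> (x \<bullet> ?y)" by (simp add: SS_mult[symmetric] phi_SS x y(1) mem_simps)
  also have "\<dots> = \<phi> (S (S (?y \<bullet> \<sigma> x)))" by (simp add: phi_SS x y(1) mem_simps sigma_mem phi_sigma)
  also have "\<dots> = \<phi> (b \<bullet> S (S (\<sigma> x)))" by (simp add: SS_mult x y sigma_mem)
  finally show "\<phi> (b \<bullet> \<sigma> (S (S x))) = \<phi> (b \<bullet> S (S (\<sigma> x)))" .
qed (simp_all add: sigma_mem S_mem x)

lemma si_SS: "x \<in> C \<Longrightarrow> si (S (S x)) = S (S (si x))"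
  using sigma_SS[of "si x"] si_sigma[of "S (S (si x))"] by (simp add: si_mem S_mem sigma_si)

lemma sigma_SiSi:
  assumes x: "x \<in> C"
  shows "Si (Si (\<sigma> x)) = \<sigma> (Si (Si x))"
proof -
  have "S (S (\<sigma> (Si (Si x)))) = \<sigma> x"
    using sigma_SS[of "Si (Si x)"] x by (simp add: Si_mem S_Si)
  then have "Si (Si (S (S (\<sigma> (Si (Si x)))))) = Si (Si (\<sigma> x))" by simp
  then show ?thesis using x by (simp add: Si_S S_mem sigma_mem Si_mem)
qed

lemma eps_S:
  assumes a: "a \<in> C"
  shows "\<epsilon> (S a) = \<epsilon> a"
proof -
  obtain e where e: "e \<in> C" "\<epsilon> e = 1" using eps_one by blast
  note lS = linear_on_compose[OF S_lin eps_lin]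
  have "\<epsilon> a = \<epsilon> (tL (\<lambda>x y. S x \<bullet> y) (cr a e))"
    by (simp add: antipode_cr a e linear_on_scaleC[OF eps_lin] scaleC_complex_def)
  also have "\<dots> = tL (\<lambda>x y. \<epsilon> (S x \<bullet> y)) (cr a e)"
    by (rule tlift_comp[OF sub2 bilinear_S_left subspace eps_lin cr_mem[OF a e(1)]])
  also have "\<dots> = tL (\<lambda>x y. \<epsilon> (S (\<epsilon> y *\<^sub>C x))) (cr a e)"
    by (rule fun_cong[OF tlift_cong]) (simp add: eps_mult S_mem linear_on_scaleC[OF lS] scaleC_complex_def mult.commute)
  also have "\<dots> = \<epsilon> (S (sr \<epsilon> (cr a e)))"
    unfolding slice_right_def
    by (rule tlift_comp[OF sub2 bilinear_on_slice_right[OF eps_lin subspace] subspace lS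
          cr_mem[OF a e(1)], symmetric])
  also have "\<dots> = \<epsilon> (S a)" by (simp add: sr_eps_cr a e scaleC_one)
  finally show ?thesis by simp
qed

lemma eps_Si: "a \<in> C \<Longrightarrow> \<epsilon> (Si a) = \<epsilon> a"
  using eps_S[of "Si a"] by (simp add: Si_mem S_Si)

lemma eps_Q: "y \<in> C \<Longrightarrow> a \<in> C \<Longrightarrow> \<epsilon> (Q y a) = \<phi> (y \<bullet> a)"
  unfolding Q_def by (simp add: fubini[OF phi_lin eps_lin, symmetric] cl_mem sr_eps_cl)

text \<open>The relation \<open>\<Delta>(\<sigma>(z)) = (S\<^sup>2 \<otimes> \<sigma>)\<Delta>(z)\<close> with its first leg tested by the functional
  \<open>\<phi>(S\<^sup>2(y) \<cdot>)\<close>; the factor \<open>\<tau>\<close> arises from \<open>\<phi> \<circ> S\<^sup>2 = \<tau> \<phi>\<close>. After pairing with \<open>\<phi>(a \<cdot>)\<close> both sides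
  are expressed through \<open>E z a\<close>, by applying \<open>S_E\<close> and then \<open>S_E_sigma\<close>.\<close>

lemma Q_sigma:
  assumes y: "y \<in> C" and z: "z \<in> C"
  shows "Q (S (S y)) (\<sigma> z) = \<tau> *\<^sub>C \<sigma> (Q y z)"
proof (rule phi_eqI_left)
  fix a assume a: "a \<in> C"
  have "\<phi> (a \<bullet> Q (S (S y)) (\<sigma> z)) = \<phi> (sr (\<lambda>v. \<phi> (a \<bullet> v)) (cl (S (S y)) (\<sigma> z)))"
    unfolding Q_def
    by (rule fubini[OF phi_lin func_lmul[OF phi_lin a], symmetric]) (simp add: cl_mem S_mem y sigma_mem z)
  also have "\<dots> = \<phi> (S (S y) \<bullet> S (S (E z a)))"
    by (simp add: S_E[symmetric] S_E_sigma S_mem y sigma_mem z a)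
  also have "\<dots> = \<tau> * \<phi> (y \<bullet> E z a)"
    by (simp add: SS_mult[symmetric] phi_SS y z a E_mem mem_simps)
  also have "y \<bullet> E z a = sr (\<lambda>v. \<phi> (v \<bullet> a)) (cl y z)"
    unfolding E_def by (rule sr_cl_rmul[OF phi_lin y z a, symmetric])
  also have "\<phi> \<dots> = \<phi> (Q y z \<bullet> a)"
    unfolding Q_def by (rule fubini[OF phi_lin func_rmul[OF phi_lin a] cl_mem[OF y z]])
  also have "\<tau> * \<dots> = \<phi> (a \<bullet> (\<tau> *\<^sub>C \<sigma> (Q y z)))"
    by (simp add: phi_sigma Q_mem y z a sigma_mem lin_simps linear_on_scaleC[OF phi_lin] mem_simps scaleC_complex_def)
  finally show "\<phi> (a \<bullet> Q (S (S y)) (\<sigma> z)) = \<phi> (a \<bullet> (\<tau> *\<^sub>C \<sigma> (Q y z)))" .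
qed (simp_all add: Q_mem S_mem y z sigma_mem mem_simps)

text \<open>This lemma and the next apply \<open>\<epsilon>\<close> to \<open>Q_sigma\<close>: they evaluate the characters \<open>\<eta>\<close> and \<open>\<chi>\<close> on
  \<open>z \<triangleleft> b\<close> for \<open>b = \<phi>(y \<cdot>)\<close>.\<close>

lemma eta_Q:
  assumes y: "y \<in> C" and z: "z \<in> C"
  shows "\<epsilon> (\<sigma> (Q y z)) = \<phi> (y \<bullet> Si (Si (\<sigma> z)))"
proof -
  let ?w = "Si (Si (\<sigma> z))"
  have w: "?w \<in> C" "S (S ?w) = \<sigma> z" using z by (simp_all add: Si_mem S_Si sigma_mem)
  have "\<tau> * \<epsilon> (\<sigma> (Q y z)) = \<epsilon> (Q (S (S y)) (\<sigma> z))"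
    by (simp add: Q_sigma y z linear_on_scaleC[OF eps_lin] sigma_mem Q_mem scaleC_complex_def)
  also have "\<dots> = \<phi> (S (S y) \<bullet> S (S ?w))" by (simp add: eps_Q S_mem y sigma_mem z w(2))
  also have "\<dots> = \<tau> * \<phi> (y \<bullet> ?w)" by (simp add: SS_mult[symmetric] phi_SS y w(1) mem_simps)
  finally show ?thesis using tau_nonzero by simp
qed

lemma chi_Q:
  assumes y: "y \<in> C" and z: "z \<in> C"
  shows "\<epsilon> (si (Q y z)) = \<phi> (y \<bullet> S (S (si z)))"
proof -
  let ?y = "Si (Si y)"
  have y': "?y \<in> C" "S (S ?y) = y" using y by (simp_all add: Si_mem S_Si)
  have "Q y z = \<tau> *\<^sub>C \<sigma> (Q ?y (si z))"
    using Q_sigma[OF y'(1) si_mem[OF z]] by (simp add: y'(2) sigma_si z)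
  then have "\<epsilon> (si (Q y z)) = \<tau> * \<phi> (?y \<bullet> si z)"
    by (simp add: linear_on_scaleC[OF si_lin] sigma_mem Q_mem y' si_mem z si_sigma
      linear_on_scaleC[OF eps_lin] scaleC_complex_def eps_Q)
  also have "\<dots> = \<phi> (S (S (?y \<bullet> si z)))" by (simp add: phi_SS y' si_mem z mem_simps)
  also have "\<dots> = \<phi> (y \<bullet> S (S (si z)))" by (simp add: SS_mult y' si_mem z)
  finally show ?thesis .
qed

lemma eta_lin: "func (\<lambda>x. \<epsilon> (\<sigma> x))" by (rule linear_on_compose[OF sigma_lin eps_lin])

lemma chi_lin: "func (\<lambda>x. \<epsilon> (si x))" by (rule linear_on_compose[OF si_lin eps_lin])

text \<open>\<open>Q_sigma\<close> once more, with the functional on the first leg removed by faithfulness: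
  \<open>(\<iota> \<otimes> \<eta>)((y \<otimes> 1)\<Delta>(z)) = y S\<^sup>-\<^sup>2(\<sigma>(z))\<close>.\<close>

lemma sr_eta_cl:
  assumes y: "y \<in> C" and z: "z \<in> C"
  shows "sr (\<lambda>x. \<epsilon> (\<sigma> x)) (cl y z) = y \<bullet> Si (Si (\<sigma> z))"
proof (rule phi_eqI_left)
  fix b assume b: "b \<in> C"
  have "\<phi> (b \<bullet> sr (\<lambda>x. \<epsilon> (\<sigma> x)) (cl y z)) = \<phi> (sr (\<lambda>x. \<epsilon> (\<sigma> x)) (cl (b \<bullet> y) z))"
    by (simp add: sr_cl_mult eta_lin y z b)
  also have "\<dots> = \<epsilon> (\<sigma> (Q (b \<bullet> y) z))"
    unfolding Q_def by (rule fubini[OF phi_lin eta_lin]) (simp add: cl_mem mem_simps y z b)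
  also have "\<dots> = \<phi> (b \<bullet> (y \<bullet> Si (Si (\<sigma> z))))"
    by (simp add: eta_Q y z b mem_simps assoc Si_mem sigma_mem)
  finally show "\<phi> (b \<bullet> sr (\<lambda>x. \<epsilon> (\<sigma> x)) (cl y z)) = \<phi> (b \<bullet> (y \<bullet> Si (Si (\<sigma> z))))" .
qed (simp_all add: sr_mem eta_lin cl_mem y z mem_simps Si_mem sigma_mem)

text \<open>\<open>\<chi> \<circ> S\<close> and \<open>\<eta>\<close> are both right convolution inverses of \<open>\<chi>\<close>: the functionals \<open>\<chi> \<otimes> \<eta>\<close> and
  \<open>\<chi> \<otimes> (\<chi> \<circ> S)\<close> agree on every \<open>(p \<otimes> 1)\<Delta>(q)\<close>, thus on \<open>A \<otimes> A\<close>, and \<open>\<chi>\<close> is not zero.\<close>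

lemma chi_S:
  assumes x: "x \<in> C"
  shows "\<epsilon> (si (S x)) = \<epsilon> (\<sigma> x)"
proof -
  obtain e where e: "e \<in> C" "\<epsilon> e = 1" using eps_one by blast
  note cS = linear_on_compose[OF S_lin chi_lin]
  \<comment> \<open>for \<open>\<eta>\<close> by \<open>sr_eta_cl\<close>, as \<open>\<chi>(p S\<^sup>-\<^sup>2(\<sigma>(q))) = \<chi>(p) \<epsilon>(q)\<close>\<close>
  have 1: "\<epsilon> (si (sr (\<lambda>x. \<epsilon> (\<sigma> x)) (cl p q))) = \<epsilon> (si p) * \<epsilon> q" if pq: "p \<in> C" "q \<in> C" for p q
  proof -
    have "si (Si (Si (\<sigma> q))) = Si (Si q)" by (simp add: sigma_SiSi pq si_sigma Si_mem)
    then show ?thesis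
      by (simp add: sr_eta_cl pq si_mult Si_mem sigma_mem eps_mult si_mem eps_Si)
  qed
  \<comment> \<open>for \<open>\<chi> \<circ> S\<close> by the antipode axiom, as \<open>\<chi>\<close> is multiplicative\<close>
  have 2: "\<epsilon> (si (sr (\<lambda>x. \<epsilon> (si (S x))) (cl p q))) = \<epsilon> (si p) * \<epsilon> q" if pq: "p \<in> C" "q \<in> C" for p q
  proof -
    have "\<epsilon> (si (sr (\<lambda>x. \<epsilon> (si (S x))) (cl p q)))
       = tL (\<lambda>x y. \<epsilon> (si (\<epsilon> (si (S y)) *\<^sub>C x))) (cl p q)"
      unfolding slice_right_def
      by (rule tlift_comp[OF sub2 bilinear_on_slice_right[OF cS subspace] subspace chi_lin cl_mem[OF pq]])
    also have "\<dots> = tL (\<lambda>x y. \<epsilon> (si (x \<bullet> S y))) (cl p q)"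
      by (rule fun_cong[OF tlift_cong])
        (simp add: si_mult S_mem eps_mult si_mem linear_on_scaleC[OF chi_lin] scaleC_complex_def mult.commute)
    also have "\<dots> = \<epsilon> (si (tL (\<lambda>x y. x \<bullet> S y) (cl p q)))"
      by (rule tlift_comp[OF sub2 bilinear_S_right subspace chi_lin cl_mem[OF pq], symmetric])
    also have "\<dots> = \<epsilon> (si p) * \<epsilon> q"
      by (simp add: antipode_cl pq linear_on_scaleC[OF chi_lin] scaleC_complex_def mult.commute)
    finally show ?thesis .
  qed
  have "\<epsilon> (si (sr (\<lambda>x. \<epsilon> (\<sigma> x)) (\<sigma> e \<otimes> x))) = \<epsilon> (si (sr (\<lambda>x. \<epsilon> (si (S x))) (\<sigma> e \<otimes> x)))"
    by (rule linear_on_eqI_cl[OF linear_on_compose[OF lin_sr[OF eta_lin] chi_lin]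
          linear_on_compose[OF lin_sr[OF cS] chi_lin]])
      (simp_all add: 1 2 pure_mem sigma_mem e x)
  then show ?thesis
    by (simp add: sr_pure eta_lin cS sigma_mem e x linear_on_scaleC[OF chi_lin] si_sigma scaleC_complex_def)
qed

text \<open>Faithfulness of \<open>\<phi>\<close> and \<open>\<psi> = \<phi> \<circ> S\<close> force \<open>\<sigma>' = S\<^sup>-\<^sup>1 \<sigma>\<^sup>-\<^sup>1 S\<close>.\<close>

lemma S_sigma':
  assumes a: "a \<in> C"
  shows "\<sigma> (S (\<sigma>' a)) = S a"
proof (rule phi_eqI_left)
  fix b assume b: "b \<in> C"
  let ?x = "Si b"
  have x: "?x \<in> C" "S ?x = b" using b by (simp_all add: Si_mem S_Si)
  have "\<phi> (b \<bullet> \<sigma> (S (\<sigma>' a))) = \<phi> (S (\<sigma>' a) \<bullet> S ?x)"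
    using phi_sigma[of "S (\<sigma>' a)" b] by (simp add: S_mem sigma'_mem a b x)
  also have "\<dots> = \<psi> (?x \<bullet> \<sigma>' a)" by (simp add: psi_phi S_anti mem_simps sigma'_mem a x(1))
  also have "\<dots> = \<psi> (a \<bullet> ?x)" by (simp add: psi_sigma' a x(1))
  also have "\<dots> = \<phi> (b \<bullet> S a)" by (simp add: psi_phi S_anti mem_simps a x)
  finally show "\<phi> (b \<bullet> \<sigma> (S (\<sigma>' a))) = \<phi> (b \<bullet> S a)" .
qed (simp_all add: sigma_mem S_mem sigma'_mem a)

lemma eps_sigma':
  assumes a: "a \<in> C"
  shows "\<epsilon> (\<sigma>' a) = \<epsilon> (\<sigma> a)"
proof -
  have "S (\<sigma>' a) = si (S a)"
    using si_sigma[of "S (\<sigma>' a)"] by (simp add: S_sigma' S_mem sigma'_mem a)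
  then show ?thesis using eps_S[of "\<sigma>' a"] chi_S[OF a] by (simp add: sigma'_mem a)
qed

lemma eps_si':
  assumes a: "a \<in> C"
  shows "\<epsilon> (inv_into C \<sigma>' a) = \<epsilon> (si a)"
proof -
  let ?b = "inv_into C \<sigma>' a"
  have b: "?b \<in> C" "\<sigma>' ?b = a"
    using a sigma'_bij by (simp_all add: inv_into_into bij_betw_def f_inv_into_f)
  have "\<epsilon> (si a) = \<epsilon> (S (S (si a)))" by (simp add: eps_S S_mem si_mem a)
  also have "\<dots> = \<epsilon> (si (S (S a)))" by (simp add: si_SS a)
  also have "\<dots> = \<epsilon> (\<sigma> (S (\<sigma>' ?b)))" by (simp add: chi_S S_mem a b)
  also have "\<dots> = \<epsilon> ?b" using S_sigma'[OF b(1)] eps_S[OF b(1)] by simp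
  finally show ?thesis by simp
qed

end

section \<open>The dual algebra\<close>

lemma scaleC_apply: "(c *\<^sub>C f) x = c *\<^sub>C f x"
  by (simp add: scaleC_fun_def)

context quantum_group
begin

abbreviation "B \<equiv> dual_alg A \<Delta> \<phi>"
abbreviation "CB \<equiv> carrier B"
abbreviation "df \<equiv> dual_fun A \<phi>"

text \<open>The functional \<open>\<phi>(y \<cdot>)\<close>, extended by zero like \<open>dual_fun\<close>: the left form of an element of
  the dual, suited to the right action, as the right form \<open>\<phi>(\<cdot> d)\<close> is to the left action.\<close>

definition "lf y = (\<lambda>x. if x \<in> C then \<phi> (y \<bullet> x) else 0)"

lemma df_apply: "a \<in> C \<Longrightarrow> df c a = \<phi> (a \<bullet> c)"
  by (simp add: dual_fun_def)

lemma lf_apply: "a \<in> C \<Longrightarrow> lf c a = \<phi> (c \<bullet> a)"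
  by (simp add: lf_def)

lemma inj_df: "inj_on df C"
proof (rule inj_onI)
  fix x y assume x: "x \<in> C" and y: "y \<in> C" and eq: "df x = df y"
  show "x = y"
  proof (rule phi_eqI_left[OF x y])
    fix b assume "b \<in> C"
    then show "\<phi> (b \<bullet> x) = \<phi> (b \<bullet> y)" using fun_cong[OF eq, of b] by (simp add: df_apply)
  qed
qed

lemma CB_df: "CB = df ` C"
  by (simp add: dual_alg_def)

lemma df_mem: "c \<in> C \<Longrightarrow> df c \<in> CB"
  by (simp add: CB_df)

lemma lf_df: "y \<in> C \<Longrightarrow> lf y = df (\<sigma> y)"
  by (auto simp: lf_def dual_fun_def phi_sigma)

lemma df_lf: "c \<in> C \<Longrightarrow> df c = lf (si c)"
  by (simp add: lf_df si_mem sigma_si)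

lemma lf_mem: "y \<in> C \<Longrightarrow> lf y \<in> CB"
  by (simp add: lf_df df_mem sigma_mem)

lemma CB_cases:
  assumes "b \<in> CB"
  obtains c where "c \<in> C" "b = df c"
  using assms by (auto simp: CB_df)

lemma CB_cases':
  assumes "b \<in> CB"
  obtains y where "y \<in> C" "b = lf y"
  using assms df_lf si_mem by (auto simp: CB_df)

lemma df_add: "c \<in> C \<Longrightarrow> d \<in> C \<Longrightarrow> df (c + d) = df c + df d"
  by (auto simp: dual_fun_def lin_simps linear_on_add[OF phi_lin] mem_simps)

lemma df_scale: "c \<in> C \<Longrightarrow> df (k *\<^sub>C c) = k *\<^sub>C df c"
  by (auto simp: dual_fun_def lin_simps linear_on_scaleC[OF phi_lin] mem_simps scaleC_fun_def)

lemma lf_add: "c \<in> C \<Longrightarrow> d \<in> C \<Longrightarrow> lf (c + d) = lf c + lf d"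
  by (auto simp: lf_def lin_simps linear_on_add[OF phi_lin] mem_simps)

lemma lf_scale: "c \<in> C \<Longrightarrow> lf (k *\<^sub>C c) = k *\<^sub>C lf c"
  by (auto simp: lf_def lin_simps linear_on_scaleC[OF phi_lin] mem_simps scaleC_fun_def)

lemma subspace_CB: "complex_vector.subspace CB"
proof (rule complex_vector.subspaceI)
  show "0 \<in> CB" using df_mem[OF zero_mem] df_scale[OF zero_mem, of 0] by simp
  show "b + b' \<in> CB" if b: "b \<in> CB" and b': "b' \<in> CB" for b b'
  proof -
    obtain c c' where "c \<in> C" "b = df c" "c' \<in> C" "b' = df c'"
      using CB_cases[OF b] CB_cases[OF b'] by metis
    then show ?thesis using df_mem[OF add_mem, of c c'] by (simp add: df_add)
  qed
  show "k *\<^sub>C b \<in> CB" if b: "b \<in> CB" for k b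
  proof -
    obtain c where "c \<in> C" "b = df c" using CB_cases[OF b] by metis
    then show ?thesis using df_mem[OF scale_mem, of c k] by (simp add: df_scale)
  qed
qed

lemma CB_func: "b \<in> CB \<Longrightarrow> func b"
  by (erule CB_cases) (auto simp: df_apply mem_simps lin_simps linear_rules[OF phi_lin] scaleC_complex_def intro!: linear_onI)

lemma CB_outside: "b \<in> CB \<Longrightarrow> x \<notin> C \<Longrightarrow> b x = 0"
  by (erule CB_cases) (simp add: dual_fun_def)

lemma CB_eqI: "b \<in> CB \<Longrightarrow> b' \<in> CB \<Longrightarrow> (\<And>x. x \<in> C \<Longrightarrow> b x = b' x) \<Longrightarrow> b = b'"
  using CB_outside by (metis ext)

lemma mult_B_outside: "x \<notin> C \<Longrightarrow> (b \<cdot>\<^bsub>B\<^esub> b') x = 0"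
  by (simp add: dual_alg_def)

text \<open>Slicing \<open>\<Delta>(a)\<close> one leg at a time expresses the product of the dual through either action,
  \<open>\<langle>a, b b'\<rangle> = \<langle>b' \<triangleright> a, b\<rangle> = \<langle>a \<triangleleft> b, b'\<rangle>\<close>; the second form is the next lemma.\<close>

lemma mult_B_E:
  assumes b: "b \<in> CB" and d: "d \<in> C" and a: "a \<in> C"
  shows "(b \<cdot>\<^bsub>B\<^esub> df d) a = b (E a d)"
proof -
  obtain c where c: "c \<in> C" "b = df c" using CB_cases[OF b] by metis
  have inv: "inv_into C df (df x) = x" if "x \<in> C" for x by (rule inv_into_f_f[OF inj_df that])
  let ?t = "tmap C C (\<lambda>u. u \<bullet> c) (\<lambda>v. v) (cr a d)"
  have t: "?t \<in> T" by (rule linear_on_mem[OF tmap_T[OF lin_rmul[OF c(1)] lin_id] cr_mem[OF a d]])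
  have "(b \<cdot>\<^bsub>B\<^esub> df d) a = tL (\<lambda>x y. \<phi> x * \<phi> y) ?t"
    using a by (simp add: dual_alg_def pair_multiplier_def c inv d Let_def fst_cop_pure)
  also have "\<dots> = \<phi> (sr \<phi> ?t)"
    unfolding slice_right_def by (rule tlift_slice_right(2)[OF sub2 phi_lin t phi_lin, symmetric])
  also have "\<dots> = b (E a d)"
    by (simp add: sr_tmap phi_lin lin_id lin_rmul c cr_mem a d, simp add: df_apply E_mem a d flip: E_def)
  finally show ?thesis .
qed

lemma mult_B_Q:
  assumes y: "y \<in> C" and b: "b \<in> CB" and a: "a \<in> C"
  shows "(lf y \<cdot>\<^bsub>B\<^esub> b) a = b (Q y a)"
proof -
  obtain d where d: "d \<in> C" "b = df d" using CB_cases[OF b] by metis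
  have "(lf y \<cdot>\<^bsub>B\<^esub> b) a = \<phi> (y \<bullet> E a d)"
    by (simp add: mult_B_E lf_mem y d a, simp add: lf_apply E_mem a d)
  also have "\<dots> = \<phi> (sl (\<lambda>u. \<phi> (y \<bullet> u)) (cr a d))"
    unfolding E_def by (rule fubini[OF func_lmul[OF phi_lin y] phi_lin cr_mem[OF a d(1)]])
  also have "\<dots> = b (Q y a)"
    by (simp add: sl_cr_lmul phi_lin y a d df_apply Q_mem, simp add: Q_def)
  finally show ?thesis .
qed

text \<open>The two actions commute, \<open>b' \<triangleright> (a \<triangleleft> b) = (b' \<triangleright> a) \<triangleleft> b\<close>, by coassociativity. This is what
  makes the dual associative.\<close>

lemma E_Q:
  assumes y: "y \<in> C" and a: "a \<in> C" and d: "d \<in> C"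
  shows "E (Q y a) d = Q y (E a d)"
proof -
  \<comment> \<open>the trilinear map \<open>\<phi> \<otimes> \<iota> \<otimes> \<phi>\<close>, to be applied to \<open>y a\<^sub>1 \<otimes> a\<^sub>2 \<otimes> a\<^sub>3 d\<close>\<close>
  define F where "F = (\<lambda>s g h. (\<phi> s * \<phi> h) *\<^sub>C (g::'a))"
  have F23: "bilinear_on C C UNIV (F s)" if "s \<in> C" for s
    by (rule bilinear_onI) (simp_all add: that F_def linear_rules[OF phi_lin]
        scaleC_add_right scaleC_add_left scaleC_scaleC scaleC_complex_def algebra_simps)
  have F1: "linear_on C UNIV (\<lambda>s. F s g h)" if "g \<in> C" "h \<in> C" for g h
    by (rule linear_onI) (simp_all add: that F_def linear_rules[OF phi_lin]
        scaleC_add_left scaleC_scaleC scaleC_complex_def algebra_simps)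
  have "E (Q y a) d = tL (\<lambda>s t. E (\<phi> s *\<^sub>C t) d) (cl y a)"
    unfolding Q_def slice_left_def
    by (rule tlift_comp[OF sub2 bilinear_on_slice_left[OF phi_lin subspace] subspace E_lin[OF d] cl_mem[OF y a]])
  also have "\<dots> = tL (\<lambda>s t. tL (F s) (cr t d)) (cl y a)"
  proof (rule fun_cong[OF tlift_cong])
    fix s t assume s: "s \<in> C" and t: "t \<in> C"
    have "E (\<phi> s *\<^sub>C t) d = \<phi> s *\<^sub>C E t d" by (rule linear_on_scaleC[OF E_lin[OF d] t])
    also have "\<dots> = tL (\<lambda>x y. \<phi> s *\<^sub>C \<phi> y *\<^sub>C x) (cr t d)"
      unfolding E_def slice_right_def
      by (rule tlift_scaleC[OF sub2 bilinear_on_slice_right[OF phi_lin subspace] cr_mem[OF t d], symmetric])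
    finally show "E (\<phi> s *\<^sub>C t) d = tL (F s) (cr t d)" by (simp add: F_def scaleC_scaleC)
  qed
  also have "\<dots> = tL (\<lambda>g h. tL (\<lambda>x z. F x z h) (cl y g)) (cr a d)"
    by (rule coassoc[OF y a d F23 F1, symmetric])
  also have "\<dots> = tL (\<lambda>g h. Q y (\<phi> h *\<^sub>C g)) (cr a d)"
  proof (rule fun_cong[OF tlift_cong])
    fix g h assume g: "g \<in> C" and h: "h \<in> C"
    have "Q y (\<phi> h *\<^sub>C g) = \<phi> h *\<^sub>C Q y g" by (rule linear_on_scaleC[OF Q_lin[OF y] g])
    also have "\<dots> = tL (\<lambda>x z. \<phi> h *\<^sub>C \<phi> x *\<^sub>C z) (cl y g)"
      unfolding Q_def slice_left_def
      by (rule tlift_scaleC[OF sub2 bilinear_on_slice_left[OF phi_lin subspace] cl_mem[OF y g], symmetric])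
    finally show "tL (\<lambda>x z. F x z h) (cl y g) = Q y (\<phi> h *\<^sub>C g)" by (simp add: F_def scaleC_scaleC mult.commute)
  qed
  also have "\<dots> = Q y (E a d)"
    unfolding E_def slice_right_def
    by (rule tlift_comp[OF sub2 bilinear_on_slice_right[OF phi_lin subspace] subspace Q_lin[OF y] cr_mem[OF a d], symmetric])
  finally show ?thesis .
qed

lemma phi_one: "\<exists>w\<in>C. \<phi> w = 1"
proof -
  obtain a where "a \<in> C" "\<phi> a \<noteq> 0" using phi_nonzero by blast
  then show ?thesis
    by (intro bexI[of _ "(1 / \<phi> a) *\<^sub>C a"]) (simp_all add: linear_on_scaleC[OF phi_lin] scaleC_complex_def mem_simps)
qed

lemma linear_on_eqI_E:
  assumes f: "linear_on C U f" and g: "linear_on C U' g"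
    and eq: "\<And>a d. a \<in> C \<Longrightarrow> d \<in> C \<Longrightarrow> f (E a d) = g (E a d)" and z: "z \<in> C"
  shows "f z = g z"
proof -
  obtain w where w: "w \<in> C" "\<phi> w = 1" using phi_one by blast
  have "f (sr \<phi> (z \<otimes> w)) = g (sr \<phi> (z \<otimes> w))"
    by (rule linear_on_eqI_cr[OF linear_on_compose[OF lin_sr[OF phi_lin] f]
          linear_on_compose[OF lin_sr[OF phi_lin] g]])
      (simp_all add: eq pure_mem w z flip: E_def)
  then show ?thesis by (simp add: sr_pure phi_lin w z scaleC_one)
qed

lemma linear_on_eqI_Q:
  assumes f: "linear_on C U f" and g: "linear_on C U' g"
    and eq: "\<And>y a. y \<in> C \<Longrightarrow> a \<in> C \<Longrightarrow> f (Q y a) = g (Q y a)" and z: "z \<in> C"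
  shows "f z = g z"
proof -
  obtain w where w: "w \<in> C" "\<phi> w = 1" using phi_one by blast
  have "f (sl \<phi> (w \<otimes> z)) = g (sl \<phi> (w \<otimes> z))"
    by (rule linear_on_eqI_cl[OF linear_on_compose[OF lin_sl[OF phi_lin] f]
          linear_on_compose[OF lin_sl[OF phi_lin] g]])
      (simp_all add: eq pure_mem w z flip: Q_def)
  then show ?thesis by (simp add: sl_pure phi_lin w z scaleC_one)
qed

text \<open>The product of \<open>\<phi>(y \<cdot>)\<close> and \<open>\<phi>(\<cdot> d)\<close> is \<open>a \<mapsto> \<phi>(y E(a, d))\<close>. To move \<open>a\<close> out of the first
  argument of \<open>E\<close>, write \<open>\<phi>\<close> as a multiple of \<open>\<psi> \<circ> S\<close> and use \<open>S(E(a, d)) = E(d, \<sigma>(a))\<close>.\<close>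

lemma mult_B_mem:
  assumes b: "b \<in> CB" and b': "b' \<in> CB"
  shows "b \<cdot>\<^bsub>B\<^esub> b' \<in> CB"
proof -
  obtain y where y: "y \<in> C" "b = lf y" using CB_cases'[OF b] by metis
  obtain d where d: "d \<in> C" "b' = df d" using CB_cases[OF b'] by metis
  \<comment> \<open>chosen so that \<open>\<psi>(x S(y)) = \<psi>(y' x)\<close> for all \<open>x\<close>\<close>
  define y' where "y' = inv_into C \<sigma>' (S y)"
  have y': "y' \<in> C" "\<sigma>' y' = S y"
    using S_mem[OF y(1)] sigma'_bij by (simp_all add: y'_def inv_into_into bij_betw_def f_inv_into_f)
  define r where "r = (1 / \<tau>) *\<^sub>C sl \<psi> (cl y' d)"
  have s: "sl \<psi> (cl y' d) \<in> C" by (rule sl_mem[OF psi_lin cl_mem[OF y'(1) d(1)]])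
  have r: "r \<in> C" using s by (simp add: r_def mem_simps)
  have "b \<cdot>\<^bsub>B\<^esub> b' = df r"
  proof (rule ext)
    fix a
    show "(b \<cdot>\<^bsub>B\<^esub> b') a = df r a"
    proof (cases "a \<in> C")
      case a: True
      have E: "E d (\<sigma> a) \<in> C" by (simp add: E_mem d sigma_mem a)
      have "\<tau> * (b \<cdot>\<^bsub>B\<^esub> b') a = \<tau> * \<phi> (y \<bullet> E a d)"
        using mult_B_E[OF b d(1) a] by (simp add: d(2) y(2) lf_apply E_mem a d(1))
      also have "\<dots> = \<psi> (E d (\<sigma> a) \<bullet> \<sigma>' y')"
        by (simp add: psi_S[symmetric] S_anti S_E_sigma y y' E_mem a d mem_simps)
      also have "\<dots> = \<psi> (y' \<bullet> E d (\<sigma> a))" by (rule psi_sigma'[OF y'(1) E, symmetric])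
      also have "y' \<bullet> E d (\<sigma> a) = sr (\<lambda>v. \<phi> (v \<bullet> \<sigma> a)) (cl y' d)"
        unfolding E_def by (rule sr_cl_rmul[OF phi_lin y'(1) d(1) sigma_mem[OF a], symmetric])
      also have "\<psi> \<dots> = \<phi> (sl \<psi> (cl y' d) \<bullet> \<sigma> a)"
        by (rule fubini[OF psi_lin func_rmul[OF phi_lin sigma_mem[OF a]] cl_mem[OF y'(1) d(1)]])
      also have "\<dots> = \<phi> (a \<bullet> sl \<psi> (cl y' d))" by (rule phi_sigma[OF a s, symmetric])
      also have "\<dots> = \<tau> * df r a"
        using tau_nonzero
        by (simp add: df_apply a r_def lin_simps s linear_on_scaleC[OF phi_lin] mem_simps scaleC_complex_def)
      finally show ?thesis using tau_nonzero by simp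
    qed (simp add: mult_B_outside dual_fun_def)
  qed
  then show ?thesis using df_mem[OF r] by simp
qed

lemma bilinear_mult_B: "bilinear_on CB CB CB (mult B)"
proof (rule bilinear_onI)
  fix b b' x k assume b: "b \<in> CB" and b': "b' \<in> CB"
  note sB = complex_vector.subspace_add[OF subspace_CB] complex_vector.subspace_scale[OF subspace_CB]
  show "b \<cdot>\<^bsub>B\<^esub> b' \<in> CB" by (rule mult_B_mem[OF b b'])
  obtain y where y: "y \<in> C" "b = lf y" using CB_cases'[OF b] by metis
  obtain d where d: "d \<in> C" "b' = df d" using CB_cases[OF b'] by metis
  show "(b + x) \<cdot>\<^bsub>B\<^esub> b' = b \<cdot>\<^bsub>B\<^esub> b' + x \<cdot>\<^bsub>B\<^esub> b'" if x: "x \<in> CB"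
  proof (rule ext)
    fix a show "((b + x) \<cdot>\<^bsub>B\<^esub> b') a = (b \<cdot>\<^bsub>B\<^esub> b' + x \<cdot>\<^bsub>B\<^esub> b') a"
      by (cases "a \<in> C") (simp_all add: mult_B_outside d mult_B_E b x sB)
  qed
  show "(k *\<^sub>C b) \<cdot>\<^bsub>B\<^esub> b' = k *\<^sub>C (b \<cdot>\<^bsub>B\<^esub> b')"
  proof (rule ext)
    fix a show "((k *\<^sub>C b) \<cdot>\<^bsub>B\<^esub> b') a = (k *\<^sub>C (b \<cdot>\<^bsub>B\<^esub> b')) a"
      by (cases "a \<in> C") (simp_all add: mult_B_outside d mult_B_E b sB scaleC_apply)
  qed
  show "b \<cdot>\<^bsub>B\<^esub> (b' + x) = b \<cdot>\<^bsub>B\<^esub> b' + b \<cdot>\<^bsub>B\<^esub> x" if x: "x \<in> CB"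
  proof (rule ext)
    fix a show "(b \<cdot>\<^bsub>B\<^esub> (b' + x)) a = (b \<cdot>\<^bsub>B\<^esub> b' + b \<cdot>\<^bsub>B\<^esub> x) a"
      by (cases "a \<in> C") (simp_all add: mult_B_outside y mult_B_Q b' x sB)
  qed
  show "b \<cdot>\<^bsub>B\<^esub> (k *\<^sub>C b') = k *\<^sub>C (b \<cdot>\<^bsub>B\<^esub> b')"
  proof (rule ext)
    fix a show "(b \<cdot>\<^bsub>B\<^esub> (k *\<^sub>C b')) a = (k *\<^sub>C (b \<cdot>\<^bsub>B\<^esub> b')) a"
      by (cases "a \<in> C") (simp_all add: mult_B_outside y mult_B_Q b' sB scaleC_apply)
  qed
qed

lemma nondegenerate_B: "nondegenerate_algebra B"
  unfolding nondegenerate_algebra_def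
proof (intro conjI ballI impI)
  show "complex_vector.subspace CB" by (rule subspace_CB)
  show "bilinear_on CB CB CB (mult B)" by (rule bilinear_mult_B)
  show "(b \<cdot>\<^bsub>B\<^esub> b') \<cdot>\<^bsub>B\<^esub> b'' = b \<cdot>\<^bsub>B\<^esub> (b' \<cdot>\<^bsub>B\<^esub> b'')"
    if b: "b \<in> CB" and b': "b' \<in> CB" and b'': "b'' \<in> CB" for b b' b''
  proof (rule CB_eqI)
    fix a assume a: "a \<in> C"
    obtain y where y: "y \<in> C" "b = lf y" using CB_cases'[OF b] by metis
    obtain d where d: "d \<in> C" "b'' = df d" using CB_cases[OF b''] by metis
    have "((b \<cdot>\<^bsub>B\<^esub> b') \<cdot>\<^bsub>B\<^esub> b'') a = b' (Q y (E a d))"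
      using mult_B_E[OF mult_B_mem[OF b b'] d(1) a] mult_B_Q[OF y(1) b' E_mem[OF a d(1)]]
      by (simp add: d(2) y(2))
    also have "\<dots> = (b \<cdot>\<^bsub>B\<^esub> (b' \<cdot>\<^bsub>B\<^esub> b'')) a"
      using mult_B_Q[OF y(1) mult_B_mem[OF b' b''] a] mult_B_E[OF b' d(1) Q_mem[OF y(1) a]]
      by (simp add: d(2) y(2) E_Q[OF y(1) a d(1)])
    finally show "((b \<cdot>\<^bsub>B\<^esub> b') \<cdot>\<^bsub>B\<^esub> b'') a = (b \<cdot>\<^bsub>B\<^esub> (b' \<cdot>\<^bsub>B\<^esub> b'')) a" .
  qed (intro mult_B_mem b b' b'')+
  have zero: "0 \<in> CB" by (rule complex_vector.subspace_0[OF subspace_CB])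
  show "b = 0" if b: "b \<in> CB" and z: "\<forall>b'\<in>CB. b \<cdot>\<^bsub>B\<^esub> b' = 0" for b
  proof (rule CB_eqI[OF b zero])
    fix x assume x: "x \<in> C"
    show "b x = (0 :: 'a \<Rightarrow> complex) x"
    proof (rule linear_on_eqI_E[OF CB_func[OF b] CB_func[OF zero] _ x])
      fix a d assume "a \<in> C" "d \<in> C"
      then show "b (E a d) = (0 :: 'a \<Rightarrow> complex) (E a d)"
        using z mult_B_E[OF b, of d a] by (simp add: df_mem)
    qed
  qed
  show "b = 0" if b: "b \<in> CB" and z: "\<forall>b'\<in>CB. b' \<cdot>\<^bsub>B\<^esub> b = 0" for b
  proof (rule CB_eqI[OF b zero])
    fix x assume x: "x \<in> C"
    show "b x = (0 :: 'a \<Rightarrow> complex) x"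
    proof (rule linear_on_eqI_Q[OF CB_func[OF b] CB_func[OF zero] _ x])
      fix y a assume "y \<in> C" "a \<in> C"
      then show "b (Q y a) = (0 :: 'a \<Rightarrow> complex) (Q y a)"
        using z mult_B_Q[OF _ b, of y a] by (simp add: lf_mem)
    qed
  qed
qed

lemma left_action_df:
  assumes d: "d \<in> C" and a: "a \<in> C"
  shows "left_action A \<Delta> (df d) a = E a d"
  unfolding left_action_def
proof (rule unembedI[OF _ E_mem[OF a d]], rule prod_eqI; rule ext)
  fix x
  have srd: "sr (df d) = sr (\<lambda>v. \<phi> (v \<bullet> d))" by (rule sr_cong) (simp add: df_apply)
  show "snd (mslice_right A (df d) (\<Delta> a)) x = snd (embed A (E a d)) x"
    using a d by (simp add: mslice_right_def embed_def srd sr_cl_rmul phi_lin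
        flip: cov_left_def, simp add: E_def)
  show "fst (mslice_right A (df d) (\<Delta> a)) x = fst (embed A (E a d)) x"
  proof (cases "x \<in> C")
    case x: True
    let ?m = "\<Delta> a \<cdot>\<^bsub>M2 A\<^esub> in_left A x"
    let ?t = "unembed (A \<otimes>\<^sub>A A) ?m"
    have t: "?t \<in> T" "embed (A \<otimes>\<^sub>A A) ?t = ?m"
      using AA.AB.in_algD[OF in_alg_cov(3)[OF a x]] by (simp_all add: carrier_tensor_alg)
    have eq: "snd (in_right A d) ?t = snd (in_left A x) (cr a d)"
      by (rule embed_cancel)
        (simp_all add: t a d x cr_mem snd_mem2 in_left_mem in_right_mem embed_cr
          AA.AB.mult_alg_assoc in_left_in_right flip: embed_mult2)
    have "sr (df d) ?t = sr \<phi> (snd (in_right A d) ?t)"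
      by (simp add: srd in_left_simps t sr_tmap phi_lin lin_id lin_rmul d)
    also have "\<dots> = E a d \<bullet> x"
      by (simp add: eq in_left_simps cr_mem a d sr_tmap phi_lin lin_id lin_rmul x, simp add: E_def)
    finally show ?thesis using x by (simp add: mslice_right_def embed_def)
  qed (simp add: mslice_right_def embed_def)
qed

lemma right_action_lf:
  assumes y: "y \<in> C" and a: "a \<in> C"
  shows "right_action A \<Delta> a (lf y) = Q y a"
  unfolding right_action_def
proof (rule unembedI[OF _ Q_mem[OF y a]], rule prod_eqI; rule ext)
  fix x
  have sly: "sl (lf y) = sl (\<lambda>v. \<phi> (y \<bullet> v))" by (rule sl_cong) (simp add: lf_apply)
  show "fst (mslice_left A (lf y) (\<Delta> a)) x = fst (embed A (Q y a)) x"
    using a y by (simp add: mslice_left_def embed_def sly sl_cr_lmul phi_lin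
        flip: cov_right_def, simp add: Q_def)
  show "snd (mslice_left A (lf y) (\<Delta> a)) x = snd (embed A (Q y a)) x"
  proof (cases "x \<in> C")
    case x: True
    let ?m = "in_right A x \<cdot>\<^bsub>M2 A\<^esub> \<Delta> a"
    let ?t = "unembed (A \<otimes>\<^sub>A A) ?m"
    have t: "?t \<in> T" "embed (A \<otimes>\<^sub>A A) ?t = ?m"
      using AA.AB.in_algD[OF in_alg_cov(4)[OF x a]] by (simp_all add: carrier_tensor_alg)
    have eq: "fst (in_left A y) ?t = fst (in_right A x) (cl y a)"
      by (rule embed_cancel)
        (simp_all add: t a y x cl_mem fst_mem2 in_left_mem in_right_mem embed_cl
          AA.AB.mult_alg_assoc[symmetric] in_left_in_right flip: mult_embed2)
    have "sl (lf y) ?t = sl \<phi> (fst (in_left A y) ?t)"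
      by (simp add: sly in_left_simps t sl_tmap phi_lin lin_id lin_lmul y)
    also have "\<dots> = x \<bullet> Q y a"
      by (simp add: eq in_left_simps cl_mem a y sl_tmap phi_lin lin_id lin_lmul x, simp add: Q_def)
    finally show ?thesis using x by (simp add: mslice_left_def embed_def)
  qed (simp add: mslice_left_def embed_def)
qed

end

sublocale quantum_group \<subseteq> dual: nondeg_alg "dual_alg A \<Delta> \<phi>"
  by (rule nondeg_alg.intro[OF nondegenerate_B])

sublocale quantum_group \<subseteq> dual2: nondeg_pair "dual_alg A \<Delta> \<phi>" "dual_alg A \<Delta> \<phi>" ..

section \<open>The modular element of the dual\<close>

lemma (in nondeg_alg) mult_inverse_props:
  assumes "mult_invertible A m"
  shows "mult_inverse A m \<in> carrier (mult_alg A)"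
    and "m \<cdot>\<^bsub>mult_alg A\<^esub> mult_inverse A m = mult_one A"
    and "mult_inverse A m \<cdot>\<^bsub>mult_alg A\<^esub> m = mult_one A"
proof -
  let ?P = "\<lambda>n. n \<in> carrier (mult_alg A) \<and>
     m \<cdot>\<^bsub>mult_alg A\<^esub> n = mult_one A \<and> n \<cdot>\<^bsub>mult_alg A\<^esub> m = mult_one A"
  have one_left: "mult_one A \<cdot>\<^bsub>mult_alg A\<^esub> n = n" if "n \<in> carrier (mult_alg A)" for n
    by (rule multiplier_eqI) (simp_all add: that mult_alg_mult_mem mult_one_mem fst_mult_alg fst_mult_one fst_mem)
  have one_right: "n \<cdot>\<^bsub>mult_alg A\<^esub> mult_one A = n" if "n \<in> carrier (mult_alg A)" for n
    by (rule multiplier_eqI) (simp_all add: that mult_alg_mult_mem mult_one_mem fst_mult_alg fst_mult_one)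
  obtain n where n: "?P n" using assms by (auto simp: mult_invertible_def)
  have "?P (mult_inverse A m)"
    unfolding mult_inverse_def
  proof (rule theI[of ?P, OF n])
    fix n' assume n': "?P n'"
    have "n' = n' \<cdot>\<^bsub>mult_alg A\<^esub> (m \<cdot>\<^bsub>mult_alg A\<^esub> n)" using n n' by (simp add: one_right)
    also have "\<dots> = (n' \<cdot>\<^bsub>mult_alg A\<^esub> m) \<cdot>\<^bsub>mult_alg A\<^esub> n" by (rule mult_alg_assoc[symmetric])
    also have "\<dots> = n" using n n' by (simp add: one_left)
    finally show "n' = n" .
  qed
  then show "mult_inverse A m \<in> carrier (mult_alg A)"
    "m \<cdot>\<^bsub>mult_alg A\<^esub> mult_inverse A m = mult_one A"
    "mult_inverse A m \<cdot>\<^bsub>mult_alg A\<^esub> m = mult_one A" by simp_all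
qed

context quantum_group
begin

abbreviation "TB \<equiv> tensor_space CB CB"

lemma bilinear_eval: "bilinear_on CB CB UNIV (\<lambda>p q. p x * q (y::'a) :: complex)"
  by (rule bilinear_onI) (simp_all add: scaleC_fun_def scaleC_complex_def algebra_simps)

lemma tensor_pairing_pure_left:
  assumes t: "t \<in> TB" and x: "x \<in> C" and y: "y \<in> C"
  shows "tensor_pairing A B (x \<otimes> y) t = tlift CB CB (\<lambda>p q. p x * q y) t"
proof -
  obtain ps where ps: "set ps \<subseteq> CB \<times> CB" "t = (\<Sum>(p, q)\<leftarrow>ps. p \<otimes> q)"
    using tensor_space_sum_list[OF t subspace_CB] by (elim exE conjE)
  have eval: "tlift CB CB (\<lambda>p q. p x * q y) t = (\<Sum>(p, q)\<leftarrow>ps. p x * q y)" for x y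
    unfolding ps(2) by (rule tlift_sum_list[OF subspace_CB subspace_CB bilinear_eval ps(1)])
  have "bilinear_on C C UNIV (\<lambda>x y. \<Sum>(p, q)\<leftarrow>ps. p x * q y)"
    using ps(1)
  proof (induction ps)
    case Nil
    show ?case by (rule bilinear_onI) simp_all
  next
    case (Cons pq ps)
    obtain p q where pq: "pq = (p, q)" by (cases pq)
    have bl: "bilinear_on C C UNIV (\<lambda>x y. \<Sum>(p, q)\<leftarrow>ps. p x * q y)" using Cons by simp
    have fp: "func p" and fq: "func q" using Cons.prems by (simp_all add: pq CB_func)
    show ?case
      unfolding pq
      by (rule bilinear_onI) (simp_all add: bilinear_onD[OF bl] bilinear_onD[OF bilinear_on_product[OF fp fq]]
        scaleC_add_right)
  qed
  then have "bilinear_on C C UNIV (\<lambda>x y. tlift CB CB (\<lambda>p q. p x * q y) t)"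
    by (simp add: eval)
  from tlift_pure[OF sub2 this x y] show ?thesis by (simp add: tensor_pairing_def)
qed

lemma tensor_pairing_pure_right:
  assumes b: "b \<in> CB" and b': "b' \<in> CB"
  shows "tensor_pairing A B s (b \<otimes> b') = tL (\<lambda>x y. b x * b' y) s"
  unfolding tensor_pairing_def
  by (simp add: tlift_pure[OF subspace_CB subspace_CB bilinear_eval b b'])

end

locale dual_quantum_group = quantum_group A \<Delta> \<epsilon> S \<phi> \<psi> \<sigma> \<sigma>'
  for A :: "'a::complex_vector calg" and \<Delta> \<epsilon> S \<phi> \<psi> \<sigma> \<sigma>' +
  fixes \<Delta>' :: "('a \<Rightarrow> complex) coproduct"
    and \<phi>' :: "('a \<Rightarrow> complex) \<Rightarrow> complex"
    and \<delta>' :: "('a \<Rightarrow> complex) multiplier"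
    and P :: "'a \<Rightarrow> ('a \<Rightarrow> complex) multiplier \<Rightarrow> complex"
  assumes dual_coproduct: "dual_coproduct A \<Delta> \<phi> \<Delta>'"
    and dual_left_integral: "dual_left_integral A \<psi> S \<epsilon> \<phi>'"
    and modular_element: "modular_element (dual_alg A \<Delta> \<phi>) \<Delta>' \<phi>' \<delta>'"
    and extended_pairing: "extended_pairing A \<Delta> \<phi> P"
begin

text \<open>\<open>\<phi>(w \<cdot>)\<close> is a functional \<open>\<psi>(S(\<cdot>) a)\<close> with \<open>a\<close> a multiple of \<open>S(w)\<close>, because
  \<open>\<psi>(S(x) S(w)) = \<psi>(S(w x)) = \<tau> \<phi>(w x)\<close>.\<close>

lemma dual_integral_lf:
  assumes w: "w \<in> C"
  shows "\<phi>' (lf w) = \<epsilon> w / \<tau>"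
proof -
  \<comment> \<open>the factor cancels the \<open>\<tau>\<close> of \<open>\<psi> \<circ> S = \<tau> \<phi>\<close>\<close>
  let ?a = "(1 / \<tau>) *\<^sub>C S w"
  have "lf w = (\<lambda>x. if x \<in> C then \<psi> (S x \<bullet> ?a) else 0)"
  proof (rule ext)
    fix x
    show "lf w x = (if x \<in> C then \<psi> (S x \<bullet> ?a) else 0)"
    proof (cases "x \<in> C")
      case x: True
      have "\<psi> (S x \<bullet> ?a) = (1 / \<tau>) * \<psi> (S (w \<bullet> x))"
        by (simp add: lin_simps S_mem w x linear_on_scaleC[OF psi_lin] mem_simps S_anti scaleC_complex_def)
      also have "\<dots> = \<phi> (w \<bullet> x)" using tau_nonzero by (simp add: psi_S mem_simps w x)
      finally show ?thesis using x by (simp add: lf_def)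
    qed (simp add: lf_def)
  qed
  moreover have "?a \<in> C" by (simp add: mem_simps S_mem w)
  ultimately have "\<phi>' (lf w) = \<epsilon> ?a"
    using dual_left_integral by (simp add: dual_left_integral_def)
  then show ?thesis
    by (simp add: linear_on_scaleC[OF eps_lin] S_mem w eps_S scaleC_complex_def)
qed

lemma dual_integral_lin: "linear_on CB UNIV \<phi>'"
proof (rule linear_onI)
  fix b b' c assume b: "b \<in> CB"
  obtain y where y: "y \<in> C" "b = lf y" using CB_cases'[OF b] by metis
  show "\<phi>' (c *\<^sub>C b) = c *\<^sub>C \<phi>' b"
    using y by (simp add: lf_scale[symmetric] dual_integral_lf mem_simps linear_on_scaleC[OF eps_lin] scaleC_complex_def)
  show "\<phi>' (b + b') = \<phi>' b + \<phi>' b'" if b': "b' \<in> CB"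
  proof -
    obtain y' where y': "y' \<in> C" "b' = lf y'" using CB_cases'[OF b'] by metis
    show ?thesis
      using y y' by (simp add: lf_add[symmetric] dual_integral_lf mem_simps linear_on_add[OF eps_lin] add_divide_distrib)
  qed
qed simp

lemma modular_mem: "\<delta>' \<in> carrier (mult_alg B)"
  and modular_invertible: "mult_invertible B \<delta>'"
  using modular_element by (simp_all add: modular_element_def mult_invertible_def)

text \<open>\<open>\<langle>z, \<delta> b'\<rangle> = \<chi>(b' \<triangleright> z)\<close> for \<open>b' = \<phi>(\<cdot> d)\<close>: the element \<open>\<Delta>(b)(1 \<otimes> b')\<close>, with second leg
  paired with \<open>z\<close>, is the functional \<open>\<phi>(\<sigma>\<^sup>-\<^sup>1(b' \<triangleright> z) c \<cdot>)\<close> when \<open>b = \<phi>(c \<cdot>)\<close>.\<close>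

lemma fst_modular:
  assumes d: "d \<in> C" and z: "z \<in> C"
  shows "fst \<delta>' (df d) z = \<epsilon> (si (E z d))"
proof -
  obtain c where c: "c \<in> C" "\<epsilon> c = 1" using eps_one by blast
  have b: "lf c \<in> CB" and b': "df d \<in> CB" by (simp_all add: c d lf_mem df_mem)
  have Ez: "E z d \<in> C" by (rule E_mem[OF z d])
  let ?t = "cov_right B \<Delta>' (lf c) (df d)"
  have dc: "in_alg (B \<otimes>\<^sub>A B) (\<Delta>' (lf c) \<cdot>\<^bsub>M2 B\<^esub> in_right B (df d))"
    "\<And>a a'. a \<in> C \<Longrightarrow> a' \<in> C \<Longrightarrow>
       tensor_pairing A B (a \<otimes> a') ?t = tensor_pairing A B (cl a a') (lf c \<otimes> df d)"
    using dual_coproduct b b' by (simp_all add: dual_coproduct_def Let_def)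
  have t: "?t \<in> TB"
    using dual2.AB.in_algD(1)[OF dc(1)] by (simp add: cov_right_def carrier_tensor_alg)
  obtain ps where ps: "set ps \<subseteq> CB \<times> CB" "?t = (\<Sum>(p, q)\<leftarrow>ps. p \<otimes> q)"
    using tensor_space_sum_list[OF t subspace_CB] by (elim exE conjE)
  have psm: "p \<in> CB" "q \<in> CB" if "(p, q) \<in> set ps" for p q using ps(1) that by auto
  have pair: "(\<Sum>(p, q)\<leftarrow>ps. p x * q z) = \<phi> ((si (E z d) \<bullet> c) \<bullet> x)" if x: "x \<in> C" for x
  proof -
    have "(\<Sum>(p, q)\<leftarrow>ps. p x * q z) = tlift CB CB (\<lambda>p q. p x * q z) ?t"
      unfolding ps(2) by (rule tlift_sum_list[OF subspace_CB subspace_CB bilinear_eval ps(1), symmetric])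
    also have "\<dots> = tL (\<lambda>u v. lf c u * df d v) (cl x z)"
      using dc(2)[OF x z] by (simp add: tensor_pairing_pure_left[OF t x z] tensor_pairing_pure_right[OF b b'])
    also have "\<dots> = lf c (sr (df d) (cl x z))"
      unfolding slice_right_def
      by (rule tlift_slice_right(2)[OF sub2 CB_func[OF b'] cl_mem[OF x z] CB_func[OF b], symmetric])
    also have "sr (df d) (cl x z) = sr (\<lambda>v. \<phi> (v \<bullet> d)) (cl x z)"
      by (rule fun_cong[OF sr_cong]) (simp add: df_apply)
    also have "\<dots> = x \<bullet> E z d" unfolding E_def by (rule sr_cl_rmul[OF phi_lin x z d])
    also have "lf c \<dots> = \<phi> ((c \<bullet> x) \<bullet> E z d)" by (simp add: lf_apply mem_simps x Ez c assoc)
    also have "\<dots> = \<phi> ((si (E z d) \<bullet> c) \<bullet> x)"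
      using phi_si[of "c \<bullet> x" "E z d"] by (simp add: mem_simps x Ez c assoc si_mem)
    finally show ?thesis .
  qed
  have "(\<Sum>(p, q)\<leftarrow>ps. q z *\<^sub>C p) = lf (si (E z d) \<bullet> c)"
  proof (rule ext)
    fix x
    have "(\<Sum>(p, q)\<leftarrow>ps. q z *\<^sub>C p) x = (\<Sum>(p, q)\<leftarrow>ps. p x * q z)"
      by (induction ps) (auto simp: scaleC_fun_def scaleC_complex_def)
    also have "\<dots> = lf (si (E z d) \<bullet> c) x"
    proof (cases "x \<in> C")
      case True then show ?thesis by (simp add: pair lf_apply)
    next
      case False
      have "(\<Sum>(p, q)\<leftarrow>ps. p x * q z) = (\<Sum>(p, q)\<leftarrow>ps. 0)"
        by (rule sum_list_cong_pairs) (simp add: CB_outside[OF psm(1) False])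
      also have "\<dots> = 0" by (induction ps) auto
      finally show ?thesis using False by (simp add: lf_def)
    qed
    finally show "(\<Sum>(p, q)\<leftarrow>ps. q z *\<^sub>C p) x = lf (si (E z d) \<bullet> c) x" .
  qed
  then have "\<epsilon> (si (E z d) \<bullet> c) / \<tau> = \<phi>' (\<Sum>(p, q)\<leftarrow>ps. q z *\<^sub>C p)"
    by (simp add: dual_integral_lf mem_simps si_mem Ez c)
  also have "\<dots> = (\<Sum>(p, q)\<leftarrow>ps. \<phi>' (q z *\<^sub>C p))"
    by (rule linear_on_sum_list(1)[OF dual_integral_lin subspace_CB])
      (simp add: complex_vector.subspace_scale[OF subspace_CB] psm)
  also have "\<dots> = (\<Sum>(p, q)\<leftarrow>ps. (\<phi>' p *\<^sub>C q) z)"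
    by (rule sum_list_cong_pairs)
      (simp add: linear_on_scaleC[OF dual_integral_lin] psm scaleC_apply scaleC_complex_def mult.commute)
  also have "\<dots> = (\<Sum>(p, q)\<leftarrow>ps. \<phi>' p *\<^sub>C q) z"
    by (induction ps) auto
  also have "(\<Sum>(p, q)\<leftarrow>ps. \<phi>' p *\<^sub>C q) = slice_left B \<phi>' ?t"
    unfolding slice_left_def ps(2)
    by (rule tlift_sum_list[OF subspace_CB subspace_CB
          bilinear_on_slice_left[OF dual_integral_lin subspace_CB] ps(1), symmetric])
  also have "\<dots> = fst (mslice_left B \<phi>' (\<Delta>' (lf c))) (df d)"
    using b' by (simp add: mslice_left_def cov_right_def)
  also have "\<dots> = fst (\<phi>' (lf c) *\<^sub>C \<delta>') (df d)"
    using modular_element b by (simp add: modular_element_def)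
  also have "\<dots> z = (1 / \<tau>) * fst \<delta>' (df d) z"
    by (simp add: scaleC_prod_def scaleC_fun_def dual_integral_lf c scaleC_complex_def)
  finally show ?thesis
    using tau_nonzero by (simp add: eps_mult si_mem Ez c)
qed

lemma pairing_lin: "m \<in> carrier (mult_alg B) \<Longrightarrow> func (\<lambda>a. P a m)"
  using extended_pairing by (simp add: extended_pairing_def Let_def bilinear_on_def)

lemma pairing_E:
  assumes m: "m \<in> carrier (mult_alg B)" and a: "a \<in> C" and d: "d \<in> C"
  shows "P (E a d) m = fst m (df d) a"
proof -
  have "P (E a d) m = P a (m \<cdot>\<^bsub>mult_alg B\<^esub> embed B (df d))"
    using extended_pairing m a df_mem[OF d] by (simp add: extended_pairing_def Let_def left_action_df d)
  also have "\<dots> = P a (embed B (fst m (df d)))"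
    by (simp add: dual.mult_embed m df_mem d)
  also have "\<dots> = fst m (df d) a"
    using extended_pairing a dual.fst_mem[OF m df_mem[OF d]] by (simp add: extended_pairing_def Let_def)
  finally show ?thesis .
qed

lemma pairing_Q:
  assumes m: "m \<in> carrier (mult_alg B)" and a: "a \<in> C" and y: "y \<in> C"
  shows "P (Q y a) m = snd m (lf y) a"
proof -
  have "P (Q y a) m = P a (embed B (lf y) \<cdot>\<^bsub>mult_alg B\<^esub> m)"
    using extended_pairing m a lf_mem[OF y] by (simp add: extended_pairing_def Let_def right_action_lf y)
  also have "\<dots> = P a (embed B (snd m (lf y)))"
    by (simp add: dual.embed_mult m lf_mem y)
  also have "\<dots> = snd m (lf y) a"
    using extended_pairing a dual.snd_mem[OF m lf_mem[OF y]] by (simp add: extended_pairing_def Let_def)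
  finally show ?thesis .
qed

lemma pairing_modular:
  assumes "z \<in> C"
  shows "P z \<delta>' = \<epsilon> (si z)"
  by (rule linear_on_eqI_E[OF pairing_lin[OF modular_mem] chi_lin _ assms])
    (simp add: pairing_E modular_mem fst_modular)

text \<open>\<open>b \<delta> = b \<circ> S\<^sup>2 \<circ> \<sigma>\<^sup>-\<^sup>1\<close>, a form that can be inverted.\<close>

lemma snd_modular:
  assumes b: "b \<in> CB" and a: "a \<in> C"
  shows "snd \<delta>' b a = b (S (S (si a)))"
proof -
  obtain y where y: "y \<in> C" "b = lf y" using CB_cases'[OF b] by metis
  have "snd \<delta>' b a = \<epsilon> (si (Q y a))"
    by (simp add: y(2) pairing_Q[OF modular_mem a y(1), symmetric] pairing_modular Q_mem y(1) a)
  also have "\<dots> = b (S (S (si a)))"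
    by (simp add: chi_Q y a lf_apply S_mem si_mem)
  finally show ?thesis .
qed

lemma pairing_modular_inverse:
  assumes "z \<in> C"
  shows "P z (mult_inverse B \<delta>') = \<epsilon> (\<sigma> z)"
proof -
  let ?n = "mult_inverse B \<delta>'"
  note n = dual.mult_inverse_props[OF modular_invertible]
  have "P (Q y a) ?n = \<epsilon> (\<sigma> (Q y a))" if y: "y \<in> C" and a: "a \<in> C" for y a
  proof -
    let ?f = "snd ?n (lf y)"
    have f: "?f \<in> CB" by (rule dual.snd_mem[OF n(1) lf_mem[OF y]])
    have "snd \<delta>' ?f = snd (?n \<cdot>\<^bsub>mult_alg B\<^esub> \<delta>') (lf y)" by (simp add: dual.snd_mult_alg)
    also have "\<dots> = lf y" by (simp add: n(3) dual.snd_mult_one lf_mem y)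
    finally have inv: "snd \<delta>' ?f = lf y" .
    \<comment> \<open>the point with \<open>S\<^sup>2(\<sigma>\<^sup>-\<^sup>1(w)) = a\<close>, at which \<open>b \<delta>\<^sup>-\<^sup>1 \<delta> = b\<close> computes \<open>(b \<delta>\<^sup>-\<^sup>1)(a)\<close>\<close>
    let ?w = "\<sigma> (Si (Si a))"
    have w: "?w \<in> C" by (simp add: sigma_mem Si_mem a)
    have "?f a = ?f (S (S (si ?w)))" by (simp add: si_sigma Si_mem a S_Si)
    also have "\<dots> = lf y ?w" using snd_modular[OF f w] by (simp add: inv)
    also have "\<dots> = \<epsilon> (\<sigma> (Q y a))" by (simp add: lf_apply w eta_Q y a sigma_SiSi)
    finally show ?thesis by (simp add: pairing_Q n(1) a y)
  qed
  then show ?thesis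
    by (intro linear_on_eqI_Q[OF pairing_lin[OF n(1)] eta_lin _ assms])
qed

end

theorem proposition2p3:
  fixes A :: "'a::complex_vector calg" and \<Delta> :: "'a coproduct"
    and \<phi> \<psi> \<epsilon> :: "'a \<Rightarrow> complex" and S \<sigma> \<sigma>' :: "'a \<Rightarrow> 'a"
    and \<Delta>' :: "('a \<Rightarrow> complex) coproduct"
    and \<phi>' :: "('a \<Rightarrow> complex) \<Rightarrow> complex"
    and \<delta>' :: "('a \<Rightarrow> complex) multiplier"
    and pairing :: "'a \<Rightarrow> ('a \<Rightarrow> complex) multiplier \<Rightarrow> complex"
  assumes "algebraic_quantum_group A \<Delta>"
    and "is_counit A \<Delta> \<epsilon>"
    and "is_antipode A \<Delta> \<epsilon> S"
    and "left_integral A \<Delta> \<phi>"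
    and "right_integral A \<Delta> \<psi>"
    and "\<forall>a\<in>carrier A. \<psi> a = \<phi> (S a)"
    and "modular_automorphism A \<phi> \<sigma>"
    and "modular_automorphism A \<psi> \<sigma>'"
    and "dual_coproduct A \<Delta> \<phi> \<Delta>'"
    and "dual_left_integral A \<psi> S \<epsilon> \<phi>'"
    and "modular_element (dual_alg A \<Delta> \<phi>) \<Delta>' \<phi>' \<delta>'"
    and "extended_pairing A \<Delta> \<phi> pairing"
    and "a \<in> carrier A"
  shows "pairing a \<delta>' = \<epsilon> (inv_into (carrier A) \<sigma> a) \<and>
         \<epsilon> (inv_into (carrier A) \<sigma> a) = \<epsilon> (inv_into (carrier A) \<sigma>' a) \<and>
         pairing a (mult_inverse (dual_alg A \<Delta> \<phi>) \<delta>') = \<epsilon> (\<sigma> a) \<and>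
         \<epsilon> (\<sigma> a) = \<epsilon> (\<sigma>' a)"
proof -
  interpret dual_quantum_group A \<Delta> \<epsilon> S \<phi> \<psi> \<sigma> \<sigma>' \<Delta>' \<phi>' \<delta>' pairing
    by unfold_locales (use assms in \<open>simp_all add: algebraic_quantum_group_def\<close>)
  show ?thesis
    using assms(13) by (simp add: pairing_modular pairing_modular_inverse eps_sigma' eps_si')
qed

end
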